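(* Let $G$ be a finite group, $p$ a prime, $\Bbbk$ a field of characteristic $p$, and $H\leq G$ a subgroup of index prime to $p$. Let $W$ be a $\Bbbk H$-module. For every $g\in G$, let $$\sigma_g:W{\downarrow}_{H[g]}\overset{\sim}{\longrightarrow}{}^{g}W{\downarrow}_{H[g]}$$ be an isomorphism in the stable category $\Bbbk H[g]\text{-}\mathrm{Stab}$, where $H[g]=H^g\cap H$, such that: (I) For every $h\in H$ (so that $H[h]=H$), $\sigma_h$ equals in $\Bbbk H\text{-}\mathrm{Stab}$ the canonical isomorphism $W\to{}^{h}W$, $w\mapsto hw$. (II) For all $g_1,g_2\in G$, with $H[g_2,g_1]:=H^{g_2g_1}\cap H^{g_1}\cap H$, one has $\sigma_{g_2}\circ\sigma_{g_1}=\sigma_{g_2g_1}$ as morphisms $W{\downarrow}_{H[g_2,g_1]}\to{}^{g_2g_1}W{\downarrow}_{H[g_2,g_1]}$ in $\Bbbk H[g_2,g_1]\text{-}\mathrm{Stab}$, where $\sigma_{g_1}$ and $\sigma_{g_2g_1}$ are restricted to $H[g_2,g_1]$ and $\sigma_{g_2}$ is $g_1$-twisted-restricted to $H[g_2,g_1]$, giving a morphism ${}^{g_1}W{\downarrow}_{H[g_2,g_1]}\to{}^{g_2g_1}W{\downarrow}_{H[g_2,g_1]}$. Then $W$ extends to $G$: there is a $\Bbbk G$-module $V$ and an isomorphism $f:V{\downarrow}_H\overset{\sim}{\to}W$ in $\Bbbk H\text{-}\mathrm{Stab}$ such that for every $g\in G$ the square $$\sigma_g\circ f=f\circ(g\cdot)\;:\;V{\downarrow}_{H[g]}\to{}^{g}W{\downarrow}_{H[g]}$$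 commutes in $\Bbbk H[g]\text{-}\mathrm{Stab}$, where $g\cdot:V{\downarrow}_{H[g]}\to{}^gV{\downarrow}_{H[g]}$ is $v\mapsto gv$, the left-hand $f$ is the restriction of $f$ to $H[g]$, and the right-hand $f$ is its $g$-twisted restriction ${}^gV{\downarrow}_{H[g]}\to{}^gW{\downarrow}_{H[g]}$. Moreover, the pair $(V,f)$ is unique up to unique isomorphism of such pairs: for any other such pair $(V',f')$ there is a unique isomorphism $v:V\to V'$ in $\Bbbk G\text{-}\mathrm{Stab}$ with $f'\circ v{\downarrow}_H=f$.
   Context: Notation: $H^g=g^{-1}Hg$ and ${}^gk=gkg^{-1}$. For a finite group $K$, $\Bbbk K\text{-}\mathrm{Stab}$ is the stable category: the objects are all left $\Bbbk K$-modules, and morphisms are $\Bbbk K$-linear maps modulo those factoring through a projective module. If $K\leq G$ and $g\in G$ satisfy ${}^gK\leq L$ for a subgroup $L\leq G$, the $g$-twisted restriction of a $\Bbbk L$-module $W$ to $K$, denoted ${}^gW{\downarrow}_K$, is the $\Bbbk$-module $W$ with $K$-action $k\cdot w:=({}^gk)w$. This is restriction along the conjugation homomorphism ${}^g(-):K\to L$; it is functorial and passes to stable categories. For $g=1$ it is ordinary restriction $W{\downarrow}_K$. Note ${}^{g}H[g]\leq H$ and ${}^{g_1}H[g_2,g_1]\leq H[g_2]$. *)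

theory Defs
  imports "HOL-Algebra.Module" "HOL-Algebra.Coset" "HOL-Computational_Algebra.Primes"
begin

text \<open>
  A left module over the group algebra of \<open>G\<close> over \<open>K\<close> is given as a \<open>K\<close>-module with a
  \<open>K\<close>-linear action of \<open>G\<close>. Only the values of \<open>act\<close> on \<open>carrier G\<close> matter, so a module over \<open>G\<close>
  is, unchanged, also a module over \<open>G\<lparr>carrier := L\<rparr>\<close> for every subgroup \<open>L\<close>: this is
  ordinary restriction. The fields \<open>mult\<close> and \<open>one\<close> inherited from \<open>module\<close> carry no meaning.
\<close>

record ('k, 'v, 'g) gmod = "('k, 'v) module" +
  act :: "'g \<Rightarrow> 'v \<Rightarrow> 'v"

locale gmodule = module K V + G: group G
  for K :: "('k, 'c) ring_scheme" and G :: "('g, 'd) monoid_scheme"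
    and V :: "('k, 'v, 'g) gmod" +
  assumes act_closed: "\<lbrakk>g \<in> carrier G; v \<in> carrier V\<rbrakk> \<Longrightarrow> act V g v \<in> carrier V"
    and act_add: "\<lbrakk>g \<in> carrier G; v \<in> carrier V; w \<in> carrier V\<rbrakk>
      \<Longrightarrow> act V g (v \<oplus>\<^bsub>V\<^esub> w) = act V g v \<oplus>\<^bsub>V\<^esub> act V g w"
    and act_smult: "\<lbrakk>g \<in> carrier G; a \<in> carrier K; v \<in> carrier V\<rbrakk>
      \<Longrightarrow> act V g (a \<odot>\<^bsub>V\<^esub> v) = a \<odot>\<^bsub>V\<^esub> act V g v"
    and act_one: "v \<in> carrier V \<Longrightarrow> act V \<one>\<^bsub>G\<^esub> v = v"
    and act_mult: "\<lbrakk>g \<in> carrier G; h \<in> carrier G; v \<in> carrier V\<rbrakk>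
      \<Longrightarrow> act V (g \<otimes>\<^bsub>G\<^esub> h) v = act V g (act V h v)"

definition gmod_hom ::
  "('k, 'c) ring_scheme \<Rightarrow> ('g, 'd) monoid_scheme \<Rightarrow> ('k, 'v, 'g) gmod \<Rightarrow> ('k, 'w, 'g) gmod
    \<Rightarrow> ('v \<Rightarrow> 'w) set" where
  "gmod_hom K G V W = {f \<in> carrier V \<rightarrow> carrier W.
     (\<forall>v\<in>carrier V. \<forall>v'\<in>carrier V. f (v \<oplus>\<^bsub>V\<^esub> v') = f v \<oplus>\<^bsub>W\<^esub> f v') \<and>
     (\<forall>a\<in>carrier K. \<forall>v\<in>carrier V. f (a \<odot>\<^bsub>V\<^esub> v) = a \<odot>\<^bsub>W\<^esub> f v) \<and>
     (\<forall>g\<in>carrier G. \<forall>v\<in>carrier V. f (act V g v) = act W g (f v))}"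

text \<open>
  The free module with basis \<open>X\<close>: finitely supported families \<open>\<phi>\<close> of coefficients, where
  \<open>\<phi> x s\<close> is the coefficient of the group element \<open>s\<close> in the component of \<open>x\<close>.
\<close>

definition free_gmod ::
  "('k, 'c) ring_scheme \<Rightarrow> ('g, 'd) monoid_scheme \<Rightarrow> 'x set \<Rightarrow> ('k, 'x \<Rightarrow> 'g \<Rightarrow> 'k, 'g) gmod" where
  "free_gmod K G X =
    \<lparr>carrier = {\<phi>. (\<forall>x\<in>X. \<forall>s\<in>carrier G. \<phi> x s \<in> carrier K) \<and>
                   (\<forall>x s. x \<notin> X \<or> s \<notin> carrier G \<longrightarrow> \<phi> x s = \<zero>\<^bsub>K\<^esub>) \<and>
                   finite {(x, s). \<phi> x s \<noteq> \<zero>\<^bsub>K\<^esub>}},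
     monoid.mult = undefined, one = undefined,
     ring.zero = (\<lambda>x s. \<zero>\<^bsub>K\<^esub>),
     ring.add = (\<lambda>\<phi> \<psi> x s. \<phi> x s \<oplus>\<^bsub>K\<^esub> \<psi> x s),
     smult = (\<lambda>a \<phi> x s. a \<otimes>\<^bsub>K\<^esub> \<phi> x s),
     act = (\<lambda>g \<phi> x s. if s \<in> carrier G then \<phi> x (inv\<^bsub>G\<^esub> g \<otimes>\<^bsub>G\<^esub> s) else \<zero>\<^bsub>K\<^esub>)\<rparr>"

text \<open>
  Projective means: direct summand of a free module. A basis \<open>X\<close> inside the type of the
  module suffices, since a direct summand of any free module, over a basis of whatever type, is a
  direct summand of the free module on its own carrier.
\<close>

definition projective_gmod ::
  "('k, 'c) ring_scheme \<Rightarrow> ('g, 'd) monoid_scheme \<Rightarrow> ('k, 'p, 'g) gmod \<Rightarrow> bool" where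
  "projective_gmod K G P \<longleftrightarrow> gmodule K G P \<and>
     (\<exists>X :: 'p set. \<exists>i\<in>gmod_hom K G P (free_gmod K G X). \<exists>r\<in>gmod_hom K G (free_gmod K G X) P.
        \<forall>x\<in>carrier P. r (i x) = x)"

text \<open>
  The type of the intermediate projective module is fixed, but this is no restriction: every map
  from a projective module to \<open>W\<close> lifts along the canonical surjection onto \<open>W\<close> from the free
  module on \<open>carrier W\<close>, so a map into \<open>W\<close> that factors through a projective module of any
  type factors through that free module.
\<close>

definition factors_proj ::
  "('k, 'c) ring_scheme \<Rightarrow> ('g, 'd) monoid_scheme \<Rightarrow> ('k, 'v, 'g) gmod \<Rightarrow> ('k, 'w, 'g) gmod
    \<Rightarrow> ('v \<Rightarrow> 'w) \<Rightarrow> bool" where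
  "factors_proj K G V W f \<longleftrightarrow> (\<exists>P :: ('k, 'w \<Rightarrow> 'g \<Rightarrow> 'k, 'g) gmod. projective_gmod K G P \<and>
     (\<exists>a\<in>gmod_hom K G V P. \<exists>b\<in>gmod_hom K G P W. \<forall>v\<in>carrier V. f v = b (a v)))"

text \<open>
  Morphisms in the stable category are equivalence classes of maps. Two maps that agree on
  the carrier are equivalent, so their values elsewhere are irrelevant.
\<close>

definition stab_rel ::
  "('k, 'c) ring_scheme \<Rightarrow> ('g, 'd) monoid_scheme \<Rightarrow> ('k, 'v, 'g) gmod \<Rightarrow> ('k, 'w, 'g) gmod
    \<Rightarrow> (('v \<Rightarrow> 'w) \<times> ('v \<Rightarrow> 'w)) set" where
  "stab_rel K G V W = {(f, f'). f \<in> gmod_hom K G V W \<and> f' \<in> gmod_hom K G V W \<and>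
     factors_proj K G V W (\<lambda>v. f v \<ominus>\<^bsub>W\<^esub> f' v)}"

definition stab_hom ::
  "('k, 'c) ring_scheme \<Rightarrow> ('g, 'd) monoid_scheme \<Rightarrow> ('k, 'v, 'g) gmod \<Rightarrow> ('k, 'w, 'g) gmod
    \<Rightarrow> ('v \<Rightarrow> 'w) set set" where
  "stab_hom K G V W = gmod_hom K G V W // stab_rel K G V W"

definition stab_class ::
  "('k, 'c) ring_scheme \<Rightarrow> ('g, 'd) monoid_scheme \<Rightarrow> ('k, 'v, 'g) gmod \<Rightarrow> ('k, 'w, 'g) gmod
    \<Rightarrow> ('v \<Rightarrow> 'w) \<Rightarrow> ('v \<Rightarrow> 'w) set" where
  "stab_class K G V W f = stab_rel K G V W `` {f}"

text \<open>The composite \<open>E \<circ> F\<close> of \<open>F : U \<rightarrow> V\<close> and \<open>E : V \<rightarrow> W\<close>.\<close>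

definition stab_comp ::
  "('k, 'c) ring_scheme \<Rightarrow> ('g, 'd) monoid_scheme \<Rightarrow> ('k, 'u, 'g) gmod \<Rightarrow> ('k, 'w, 'g) gmod
    \<Rightarrow> ('v \<Rightarrow> 'w) set \<Rightarrow> ('u \<Rightarrow> 'v) set \<Rightarrow> ('u \<Rightarrow> 'w) set" where
  "stab_comp K G U W E F = (\<Union>e\<in>E. \<Union>f\<in>F. stab_class K G U W (e \<circ> f))"

definition stab_iso ::
  "('k, 'c) ring_scheme \<Rightarrow> ('g, 'd) monoid_scheme \<Rightarrow> ('k, 'v, 'g) gmod \<Rightarrow> ('k, 'w, 'g) gmod
    \<Rightarrow> ('v \<Rightarrow> 'w) set set" where
  "stab_iso K G V W = {F \<in> stab_hom K G V W. \<exists>E\<in>stab_hom K G W V.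
     stab_comp K G V V E F = stab_class K G V V id \<and>
     stab_comp K G W W F E = stab_class K G W W id}"

definition twist :: "('g, 'd) monoid_scheme \<Rightarrow> 'g \<Rightarrow> ('k, 'v, 'g) gmod \<Rightarrow> ('k, 'v, 'g) gmod" where
  "twist G g V = V\<lparr>act := \<lambda>k. act V (g \<otimes>\<^bsub>G\<^esub> k \<otimes>\<^bsub>G\<^esub> inv\<^bsub>G\<^esub> g)\<rparr>"

text \<open>
  Restriction to \<open>L\<close> and \<open>g\<close>-twisted restriction to \<open>L\<close> of stable morphisms \<open>V \<rightarrow> W\<close>; neither
  changes the underlying maps.
\<close>

definition stab_res ::
  "('k, 'c) ring_scheme \<Rightarrow> ('g, 'd) monoid_scheme \<Rightarrow> 'g set \<Rightarrow> ('k, 'v, 'g) gmod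
    \<Rightarrow> ('k, 'w, 'g) gmod \<Rightarrow> ('v \<Rightarrow> 'w) set \<Rightarrow> ('v \<Rightarrow> 'w) set" where
  "stab_res K G L V W F = (\<Union>f\<in>F. stab_class K (G\<lparr>carrier := L\<rparr>) V W f)"

definition stab_twres ::
  "('k, 'c) ring_scheme \<Rightarrow> ('g, 'd) monoid_scheme \<Rightarrow> 'g \<Rightarrow> 'g set \<Rightarrow> ('k, 'v, 'g) gmod
    \<Rightarrow> ('k, 'w, 'g) gmod \<Rightarrow> ('v \<Rightarrow> 'w) set \<Rightarrow> ('v \<Rightarrow> 'w) set" where
  "stab_twres K G g L V W F =
     (\<Union>f\<in>F. stab_class K (G\<lparr>carrier := L\<rparr>) (twist G g V) (twist G g W) f)"

definition conj_subgroup :: "('g, 'd) monoid_scheme \<Rightarrow> 'g set \<Rightarrow> 'g \<Rightarrow> 'g set" where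
  "conj_subgroup G H g = (\<lambda>h. inv\<^bsub>G\<^esub> g \<otimes>\<^bsub>G\<^esub> h \<otimes>\<^bsub>G\<^esub> g) ` H"

definition meet1 :: "('g, 'd) monoid_scheme \<Rightarrow> 'g set \<Rightarrow> 'g \<Rightarrow> 'g set" where
  "meet1 G H g = conj_subgroup G H g \<inter> H"

definition meet2 :: "('g, 'd) monoid_scheme \<Rightarrow> 'g set \<Rightarrow> 'g \<Rightarrow> 'g \<Rightarrow> 'g set" where
  "meet2 G H g2 g1 = conj_subgroup G H (g2 \<otimes>\<^bsub>G\<^esub> g1) \<inter> conj_subgroup G H g1 \<inter> H"

definition has_char :: "('k, 'c) ring_scheme \<Rightarrow> nat \<Rightarrow> bool" where
  "has_char K p \<longleftrightarrow> (\<forall>n::nat. [n] \<cdot>\<^bsub>K\<^esub> \<one>\<^bsub>K\<^esub> = \<zero>\<^bsub>K\<^esub> \<longleftrightarrow> p dvd n)"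

text \<open>
  The compatible families of stable isomorphisms. In the cocycle condition the twisted
  restriction of \<open>\<sigma> g2 : W \<rightarrow> twist G g2 W\<close> ends in \<open>twist G g1 (twist G g2 W)\<close>, whose action
  on \<open>carrier G\<close> is that of \<open>twist G (g2 \<otimes>\<^bsub>G\<^esub> g1) W\<close>.
\<close>

definition descent_datum ::
  "('k, 'c) ring_scheme \<Rightarrow> ('g, 'd) monoid_scheme \<Rightarrow> 'g set \<Rightarrow> ('k, 'w, 'g) gmod
    \<Rightarrow> ('g \<Rightarrow> ('w \<Rightarrow> 'w) set) \<Rightarrow> bool" where
  "descent_datum K G H W \<sigma> \<longleftrightarrow>
     (\<forall>g\<in>carrier G. \<sigma> g \<in> stab_iso K (G\<lparr>carrier := meet1 G H g\<rparr>) W (twist G g W)) \<and>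
     (\<forall>h\<in>H. \<sigma> h = stab_class K (G\<lparr>carrier := H\<rparr>) W (twist G h W) (act W h)) \<and>
     (\<forall>g1\<in>carrier G. \<forall>g2\<in>carrier G.
        stab_comp K (G\<lparr>carrier := meet2 G H g2 g1\<rparr>) W (twist G (g2 \<otimes>\<^bsub>G\<^esub> g1) W)
          (stab_twres K G g1 (meet2 G H g2 g1) W (twist G g2 W) (\<sigma> g2))
          (stab_res K G (meet2 G H g2 g1) W (twist G g1 W) (\<sigma> g1))
        = stab_res K G (meet2 G H g2 g1) W (twist G (g2 \<otimes>\<^bsub>G\<^esub> g1) W) (\<sigma> (g2 \<otimes>\<^bsub>G\<^esub> g1)))"

definition extension ::
  "('k, 'c) ring_scheme \<Rightarrow> ('g, 'd) monoid_scheme \<Rightarrow> 'g set \<Rightarrow> ('k, 'w, 'g) gmod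
    \<Rightarrow> ('g \<Rightarrow> ('w \<Rightarrow> 'w) set) \<Rightarrow> ('k, 'v, 'g) gmod \<Rightarrow> ('v \<Rightarrow> 'w) set \<Rightarrow> bool" where
  "extension K G H W \<sigma> V f \<longleftrightarrow>
     gmodule K G V \<and> f \<in> stab_iso K (G\<lparr>carrier := H\<rparr>) V W \<and>
     (\<forall>g\<in>carrier G.
        stab_comp K (G\<lparr>carrier := meet1 G H g\<rparr>) V (twist G g W)
          (\<sigma> g) (stab_res K G (meet1 G H g) V W f)
        = stab_comp K (G\<lparr>carrier := meet1 G H g\<rparr>) V (twist G g W)
            (stab_twres K G g (meet1 G H g) V W f)
            (stab_class K (G\<lparr>carrier := meet1 G H g\<rparr>) V (twist G g V) (act V g)))"

end

theory Submission
  imports Defs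
begin

text \<open>
  Over a finite group \<open>L\<close> and a field, a map \<open>V \<rightarrow> W\<close> factors through a projective module exactly
  if it is a trace \<open>\<Sum>\<^sub>l l \<theta> l\<^sup>-\<^sup>1\<close> of a mere linear map \<open>\<theta>\<close> (\<open>factors_proj_iff_trace\<close>). So the
  stable category is the category of linear equivariant maps modulo traces, and every stable identity
  below is an equation with an explicit trace as its error term (\<open>stably_eq\<close>).

  The engine is an orbit argument (\<open>stably_eq_coset_sum\<close>). Let \<open>L\<close> permute the cosets \<open>Hg\<close> by
  right multiplication, and let a family of linear maps \<open>F\<^sub>g\<close> indexed by these cosets be permuted
  accordingly. If each \<open>F\<^sub>g\<close> vanishes stably over the stabiliser \<open>L \<inter> H\<^sup>g\<close>, then
  \<open>\<Sum>\<^sub>g F\<^sub>g\<close> vanishes stably over \<open>L\<close>, because a trace from a stabiliser, summed over the orbit, is a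
  trace from \<open>L\<close>. As the index \<open>n\<close> of \<open>H\<close> is invertible in the field, one may divide such sums by \<open>n\<close>.
  In particular restriction from \<open>G\<close> to \<open>H\<close> is faithful on stable morphisms (\<open>stably_eq_whole\<close>).

  Uniqueness. For two extensions \<open>(V, f)\<close> and \<open>(V', f')\<close> the map \<open>u = f'\<^sup>-\<^sup>1 f\<close> is only equivariant for
  \<open>H\<close>, but the compatibility with \<open>\<sigma>\<close> says \<open>g\<^sup>-\<^sup>1 u g = u\<close> stably over \<open>H \<inter> H\<^sup>g\<close>. So the average
  of the conjugates \<open>g\<^sup>-\<^sup>1 u g\<close>, which is equivariant for \<open>G\<close>, agrees stably with \<open>u\<close> over \<open>H\<close>. By
  faithfulness it is the only such map and is invertible.

  Existence. The maps \<open>\<sigma>\<^sub>g\<close> can be represented by linear maps \<open>\<tau>\<^sub>g\<close> with \<open>\<tau>\<^bsub>hgk\<^esub> = h \<tau>\<^sub>g k\<close> strictly for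
  \<open>h, k \<in> H\<close>: choose them on representatives of double cosets. If the extension \<open>V\<close> existed, it would
  be a direct summand of the module \<open>Ind\<close> induced from \<open>W\<close>, and the projection would be
  \<open>(\<epsilon> \<phi>)(x) = n\<^sup>-\<^sup>1 \<Sum>\<^sub>g \<tau>\<^bsub>x g\<^sup>-\<^sup>1\<^esub> (\<phi> g)\<close>. This formula makes sense in any case, and the cocycle condition
  together with the orbit argument shows that \<open>\<epsilon>\<close> is a stable idempotent (\<open>\<epsilon>_idempotent\<close>).

  It remains to split a stable idempotent \<open>e\<close> of a module \<open>I\<close>. The candidate is the homotopy limit of
  \<open>\<dots> \<rightarrow> I \<rightarrow> I \<rightarrow> I\<close> with all maps equal to \<open>e\<close>: it consists of the sequences
  \<open>x\<^sub>0, q\<^sub>0, x\<^sub>1, q\<^sub>1, \<dots>\<close> with \<open>x\<^sub>i = e x\<^bsub>i+1\<^esub> + b q\<^sub>i\<close>, where \<open>b : Q \<rightarrow> I\<close> is a surjection from a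
  projective module. That the identity of this limit agrees stably with the composite through \<open>I\<close> is
  true coordinate by coordinate; the obstruction to assembling the coordinates lies in a
  \<open>lim\<^sup>1\<close> term, which vanishes because \<open>e\<close> is idempotent (\<open>inc_coord\<close>).
\<close>

section \<open>Linear maps\<close>

definition lin ::
  "('k, 'c) ring_scheme \<Rightarrow> ('k, 'v, 'x) module_scheme \<Rightarrow> ('k, 'w, 'y) module_scheme
    \<Rightarrow> ('v \<Rightarrow> 'w) set" where
  "lin K V W = {f \<in> carrier V \<rightarrow> carrier W.
     (\<forall>v\<in>carrier V. \<forall>v'\<in>carrier V. f (v \<oplus>\<^bsub>V\<^esub> v') = f v \<oplus>\<^bsub>W\<^esub> f v') \<and>
     (\<forall>a\<in>carrier K. \<forall>v\<in>carrier V. f (a \<odot>\<^bsub>V\<^esub> v) = a \<odot>\<^bsub>W\<^esub> f v)}"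

lemma gmod_hom_iff:
  "f \<in> gmod_hom K G V W \<longleftrightarrow> f \<in> lin K V W \<and>
     (\<forall>g\<in>carrier G. \<forall>v\<in>carrier V. f (act V g v) = act W g (f v))"
  by (auto simp: gmod_hom_def lin_def)

lemma linI:
  assumes "\<And>v. v \<in> carrier V \<Longrightarrow> f v \<in> carrier W"
    and "\<And>v v'. v \<in> carrier V \<Longrightarrow> v' \<in> carrier V \<Longrightarrow> f (v \<oplus>\<^bsub>V\<^esub> v') = f v \<oplus>\<^bsub>W\<^esub> f v'"
    and "\<And>a v. a \<in> carrier K \<Longrightarrow> v \<in> carrier V \<Longrightarrow> f (a \<odot>\<^bsub>V\<^esub> v) = a \<odot>\<^bsub>W\<^esub> f v"
  shows "f \<in> lin K V W"
  using assms by (auto simp: lin_def)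

lemma lin_closed: "f \<in> lin K V W \<Longrightarrow> v \<in> carrier V \<Longrightarrow> f v \<in> carrier W"
  by (auto simp: lin_def)

lemma lin_add:
  "f \<in> lin K V W \<Longrightarrow> v \<in> carrier V \<Longrightarrow> v' \<in> carrier V \<Longrightarrow> f (v \<oplus>\<^bsub>V\<^esub> v') = f v \<oplus>\<^bsub>W\<^esub> f v'"
  by (auto simp: lin_def)

lemma lin_smult:
  "f \<in> lin K V W \<Longrightarrow> a \<in> carrier K \<Longrightarrow> v \<in> carrier V \<Longrightarrow> f (a \<odot>\<^bsub>V\<^esub> v) = a \<odot>\<^bsub>W\<^esub> f v"
  by (auto simp: lin_def)

lemma lin_cong:
  assumes "f \<in> lin K V W" "\<And>v. v \<in> carrier V \<Longrightarrow> g v = f v" "module K V"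
  shows "g \<in> lin K V W"
proof -
  interpret V: module K V by fact
  show ?thesis using assms(1,2) by (auto simp: lin_def Pi_def)
qed

lemma lin_comp: "f \<in> lin K V W \<Longrightarrow> g \<in> lin K U V \<Longrightarrow> (\<lambda>x. f (g x)) \<in> lin K U W"
  by (auto simp: lin_def Pi_def)

lemma lin_id: "(\<lambda>x. x) \<in> lin K V V"
  by (auto simp: lin_def)

lemma lin_zero:
  assumes "module K V" "module K W" "f \<in> lin K V W"
  shows "f \<zero>\<^bsub>V\<^esub> = \<zero>\<^bsub>W\<^esub>"
proof -
  interpret V: module K V by fact
  interpret W: module K W by fact
  have "f (\<zero>\<^bsub>K\<^esub> \<odot>\<^bsub>V\<^esub> \<zero>\<^bsub>V\<^esub>) = \<zero>\<^bsub>K\<^esub> \<odot>\<^bsub>W\<^esub> f \<zero>\<^bsub>V\<^esub>"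
    by (rule lin_smult[OF assms(3)]) auto
  moreover have "f \<zero>\<^bsub>V\<^esub> \<in> carrier W" by (rule lin_closed[OF assms(3)]) simp
  ultimately show ?thesis by simp
qed

lemma lin_uminus:
  assumes "module K V" "module K W" "f \<in> lin K V W" "v \<in> carrier V"
  shows "f (\<ominus>\<^bsub>V\<^esub> v) = \<ominus>\<^bsub>W\<^esub> f v"
proof -
  interpret V: module K V by fact
  interpret W: module K W by fact
  have fv: "f v \<in> carrier W" "f (\<ominus>\<^bsub>V\<^esub> v) \<in> carrier W"
    using assms(4) lin_closed[OF assms(3)] by auto
  have "f (\<ominus>\<^bsub>V\<^esub> v) \<oplus>\<^bsub>W\<^esub> f v = f (\<ominus>\<^bsub>V\<^esub> v \<oplus>\<^bsub>V\<^esub> v)"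
    using assms(4) lin_add[OF assms(3)] by auto
  also have "\<dots> = \<zero>\<^bsub>W\<^esub>" using assms(4) lin_zero[OF assms(1-3)] by (simp add: V.M.l_neg)
  finally show ?thesis using fv W.M.minus_equality by metis
qed


lemma lin_finsum:
  assumes "module K V" "module K W" "f \<in> lin K V W" "\<And>i. i \<in> A \<Longrightarrow> \<phi> i \<in> carrier V"
  shows "f (finsum V \<phi> A) = finsum W (\<lambda>i. f (\<phi> i)) A"
proof -
  interpret V: module K V by fact
  interpret W: module K W by fact
  show ?thesis
  proof (cases "finite A")
    case True
    then show ?thesis using assms(4)
    proof (induction A)
      case empty
      then show ?case using lin_zero[OF assms(1-3)] by simp
    next
      case (insert x F)
      then have "(\<lambda>i. f (\<phi> i)) \<in> F \<rightarrow> carrier W" "f (\<phi> x) \<in> carrier W" "\<phi> \<in> F \<rightarrow> carrier V"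
        using lin_closed[OF assms(3)] by auto
      with insert show ?case by (simp add: lin_add[OF assms(3)])
    qed
  next
    case False
    then show ?thesis using lin_zero[OF assms(1-3)] by simp
  qed
qed

lemma lin_plus:
  assumes "module K W" "f \<in> lin K V W" "f' \<in> lin K V W"
  shows "(\<lambda>v. f v \<oplus>\<^bsub>W\<^esub> f' v) \<in> lin K V W"
proof -
  interpret W: module K W by fact
  show ?thesis
    using lin_closed[OF assms(2)] lin_closed[OF assms(3)]
    by (intro linI) (auto simp: lin_add[OF assms(2)] lin_add[OF assms(3)] lin_smult[OF assms(2)]
      lin_smult[OF assms(3)] W.smult_r_distr W.M.a_ac)
qed

lemma lin_const_zero: "module K W \<Longrightarrow> (\<lambda>v. \<zero>\<^bsub>W\<^esub>) \<in> lin K V W"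
proof -
  assume "module K W"
  then interpret W: module K W .
  show ?thesis by (intro linI) auto
qed

lemma lin_neg:
  assumes "module K W" "f \<in> lin K V W"
  shows "(\<lambda>v. \<ominus>\<^bsub>W\<^esub> f v) \<in> lin K V W"
proof -
  interpret W: module K W by fact
  show ?thesis
    using lin_closed[OF assms(2)]
    by (intro linI) (auto simp: lin_add[OF assms(2)] lin_smult[OF assms(2)]
      W.M.minus_add W.smult_r_minus W.M.a_ac)
qed

lemma lin_scale:
  assumes "module K W" "f \<in> lin K V W" "c \<in> carrier K"
  shows "(\<lambda>v. c \<odot>\<^bsub>W\<^esub> f v) \<in> lin K V W"
proof -
  interpret W: module K W by fact
  show ?thesis
    using lin_closed[OF assms(2)] assms(3)
    by (intro linI) (auto simp: lin_add[OF assms(2)] lin_smult[OF assms(2)] W.smult_r_distr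
      W.smult_assoc1[symmetric] W.R.m_comm)
qed

lemma lin_sum:
  assumes V: "module K V" and "module K W" "\<And>i. i \<in> A \<Longrightarrow> f i \<in> lin K V W"
  shows "(\<lambda>v. finsum W (\<lambda>i. f i v) A) \<in> lin K V W"
proof -
  interpret W: module K W by fact
  show ?thesis
  proof (cases "finite A")
    case True
    then show ?thesis using assms(3)
    proof (induction A)
      case empty
      then show ?case using lin_const_zero[OF assms(2)] by simp
    next
      case (insert x F)
      have "(\<lambda>v. f x v \<oplus>\<^bsub>W\<^esub> finsum W (\<lambda>i. f i v) F) \<in> lin K V W"
        using insert by (intro lin_plus[OF assms(2)]) auto
      moreover have "finsum W (\<lambda>i. f i v) (insert x F) = f x v \<oplus>\<^bsub>W\<^esub> finsum W (\<lambda>i. f i v) F"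
        if "v \<in> carrier V" for v
        using insert that by (intro W.M.finsum_insert) (auto intro: lin_closed)
      ultimately show ?case by (rule lin_cong) (simp_all add: V)
    qed
  next
    case False
    then show ?thesis using lin_const_zero[OF assms(2)] by simp
  qed
qed

section \<open>Representations of subgroups and traces of linear maps\<close>

lemma (in abelian_monoid) finsum_fibres:
  assumes "finite A" "f \<in> A \<rightarrow> carrier G"
  shows "finsum G f A = (\<Oplus>b\<in>\<pi> ` A. \<Oplus>a\<in>{a\<in>A. \<pi> a = b}. f a)"
proof -
  have "finsum G f (\<Union>b\<in>\<pi> ` A. {a\<in>A. \<pi> a = b}) = (\<Oplus>b\<in>\<pi> ` A. \<Oplus>a\<in>{a\<in>A. \<pi> a = b}. f a)"
    by (rule add.finprod_UN_disjoint) (use assms in \<open>auto simp: pairwise_def disjnt_def\<close>)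
  moreover have "(\<Union>b\<in>\<pi> ` A. {a\<in>A. \<pi> a = b}) = A" by auto
  ultimately show ?thesis by simp
qed

lemma (in abelian_monoid) finsum_swap:
  assumes "finite A" "finite B" "\<And>a b. a \<in> A \<Longrightarrow> b \<in> B \<Longrightarrow> f a b \<in> carrier G"
  shows "(\<Oplus>a\<in>A. \<Oplus>b\<in>B. f a b) = (\<Oplus>b\<in>B. \<Oplus>a\<in>A. f a b)"
  using assms(1,3)
proof (induction A)
  case empty
  then show ?case by simp
next
  case (insert x F)
  have "(\<Oplus>a\<in>insert x F. \<Oplus>b\<in>B. f a b) = (\<Oplus>b\<in>B. f x b) \<oplus> (\<Oplus>a\<in>F. \<Oplus>b\<in>B. f a b)"
    using insert by (intro finsum_insert) (auto intro!: finsum_closed)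
  also have "\<dots> = (\<Oplus>b\<in>B. f x b) \<oplus> (\<Oplus>b\<in>B. \<Oplus>a\<in>F. f a b)"
    using insert by simp
  also have "\<dots> = (\<Oplus>b\<in>B. f x b \<oplus> (\<Oplus>a\<in>F. f a b))"
    using insert by (intro finsum_addf[symmetric]) (auto intro!: finsum_closed)
  also have "\<dots> = (\<Oplus>b\<in>B. \<Oplus>a\<in>insert x F. f a b)"
    using insert by (intro finsum_cong' finsum_insert[symmetric]) (auto intro!: finsum_closed)
  finally show ?case .
qed

lemma finsum_act_update [simp]: "finsum (W\<lparr>act := \<beta>\<rparr>) = finsum W"
  by (simp add: finsum_def finprod_def fun_eq_iff)

lemma lin_act_update_dom [simp]: "lin K (V\<lparr>act := \<alpha>\<rparr>) W = lin K V W"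
  by (simp add: lin_def)

lemma lin_act_update_cod [simp]: "lin K V (W\<lparr>act := \<beta>\<rparr>) = lin K V W"
  by (simp add: lin_def)

lemma module_act_update [simp]: "module K (V\<lparr>act := \<alpha>\<rparr>) \<longleftrightarrow> module K V"
proof -
  have "add_monoid (V\<lparr>act := \<alpha>\<rparr>) = add_monoid V" by simp
  then show ?thesis
    by (simp add: module_def module_axioms_def abelian_group_def abelian_group_axioms_def
        abelian_monoid_def)
qed

text \<open>
  A twist differs from the original module only in its action, so nothing that concerns the
  underlying vector space sees it.
\<close>

lemma twist_simps [simp]:
  "carrier (twist G g V) = carrier V" "ring.zero (twist G g V) = ring.zero V"
  "ring.add (twist G g V) = ring.add V" "smult (twist G g V) = smult V"
  "act (twist G g V) k = act V (g \<otimes>\<^bsub>G\<^esub> k \<otimes>\<^bsub>G\<^esub> inv\<^bsub>G\<^esub> g)"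
  "finsum (twist G g V) = finsum V" "lin K (twist G g V) X = lin K V X"
  "lin K Y (twist G g V) = lin K Y V" "module K (twist G g V) \<longleftrightarrow> module K V"
  by (simp_all add: twist_def)

lemma (in group) inv_mult_cancel [simp]:
  assumes "x \<in> carrier G" "y \<in> carrier G"
  shows "inv x \<otimes> (x \<otimes> y) = y" "x \<otimes> (inv x \<otimes> y) = y"
  using assms by (simp_all add: m_assoc[symmetric])

text \<open>
  Modules over a subgroup \<open>L\<close> of \<open>G\<close> keep the inverse and the unit of \<open>G\<close>; \<open>rep L V\<close> and \<open>hom L V W\<close>
  hide the record update by which the subgroup becomes a group.
\<close>

locale group_algebra =
  fixes K :: "('k, 'c) ring_scheme" and G :: "('g, 'd) monoid_scheme" (structure)
  assumes field: "field K" and group: "group G" and finite_group: "finite (carrier G)"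
begin

sublocale G: group G by (rule group)

abbreviation rep :: "'g set \<Rightarrow> ('k, 'v, 'g) gmod \<Rightarrow> bool" where
  "rep L V \<equiv> gmodule K (G\<lparr>carrier := L\<rparr>) V"

abbreviation hom :: "'g set \<Rightarrow> ('k, 'v, 'g) gmod \<Rightarrow> ('k, 'w, 'g) gmod \<Rightarrow> ('v \<Rightarrow> 'w) set" where
  "hom L V W \<equiv> gmod_hom K (G\<lparr>carrier := L\<rparr>) V W"

lemma finite_subgroup: "subgroup L G \<Longrightarrow> finite L"
  using finite_group finite_subset subgroup.subset by blast

lemma rep_module: "rep L V \<Longrightarrow> module K V"
  by (rule gmodule.axioms(1))

lemma rep_act_lin: "rep L V \<Longrightarrow> g \<in> L \<Longrightarrow> act V g \<in> lin K V V"
  by (intro linI) (simp_all add: gmodule.act_closed gmodule.act_add gmodule.act_smult)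

lemma rep_act_closed: "rep L V \<Longrightarrow> g \<in> L \<Longrightarrow> v \<in> carrier V \<Longrightarrow> act V g v \<in> carrier V"
  by (simp add: gmodule.act_closed)

lemma rep_act_one: "rep L V \<Longrightarrow> v \<in> carrier V \<Longrightarrow> act V \<one> v = v"
  using gmodule.act_one by fastforce

lemma rep_act_mult:
  "rep L V \<Longrightarrow> g \<in> L \<Longrightarrow> h \<in> L \<Longrightarrow> v \<in> carrier V \<Longrightarrow>
    act V (g \<otimes> h) v = act V g (act V h v)"
  using gmodule.act_mult by fastforce

lemma rep_act_inv:
  assumes "rep L V" "subgroup L G" "g \<in> L" "v \<in> carrier V"
  shows "act V (inv g) (act V g v) = v" "act V g (act V (inv g) v) = v"
proof -
  have i: "inv g \<in> L" "g \<in> carrier G"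
    using assms(2,3) by (auto simp: subgroup.m_inv_closed subgroup.mem_carrier)
  show "act V (inv g) (act V g v) = v"
    using rep_act_mult[OF assms(1) i(1) assms(3,4)] i rep_act_one[OF assms(1,4)] by simp
  show "act V g (act V (inv g) v) = v"
    using rep_act_mult[OF assms(1) assms(3) i(1) assms(4)] i rep_act_one[OF assms(1,4)] by simp
qed

lemma repI:
  assumes "subgroup L G" "module K V"
    and "\<And>g. g \<in> L \<Longrightarrow> act V g \<in> lin K V V"
    and "\<And>v. v \<in> carrier V \<Longrightarrow> act V \<one> v = v"
    and "\<And>g h v. g \<in> L \<Longrightarrow> h \<in> L \<Longrightarrow> v \<in> carrier V \<Longrightarrow>
      act V (g \<otimes> h) v = act V g (act V h v)"
  shows "rep L V"
proof -
  have "group (G\<lparr>carrier := L\<rparr>)" using assms(1) by (rule G.subgroup_imp_group)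
  then show ?thesis
    using assms(2-5) lin_closed[OF assms(3)] lin_add[OF assms(3)] lin_smult[OF assms(3)]
    by (auto simp: gmodule_def gmodule_axioms_def)
qed

lemma rep_subgroup:
  assumes "rep L V" "subgroup M G" "M \<subseteq> L"
  shows "rep M V"
  using assms rep_act_lin[OF assms(1)] rep_act_mult[OF assms(1)] rep_act_one[OF assms(1)]
  by (intro repI) (auto simp: rep_module subset_iff)

lemma rep_twist:
  assumes V: "rep L V" and M: "subgroup M G" and g: "g \<in> carrier G"
    and sub: "\<And>k. k \<in> M \<Longrightarrow> g \<otimes> k \<otimes> inv g \<in> L"
  shows "rep M (twist G g V)"
proof (rule repI[OF M])
  show "module K (twist G g V)" using rep_module[OF V] by simp
  show "act (twist G g V) k \<in> lin K (twist G g V) (twist G g V)" if "k \<in> M" for k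
    using rep_act_lin[OF V sub[OF that]] by (simp add: twist_def)
  show "act (twist G g V) \<one> v = v" if "v \<in> carrier (twist G g V)" for v
    using g that rep_act_one[OF V] by simp
  show "act (twist G g V) (k \<otimes> h) v = act (twist G g V) k (act (twist G g V) h v)"
    if "k \<in> M" "h \<in> M" "v \<in> carrier (twist G g V)" for k h v
  proof -
    have "k \<in> carrier G" "h \<in> carrier G" using that M by (auto simp: subgroup.mem_carrier)
    then have "g \<otimes> (k \<otimes> h) \<otimes> inv g
      = (g \<otimes> k \<otimes> inv g) \<otimes> (g \<otimes> h \<otimes> inv g)"
      using g by (simp add: G.m_assoc)
    then show ?thesis using rep_act_mult[OF V sub sub] that by simp
  qed
qed

lemma hom_iff:
  "f \<in> hom L V W \<longleftrightarrow> f \<in> lin K V W \<and> (\<forall>g\<in>L. \<forall>v\<in>carrier V. f (act V g v) = act W g (f v))"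
  by (simp add: gmod_hom_iff)

lemma hom_lin: "f \<in> hom L V W \<Longrightarrow> f \<in> lin K V W"
  by (simp add: hom_iff)

lemma hom_closed: "f \<in> hom L V W \<Longrightarrow> v \<in> carrier V \<Longrightarrow> f v \<in> carrier W"
  by (auto simp: hom_iff intro: lin_closed)

lemma hom_act: "f \<in> hom L V W \<Longrightarrow> g \<in> L \<Longrightarrow> v \<in> carrier V \<Longrightarrow> f (act V g v) = act W g (f v)"
  by (simp add: hom_iff)

lemma hom_comp: "f \<in> hom L V W \<Longrightarrow> g \<in> hom L U V \<Longrightarrow> (\<lambda>x. f (g x)) \<in> hom L U W"
  by (auto simp: hom_iff lin_comp lin_closed)

lemma hom_subgroup: "f \<in> hom L V W \<Longrightarrow> M \<subseteq> L \<Longrightarrow> f \<in> hom M V W"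
  by (auto simp: hom_iff)

lemma hom_id: "(\<lambda>x. x) \<in> hom L V V"
  by (auto simp: hom_iff lin_id)

definition trace ::
  "'g set \<Rightarrow> ('k, 'v, 'g) gmod \<Rightarrow> ('k, 'w, 'g) gmod \<Rightarrow> ('v \<Rightarrow> 'w) \<Rightarrow> 'v \<Rightarrow> 'w" where
  "trace L V W \<theta> v = (\<Oplus>\<^bsub>W\<^esub>g\<in>L. act W g (\<theta> (act V (inv g) v)))"

text \<open>
  The maps differ by a trace. Neither map need be equivariant: the relation is also used for the
  single summands of an equivariant sum, which are only linear.
\<close>

definition stably_eq ::
  "'g set \<Rightarrow> ('k, 'v, 'g) gmod \<Rightarrow> ('k, 'w, 'g) gmod \<Rightarrow> ('v \<Rightarrow> 'w) \<Rightarrow> ('v \<Rightarrow> 'w) \<Rightarrow> bool" where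
  "stably_eq L V W f f' \<longleftrightarrow>
     (\<exists>\<theta>\<in>lin K V W. \<forall>v\<in>carrier V. f v = f' v \<oplus>\<^bsub>W\<^esub> trace L V W \<theta> v)"

context
  fixes L :: "'g set" and V :: "('k, 'v, 'g) gmod" and W :: "('k, 'w, 'g) gmod"
  assumes L: "subgroup L G" and V: "rep L V" and W: "rep L W"
begin

lemma conjugate_lin:
  assumes "\<theta> \<in> lin K V W" "g \<in> L"
  shows "(\<lambda>v. act W g (\<theta> (act V (inv g) v))) \<in> lin K V W"
proof -
  have "inv g \<in> L" using assms(2) L by (simp add: subgroup.m_inv_closed)
  then show ?thesis
    using lin_comp[OF rep_act_lin[OF W assms(2)] lin_comp[OF assms(1) rep_act_lin[OF V]]] by simp
qed

lemma trace_summand_closed: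
  assumes "\<theta> \<in> lin K V W" "v \<in> carrier V"
  shows "(\<lambda>g. act W g (\<theta> (act V (inv g) v))) \<in> L \<rightarrow> carrier W"
  using lin_closed[OF conjugate_lin[OF assms(1)] assms(2)] by auto

lemma trace_lin: "\<theta> \<in> lin K V W \<Longrightarrow> trace L V W \<theta> \<in> lin K V W"
  unfolding trace_def[abs_def]
  by (intro lin_sum[OF rep_module[OF V] rep_module[OF W]] conjugate_lin)

lemma trace_closed: "\<theta> \<in> lin K V W \<Longrightarrow> v \<in> carrier V \<Longrightarrow> trace L V W \<theta> v \<in> carrier W"
  by (rule lin_closed[OF trace_lin])

lemma trace_hom:
  assumes \<theta>: "\<theta> \<in> lin K V W"
  shows "trace L V W \<theta> \<in> hom L V W"
proof -
  interpret W: module K W by (rule rep_module[OF W])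
  have "trace L V W \<theta> (act V h v) = act W h (trace L V W \<theta> v)"
    if h: "h \<in> L" and v: "v \<in> carrier V" for h v
  proof -
    have hG: "h \<in> carrier G" "\<And>g. g \<in> L \<Longrightarrow> g \<in> carrier G" "inv h \<in> L"
      using h L by (auto simp: subgroup.mem_carrier subgroup.m_inv_closed)
    have img: "(\<lambda>g. h \<otimes> g) ` L = L"
    proof
      show "(\<lambda>g. h \<otimes> g) ` L \<subseteq> L" using h L by (auto simp: subgroup.m_closed)
      show "L \<subseteq> (\<lambda>g. h \<otimes> g) ` L"
      proof
        fix g assume g: "g \<in> L"
        then have "g = h \<otimes> (inv h \<otimes> g)" "inv h \<otimes> g \<in> L"
          using hG L by (auto simp: G.m_assoc[symmetric] subgroup.m_closed)
        then show "g \<in> (\<lambda>g. h \<otimes> g) ` L" by blast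
      qed
    qed
    have inj: "inj_on (\<lambda>g. h \<otimes> g) L" using hG by (auto intro!: inj_onI)
    let ?f = "\<lambda>g. act W g (\<theta> (act V (inv g) (act V h v)))"
    have hv: "act V h v \<in> carrier V" by (rule rep_act_closed[OF V h v])
    have "trace L V W \<theta> (act V h v) = finsum W ?f ((\<lambda>g. h \<otimes> g) ` L)"
      by (simp add: trace_def img)
    also have "\<dots> = finsum W (\<lambda>g. ?f (h \<otimes> g)) L"
      using trace_summand_closed[OF \<theta> hv] by (intro W.M.finsum_reindex inj) (auto simp: img)
    also have "\<dots> = finsum W (\<lambda>g. act W h (act W g (\<theta> (act V (inv g) v)))) L"
    proof (rule W.M.finsum_cong'[OF refl])
      show "(\<lambda>g. act W h (act W g (\<theta> (act V (inv g) v)))) \<in> L \<rightarrow> carrier W"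
        using trace_summand_closed[OF \<theta> v] rep_act_closed[OF W h] by auto
      fix g assume g: "g \<in> L"
      then have gi: "inv g \<in> L" using L by (simp add: subgroup.m_inv_closed)
      have "act V (inv (h \<otimes> g)) (act V h v) = act V (inv g) v"
        using hG g gi v hv by (simp add: G.inv_mult_group rep_act_mult[OF V] rep_act_inv[OF V L h])
      then show "?f (h \<otimes> g) = act W h (act W g (\<theta> (act V (inv g) v)))"
        using g gi h v by (simp add: rep_act_mult[OF W] lin_closed[OF \<theta>] rep_act_closed[OF V])
    qed
    also have "\<dots> = act W h (trace L V W \<theta> v)"
      unfolding trace_def using trace_summand_closed[OF \<theta> v]
      by (intro lin_finsum[symmetric, OF rep_module[OF W] rep_module[OF W] rep_act_lin[OF W h]]) auto
    finally show ?thesis .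
  qed
  with trace_lin[OF \<theta>] show ?thesis by (auto simp: hom_iff)
qed

lemma trace_plus:
  assumes "\<theta> \<in> lin K V W" "\<eta> \<in> lin K V W" "v \<in> carrier V"
  shows "trace L V W (\<lambda>v. \<theta> v \<oplus>\<^bsub>W\<^esub> \<eta> v) v = trace L V W \<theta> v \<oplus>\<^bsub>W\<^esub> trace L V W \<eta> v"
proof -
  interpret W: module K W by (rule rep_module[OF W])
  have i: "inv g \<in> L" if "g \<in> L" for g using that L by (simp add: subgroup.m_inv_closed)
  have "trace L V W (\<lambda>v. \<theta> v \<oplus>\<^bsub>W\<^esub> \<eta> v) v
    = (\<Oplus>\<^bsub>W\<^esub>g\<in>L. act W g (\<theta> (act V (inv g) v)) \<oplus>\<^bsub>W\<^esub> act W g (\<eta> (act V (inv g) v)))"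
    unfolding trace_def
    using i assms trace_summand_closed[OF assms(1,3)] trace_summand_closed[OF assms(2,3)]
    by (intro W.M.finsum_cong')
      (auto simp: lin_add[OF rep_act_lin[OF W]] lin_closed rep_act_closed[OF V])
  also have "\<dots> = trace L V W \<theta> v \<oplus>\<^bsub>W\<^esub> trace L V W \<eta> v"
    unfolding trace_def
    using trace_summand_closed[OF assms(1,3)] trace_summand_closed[OF assms(2,3)]
    by (rule W.M.finsum_addf)
  finally show ?thesis .
qed

lemma trace_postcompose:
  assumes "rep L X" "a \<in> hom L W X" "\<theta> \<in> lin K V W" "v \<in> carrier V"
  shows "trace L V X (\<lambda>v. a (\<theta> v)) v = a (trace L V W \<theta> v)"
proof -
  interpret X: module K X by (rule rep_module[OF assms(1)])
  have "a (trace L V W \<theta> v) = (\<Oplus>\<^bsub>X\<^esub>g\<in>L. a (act W g (\<theta> (act V (inv g) v))))"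
    unfolding trace_def using trace_summand_closed[OF assms(3,4)]
    by (intro lin_finsum[OF rep_module[OF W] rep_module[OF assms(1)] hom_lin[OF assms(2)]]) auto
  also have "\<dots> = trace L V X (\<lambda>v. a (\<theta> v)) v"
    unfolding trace_def
  proof (rule X.M.finsum_cong'[OF refl])
    fix g assume g: "g \<in> L"
    then have i: "inv g \<in> L" using L by (simp add: subgroup.m_inv_closed)
    show "a (act W g (\<theta> (act V (inv g) v))) = act X g (a (\<theta> (act V (inv g) v)))"
      using g i assms(4)
      by (intro hom_act[OF assms(2)]) (auto intro!: lin_closed[OF assms(3)] rep_act_closed[OF V])
  next
    show "(\<lambda>g. act X g (a (\<theta> (act V (inv g) v)))) \<in> L \<rightarrow> carrier X"
      using assms(4) L by (auto intro!: rep_act_closed[OF assms(1)] hom_closed[OF assms(2)]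
          lin_closed[OF assms(3)] rep_act_closed[OF V] subgroup.m_inv_closed)
  qed
  finally show ?thesis ..
qed

lemma trace_precompose:
  assumes "rep L U" "b \<in> hom L U V" "\<theta> \<in> lin K V W" "u \<in> carrier U"
  shows "trace L U W (\<lambda>u. \<theta> (b u)) u = trace L V W \<theta> (b u)"
proof -
  interpret W: module K W by (rule rep_module[OF W])
  show ?thesis
    unfolding trace_def
  proof (rule W.M.finsum_cong'[OF refl])
    show "(\<lambda>g. act W g (\<theta> (act V (inv g) (b u)))) \<in> L \<rightarrow> carrier W"
      using trace_summand_closed[OF assms(3) hom_closed[OF assms(2,4)]] .
  next
    fix g assume g: "g \<in> L"
    then have i: "inv g \<in> L" using L by (simp add: subgroup.m_inv_closed)
    show "act W g (\<theta> (b (act U (inv g) u))) = act W g (\<theta> (act V (inv g) (b u)))"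
      using hom_act[OF assms(2) i assms(4)] by simp
  qed
qed

text \<open>
  Writing \<open>L\<close> as a union of cosets \<open>M r\<close>, the trace over \<open>L\<close> is the trace over \<open>M\<close> of
  \<open>\<Sum>\<^sub>r r \<theta> r\<^sup>-\<^sup>1\<close>.
\<close>

lemma trace_restrict:
  assumes \<theta>: "\<theta> \<in> lin K V W" and M: "subgroup M G" "M \<subseteq> L"
  shows "\<exists>\<eta>\<in>lin K V W. \<forall>v\<in>carrier V. trace L V W \<theta> v = trace M V W \<eta> v"
proof -
  interpret W: module K W by (rule rep_module[OF W])
  define r where "r C = (SOME g. g \<in> L \<and> M #> g = C)" for C
  define \<eta> where "\<eta> v = (\<Oplus>\<^bsub>W\<^esub>C\<in>(\<lambda>g. M #> g) ` L. act W (r C) (\<theta> (act V (inv (r C)) v)))" for v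
  have fin: "finite L" "finite M" by (simp_all add: finite_subgroup L M)
  have r: "r C \<in> L" "M #> r C = C" if "C \<in> (\<lambda>g. M #> g) ` L" for C
  proof -
    have "\<exists>g. g \<in> L \<and> M #> g = C" using that by auto
    from someI_ex[OF this] show "r C \<in> L" "M #> r C = C" by (auto simp: r_def)
  qed
  have \<eta>: "\<eta> \<in> lin K V W"
    unfolding \<eta>_def[abs_def]
    by (intro lin_sum[OF rep_module[OF V] rep_module[OF W]] conjugate_lin \<theta> r(1))
  have "trace L V W \<theta> v = trace M V W \<eta> v" if v: "v \<in> carrier V" for v
  proof -
    let ?f = "\<lambda>g. act W g (\<theta> (act V (inv g) v))"
    let ?R = "(\<lambda>g. M #> g) ` L"
    have f: "?f \<in> L \<rightarrow> carrier W" by (rule trace_summand_closed[OF \<theta> v])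
    \<comment> \<open>The sum over \<open>L\<close> is cut into the cosets \<open>M r\<close>, and each of them is parametrised by \<open>M\<close>.\<close>
    have fibre: "{g\<in>L. M #> g = C} = (\<lambda>k. k \<otimes> r C) ` M" if C: "C \<in> ?R" for C
    proof -
      have rL: "r C \<in> L" "r C \<in> carrier G" using r(1)[OF C] L by (auto simp: subgroup.mem_carrier)
      have "g \<in> (\<lambda>k. k \<otimes> r C) ` M" if "g \<in> L" "M #> g = C" for g
      proof -
        have "g \<in> M #> r C"
          using that r(2)[OF C] G.rcos_self[of g M] M(1) L by (auto simp: subgroup.mem_carrier)
        then show ?thesis by (auto simp: r_coset_def)
      qed
      moreover have "k \<otimes> r C \<in> L \<and> M #> (k \<otimes> r C) = C" if "k \<in> M" for k
      proof
        show "k \<otimes> r C \<in> L" using that rL M L by (auto simp: subgroup.m_closed)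
        have "k \<in> carrier G" "M \<subseteq> carrier G" using that M(1) by (auto simp: subgroup.mem_carrier)
        then have "M #> (k \<otimes> r C) = (M #> k) #> r C"
          using rL by (simp add: G.coset_mult_assoc)
        also have "M #> k = M" using that M(1) \<open>k \<in> carrier G\<close> by (simp add: G.coset_join2)
        finally show "M #> (k \<otimes> r C) = C" using r(2)[OF C] by simp
      qed
      ultimately show ?thesis by auto
    qed
    have kr: "act W (k \<otimes> r C) (\<theta> (act V (inv (k \<otimes> r C)) v))
      = act W k (act W (r C) (\<theta> (act V (inv (r C)) (act V (inv k) v))))"
      if "k \<in> M" "C \<in> ?R" for k C
    proof -
      have m: "k \<in> L" "r C \<in> L" "inv k \<in> L" "inv (r C) \<in> L" "k \<in> carrier G" "r C \<in> carrier G"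
        using that r(1)[OF that(2)] M L by (auto simp: subgroup.m_inv_closed subgroup.mem_carrier)
      then show ?thesis
        using v by (simp add: G.inv_mult_group rep_act_mult[OF V] rep_act_mult[OF W]
            lin_closed[OF \<theta>] rep_act_closed[OF V])
    qed
    have "trace L V W \<theta> v = (\<Oplus>\<^bsub>W\<^esub>C\<in>?R. \<Oplus>\<^bsub>W\<^esub>g\<in>{g\<in>L. M #> g = C}. ?f g)"
      unfolding trace_def by (rule W.M.finsum_fibres[OF fin(1) f])
    also have "\<dots> = (\<Oplus>\<^bsub>W\<^esub>C\<in>?R. \<Oplus>\<^bsub>W\<^esub>k\<in>M. ?f (k \<otimes> r C))"
    proof (rule W.M.finsum_cong'[OF refl])
      have kL: "k \<otimes> r C \<in> L" if "k \<in> M" "C \<in> ?R" for k C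
        using that r(1)[OF that(2)] M L by (auto simp: subgroup.m_closed)
      have fk: "?f (k \<otimes> r C) \<in> carrier W" if "k \<in> M" "C \<in> ?R" for k C
        using funcset_mem[OF f kL[OF that]] .
      show "(\<lambda>C. \<Oplus>\<^bsub>W\<^esub>k\<in>M. ?f (k \<otimes> r C)) \<in> ?R \<rightarrow> carrier W"
      proof
        fix C assume "C \<in> ?R"
        then show "(\<Oplus>\<^bsub>W\<^esub>k\<in>M. ?f (k \<otimes> r C)) \<in> carrier W"
          by (intro W.M.finsum_closed Pi_I fk)
      qed
      fix C assume C: "C \<in> ?R"
      have rC: "r C \<in> carrier G" using r(1)[OF C] L by (auto simp: subgroup.mem_carrier)
      have "inj_on (\<lambda>k. k \<otimes> r C) M"
        using rC M(1) by (auto intro!: inj_onI simp: subgroup.mem_carrier)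
      then show "(\<Oplus>\<^bsub>W\<^esub>g\<in>{g\<in>L. M #> g = C}. ?f g) = (\<Oplus>\<^bsub>W\<^esub>k\<in>M. ?f (k \<otimes> r C))"
        unfolding fibre[OF C] using fk[OF _ C] by (intro W.M.finsum_reindex) auto
    qed
    also have "\<dots> = (\<Oplus>\<^bsub>W\<^esub>k\<in>M. \<Oplus>\<^bsub>W\<^esub>C\<in>?R. ?f (k \<otimes> r C))"
    proof (rule W.M.finsum_swap)
      fix C k assume "C \<in> ?R" "k \<in> M"
      then have "k \<otimes> r C \<in> L" using r(1) M L by (auto simp: subgroup.m_closed)
      then show "?f (k \<otimes> r C) \<in> carrier W" using funcset_mem[OF f] by blast
    qed (use fin in auto)
    also have "\<dots> = trace M V W \<eta> v"
      unfolding trace_def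
    proof (rule W.M.finsum_cong'[OF refl])
      show "(\<lambda>k. act W k (\<eta> (act V (inv k) v))) \<in> M \<rightarrow> carrier W"
        using v M L by (auto intro!: rep_act_closed[OF W] lin_closed[OF \<eta>] rep_act_closed[OF V]
            subgroup.m_inv_closed)
      fix k assume k: "k \<in> M"
      then have kL: "k \<in> L" "inv k \<in> L" using M L by (auto simp: subgroup.m_inv_closed)
      let ?v = "act V (inv k) v"
      have v': "?v \<in> carrier V" by (rule rep_act_closed[OF V kL(2) v])
      have cl: "act W (r C) (\<theta> (act V (inv (r C)) ?v)) \<in> carrier W" if "C \<in> ?R" for C
        using funcset_mem[OF trace_summand_closed[OF \<theta> v'] r(1)[OF that]] .
      have "(\<Oplus>\<^bsub>W\<^esub>C\<in>?R. ?f (k \<otimes> r C))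
        = (\<Oplus>\<^bsub>W\<^esub>C\<in>?R. act W k (act W (r C) (\<theta> (act V (inv (r C)) ?v))))"
        using cl kr[OF k] by (intro W.M.finsum_cong') (auto intro!: rep_act_closed[OF W kL(1)])
      also have "\<dots> = act W k (\<eta> ?v)"
        unfolding \<eta>_def
        by (rule lin_finsum[symmetric, OF rep_module[OF W] rep_module[OF W] rep_act_lin[OF W kL(1)] cl])
      finally show "(\<Oplus>\<^bsub>W\<^esub>C\<in>?R. ?f (k \<otimes> r C)) = act W k (\<eta> ?v)" .
    qed
    finally show ?thesis .
  qed
  with \<eta> show ?thesis by blast
qed

end

end

section \<open>Equality of maps modulo traces\<close>

context group_algebra
begin

context
  fixes L :: "'g set" and V :: "('k, 'v, 'g) gmod" and W :: "('k, 'w, 'g) gmod"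
  assumes L: "subgroup L G" and V: "rep L V" and W: "rep L W"
begin

lemma trace_zero: "v \<in> carrier V \<Longrightarrow> trace L V W (\<lambda>v. \<zero>\<^bsub>W\<^esub>) v = \<zero>\<^bsub>W\<^esub>"
proof -
  interpret W: module K W by (rule rep_module[OF W])
  show ?thesis
    by (simp add: trace_def lin_zero[OF rep_module[OF W] rep_module[OF W] rep_act_lin[OF W]]
        cong: W.M.finsum_cong)
qed

lemma trace_uminus:
  assumes "\<theta> \<in> lin K V W" "v \<in> carrier V"
  shows "trace L V W (\<lambda>v. \<ominus>\<^bsub>W\<^esub> \<theta> v) v = \<ominus>\<^bsub>W\<^esub> trace L V W \<theta> v"
proof -
  interpret W: module K W by (rule rep_module[OF W])
  have "(\<lambda>w. \<ominus>\<^bsub>W\<^esub> w) \<in> hom L W W"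
    using lin_neg[OF rep_module[OF W] lin_id] lin_uminus[OF rep_module[OF W] rep_module[OF W]
      rep_act_lin[OF W]] by (auto simp: hom_iff)
  from trace_postcompose[OF L V W W this assms] show ?thesis .
qed

lemma stably_eq_of_eq:
  assumes "\<And>v. v \<in> carrier V \<Longrightarrow> f v = f' v" "\<And>v. v \<in> carrier V \<Longrightarrow> f' v \<in> carrier W"
  shows "stably_eq L V W f f'"
proof -
  interpret W: module K W by (rule rep_module[OF W])
  show ?thesis
    unfolding stably_eq_def
    by (rule bexI[of _ "\<lambda>v. \<zero>\<^bsub>W\<^esub>"])
      (use assms trace_zero lin_const_zero[OF rep_module[OF W]] in auto)
qed

lemma stably_eq_sym:
  assumes "stably_eq L V W f f'" "\<And>v. v \<in> carrier V \<Longrightarrow> f' v \<in> carrier W"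
  shows "stably_eq L V W f' f"
proof -
  interpret W: module K W by (rule rep_module[OF W])
  obtain \<theta> where \<theta>: "\<theta> \<in> lin K V W" "\<And>v. v \<in> carrier V \<Longrightarrow> f v = f' v \<oplus>\<^bsub>W\<^esub> trace L V W \<theta> v"
    using assms(1) by (auto simp: stably_eq_def)
  have "f' v = f v \<oplus>\<^bsub>W\<^esub> trace L V W (\<lambda>v. \<ominus>\<^bsub>W\<^esub> \<theta> v) v" if "v \<in> carrier V" for v
    using \<theta>(2)[OF that] assms(2)[OF that] trace_closed[OF L V W \<theta>(1) that]
    by (simp add: trace_uminus[OF \<theta>(1) that] W.M.a_assoc W.M.r_neg)
  then show ?thesis using lin_neg[OF rep_module[OF W] \<theta>(1)] by (auto simp: stably_eq_def)
qed

lemma stably_eq_trans: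
  assumes "stably_eq L V W f f'" "stably_eq L V W f' f''" "\<And>v. v \<in> carrier V \<Longrightarrow> f'' v \<in> carrier W"
  shows "stably_eq L V W f f''"
proof -
  interpret W: module K W by (rule rep_module[OF W])
  obtain \<theta> where \<theta>: "\<theta> \<in> lin K V W" "\<And>v. v \<in> carrier V \<Longrightarrow> f v = f' v \<oplus>\<^bsub>W\<^esub> trace L V W \<theta> v"
    using assms(1) by (auto simp: stably_eq_def)
  obtain \<eta> where \<eta>: "\<eta> \<in> lin K V W" "\<And>v. v \<in> carrier V \<Longrightarrow> f' v = f'' v \<oplus>\<^bsub>W\<^esub> trace L V W \<eta> v"
    using assms(2) by (auto simp: stably_eq_def)
  have "f v = f'' v \<oplus>\<^bsub>W\<^esub> trace L V W (\<lambda>v. \<eta> v \<oplus>\<^bsub>W\<^esub> \<theta> v) v" if "v \<in> carrier V" for v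
    using \<theta>(2)[OF that] \<eta>(2)[OF that] assms(3)[OF that] trace_closed[OF L V W \<theta>(1) that]
      trace_closed[OF L V W \<eta>(1) that]
    by (simp add: trace_plus[OF L V W \<eta>(1) \<theta>(1) that] W.M.a_assoc)
  then show ?thesis
    using lin_plus[OF rep_module[OF W] \<eta>(1) \<theta>(1)] by (auto simp: stably_eq_def)
qed

lemma stably_eq_plus:
  assumes "stably_eq L V W f f'" "stably_eq L V W g g'"
    and "\<And>v. v \<in> carrier V \<Longrightarrow> f' v \<in> carrier W" "\<And>v. v \<in> carrier V \<Longrightarrow> g' v \<in> carrier W"
  shows "stably_eq L V W (\<lambda>v. f v \<oplus>\<^bsub>W\<^esub> g v) (\<lambda>v. f' v \<oplus>\<^bsub>W\<^esub> g' v)"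
proof -
  interpret W: module K W by (rule rep_module[OF W])
  obtain \<theta> where \<theta>: "\<theta> \<in> lin K V W" "\<And>v. v \<in> carrier V \<Longrightarrow> f v = f' v \<oplus>\<^bsub>W\<^esub> trace L V W \<theta> v"
    using assms(1) by (auto simp: stably_eq_def)
  obtain \<eta> where \<eta>: "\<eta> \<in> lin K V W" "\<And>v. v \<in> carrier V \<Longrightarrow> g v = g' v \<oplus>\<^bsub>W\<^esub> trace L V W \<eta> v"
    using assms(2) by (auto simp: stably_eq_def)
  have "f v \<oplus>\<^bsub>W\<^esub> g v = (f' v \<oplus>\<^bsub>W\<^esub> g' v) \<oplus>\<^bsub>W\<^esub> trace L V W (\<lambda>v. \<theta> v \<oplus>\<^bsub>W\<^esub> \<eta> v) v" if "v \<in> carrier V" for v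
    using \<theta>(2)[OF that] \<eta>(2)[OF that] assms(3,4)[OF that] trace_closed[OF L V W \<theta>(1) that]
      trace_closed[OF L V W \<eta>(1) that]
    by (simp add: trace_plus[OF L V W \<theta>(1) \<eta>(1) that] W.M.a_ac)
  then show ?thesis
    using lin_plus[OF rep_module[OF W] \<theta>(1) \<eta>(1)] by (auto simp: stably_eq_def)
qed

lemma stably_eq_postcompose:
  assumes "stably_eq L V W f f'" "rep L X" "a \<in> hom L W X"
    and "\<And>v. v \<in> carrier V \<Longrightarrow> f' v \<in> carrier W"
  shows "stably_eq L V X (\<lambda>v. a (f v)) (\<lambda>v. a (f' v))"
proof -
  obtain \<theta> where \<theta>: "\<theta> \<in> lin K V W" "\<And>v. v \<in> carrier V \<Longrightarrow> f v = f' v \<oplus>\<^bsub>W\<^esub> trace L V W \<theta> v"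
    using assms(1) by (auto simp: stably_eq_def)
  have "a (f v) = a (f' v) \<oplus>\<^bsub>X\<^esub> trace L V X (\<lambda>v. a (\<theta> v)) v" if "v \<in> carrier V" for v
    using \<theta>(2)[OF that] assms(4)[OF that] trace_closed[OF L V W \<theta>(1) that]
    by (simp add: trace_postcompose[OF L V W assms(2,3) \<theta>(1) that] lin_add[OF hom_lin[OF assms(3)]])
  then show ?thesis
    using lin_comp[OF hom_lin[OF assms(3)] \<theta>(1)] by (auto simp: stably_eq_def)
qed

lemma stably_eq_precompose:
  assumes "stably_eq L V W f f'" "rep L U" "b \<in> hom L U V"
  shows "stably_eq L U W (\<lambda>u. f (b u)) (\<lambda>u. f' (b u))"
proof -
  obtain \<theta> where \<theta>: "\<theta> \<in> lin K V W" "\<And>v. v \<in> carrier V \<Longrightarrow> f v = f' v \<oplus>\<^bsub>W\<^esub> trace L V W \<theta> v"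
    using assms(1) by (auto simp: stably_eq_def)
  have "f (b u) = f' (b u) \<oplus>\<^bsub>W\<^esub> trace L U W (\<lambda>u. \<theta> (b u)) u" if "u \<in> carrier U" for u
    using \<theta>(2) hom_closed[OF assms(3) that]
    by (simp add: trace_precompose[OF L V W assms(2,3) \<theta>(1) that])
  then show ?thesis
    using lin_comp[OF \<theta>(1) hom_lin[OF assms(3)]] by (auto simp: stably_eq_def)
qed

lemma stably_eq_subgroup:
  assumes "stably_eq L V W f f'" "subgroup M G" "M \<subseteq> L"
  shows "stably_eq M V W f f'"
proof -
  obtain \<theta> where \<theta>: "\<theta> \<in> lin K V W" "\<And>v. v \<in> carrier V \<Longrightarrow> f v = f' v \<oplus>\<^bsub>W\<^esub> trace L V W \<theta> v"
    using assms(1) by (auto simp: stably_eq_def)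
  show ?thesis
    using trace_restrict[OF L V W \<theta>(1) assms(2,3)] \<theta>(2) by (auto simp: stably_eq_def)
qed

end

text \<open>
  The field \<open>act\<close> of a module over \<open>L\<close> is arbitrary outside \<open>L\<close>. This lemma identifies modules that
  agree where it matters, such as iterated twists.
\<close>

lemma stably_eq_act_cong:
  assumes L: "subgroup L G" and V: "rep L V" and W: "rep L W"
    and V': "\<And>l v. l \<in> L \<Longrightarrow> v \<in> carrier V \<Longrightarrow> \<alpha> l v = act V l v"
    and W': "\<And>l w. l \<in> L \<Longrightarrow> w \<in> carrier W \<Longrightarrow> \<beta> l w = act W l w"
  shows "stably_eq L (V\<lparr>act := \<alpha>\<rparr>) (W\<lparr>act := \<beta>\<rparr>) f f' \<longleftrightarrow> stably_eq L V W f f'"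
proof -
  interpret W: module K W by (rule rep_module[OF W])
  have "trace L (V\<lparr>act := \<alpha>\<rparr>) (W\<lparr>act := \<beta>\<rparr>) \<theta> v = trace L V W \<theta> v"
    if "\<theta> \<in> lin K V W" "v \<in> carrier V" for \<theta> v
    unfolding trace_def finsum_act_update
    using trace_summand_closed[OF L V W that] that V' W' L
    by (intro W.M.finsum_cong')
      (auto simp: subgroup.m_inv_closed lin_closed[OF that(1)] rep_act_closed[OF V])
  then show ?thesis by (auto simp: stably_eq_def)
qed

lemma conj_subgroup_iff:
  assumes "g \<in> carrier G" "k \<in> carrier G" "L \<subseteq> carrier G"
  shows "k \<in> conj_subgroup G L g \<longleftrightarrow> g \<otimes> k \<otimes> inv g \<in> L"
proof
  assume "k \<in> conj_subgroup G L g"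
  then obtain h where "h \<in> L" "k = inv g \<otimes> h \<otimes> g" by (auto simp: conj_subgroup_def)
  then show "g \<otimes> k \<otimes> inv g \<in> L" using assms by (auto simp: G.m_assoc)
next
  assume *: "g \<otimes> k \<otimes> inv g \<in> L"
  have "k = inv g \<otimes> (g \<otimes> k \<otimes> inv g) \<otimes> g" using assms by (simp add: G.m_assoc)
  then show "k \<in> conj_subgroup G L g" using * by (auto simp: conj_subgroup_def)
qed

lemma conj_subgroup_carrier:
  "g \<in> carrier G \<Longrightarrow> L \<subseteq> carrier G \<Longrightarrow> conj_subgroup G L g \<subseteq> carrier G"
  by (auto simp: conj_subgroup_def)

lemma conj_mult:
  assumes "g \<in> carrier G" "k \<in> carrier G" "l \<in> carrier G"
  shows "g \<otimes> (k \<otimes> l) \<otimes> inv g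
    = (g \<otimes> k \<otimes> inv g) \<otimes> (g \<otimes> l \<otimes> inv g)"
  using assms by (simp add: G.m_assoc)

lemma conj_subgroup_subgroup:
  assumes "subgroup L G" "g \<in> carrier G"
  shows "subgroup (conj_subgroup G L g) G"
proof -
  have sub: "conj_subgroup G L g \<subseteq> carrier G"
    using assms by (simp add: conj_subgroup_carrier subgroup.subset)
  have iff: "k \<in> conj_subgroup G L g \<longleftrightarrow> g \<otimes> k \<otimes> inv g \<in> L" if "k \<in> carrier G" for k
    using conj_subgroup_iff[OF assms(2) that] assms(1) by (simp add: subgroup.subset)
  show ?thesis
  proof (rule G.subgroupI[OF sub])
    have "\<one> \<in> conj_subgroup G L g" using assms by (simp add: iff subgroup.one_closed)
    then show "conj_subgroup G L g \<noteq> {}" by blast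
    fix a assume a: "a \<in> conj_subgroup G L g"
    then have aG: "a \<in> carrier G" using sub by blast
    have "g \<otimes> inv a \<otimes> inv g = inv (g \<otimes> a \<otimes> inv g)"
      using aG assms by (simp add: G.inv_mult_group G.m_assoc)
    then show "inv a \<in> conj_subgroup G L g"
      using a aG assms(1) by (simp add: iff subgroup.m_inv_closed)
    fix b assume b: "b \<in> conj_subgroup G L g"
    then have bG: "b \<in> carrier G" using sub by blast
    show "a \<otimes> b \<in> conj_subgroup G L g"
      using a b aG bG assms by (simp add: iff conj_mult subgroup.m_closed)
  qed
qed

text \<open>
  Conjugation by \<open>g\<close> carries the summands of the trace over \<open>L\<close> to those over \<open>g\<^sup>-\<^sup>1 L g\<close>.
\<close>

lemma stably_eq_twist:
  assumes L: "subgroup L G" and V: "rep L V" and W: "rep L W" and g: "g \<in> carrier G"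
    and eq: "stably_eq L V W f f'"
  shows "stably_eq (conj_subgroup G L g) (twist G g V) (twist G g W) f f'"
proof -
  interpret W: module K W by (rule rep_module[OF W])
  obtain \<theta> where \<theta>: "\<theta> \<in> lin K V W" "\<And>v. v \<in> carrier V \<Longrightarrow> f v = f' v \<oplus>\<^bsub>W\<^esub> trace L V W \<theta> v"
    using eq by (auto simp: stably_eq_def)
  have inj: "inj_on (\<lambda>h. inv g \<otimes> h \<otimes> g) L"
    using g L by (auto intro!: inj_onI simp: subgroup.mem_carrier)
  have "trace (conj_subgroup G L g) (twist G g V) (twist G g W) \<theta> v = trace L V W \<theta> v"
    if v: "v \<in> carrier V" for v
  proof -
    let ?f = "\<lambda>k. act W (g \<otimes> k \<otimes> inv g) (\<theta> (act V (g \<otimes> inv k \<otimes> inv g) v))"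
    have e: "?f (inv g \<otimes> h \<otimes> g) = act W h (\<theta> (act V (inv h) v))" if "h \<in> L" for h
    proof -
      have "h \<in> carrier G" using that L by (simp add: subgroup.mem_carrier)
      then show ?thesis using g by (simp add: G.m_assoc G.inv_mult_group)
    qed
    have "finsum W ?f (conj_subgroup G L g)
      = finsum W (\<lambda>h. ?f (inv g \<otimes> h \<otimes> g)) L"
      unfolding conj_subgroup_def using trace_summand_closed[OF L V W \<theta>(1) v] e
      by (intro W.M.finsum_reindex inj) auto
    also have "\<dots> = trace L V W \<theta> v"
      unfolding trace_def using trace_summand_closed[OF L V W \<theta>(1) v] e
      by (intro W.M.finsum_cong') auto
    finally show ?thesis by (simp add: trace_def)
  qed
  with \<theta> show ?thesis unfolding stably_eq_def by (intro bexI[of _ \<theta>]) auto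
qed

end

section \<open>Sums over cosets\<close>

definition coset_rep :: "'g set \<Rightarrow> 'g" where
  "coset_rep C = (SOME g. g \<in> C)"

text \<open>
  Meant for functions \<open>F\<close> on \<open>G\<close> that are constant on the cosets \<open>Hg\<close>; then the choice of
  representatives is immaterial.
\<close>

definition coset_sum ::
  "('g, 'd) monoid_scheme \<Rightarrow> 'g set \<Rightarrow> ('w, 'y) ring_scheme \<Rightarrow> ('g \<Rightarrow> 'w) \<Rightarrow> 'w" where
  "coset_sum G H W F = (\<Oplus>\<^bsub>W\<^esub>C\<in>rcosets\<^bsub>G\<^esub> H. F (coset_rep C))"

context group_algebra
begin

context
  fixes H :: "'g set"
  assumes H: "subgroup H G"
begin

lemma coset_rep:
  assumes "C \<in> rcosets H"
  shows "coset_rep C \<in> carrier G" "H #> coset_rep C = C"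
proof -
  obtain g where g: "g \<in> carrier G" "C = H #> g" using assms by (auto simp: RCOSETS_def)
  have "g \<in> C" using G.rcos_self[OF g(1) H] g(2) by simp
  then have r: "coset_rep C \<in> C" unfolding coset_rep_def by (rule someI)
  then show "coset_rep C \<in> carrier G"
    using g G.r_coset_subset_G[OF subgroup.subset[OF H]] by auto
  show "H #> coset_rep C = C"
    using G.repr_independence[OF _ g(1) H] r g(2) by simp
qed

lemma coset_rep_factor:
  assumes "g \<in> carrier G"
  shows "\<exists>h\<in>H. coset_rep (H #> g) = h \<otimes> g"
proof -
  have "g \<in> H #> g" using G.rcos_self[OF assms H] .
  then have "coset_rep (H #> g) \<in> H #> g" unfolding coset_rep_def by (rule someI)
  then show ?thesis by (auto simp: r_coset_def)
qed

lemma coset_invariant_rep: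
  assumes "\<And>h g. h \<in> H \<Longrightarrow> g \<in> carrier G \<Longrightarrow> F (h \<otimes> g) = F g" "g \<in> carrier G"
  shows "F (coset_rep (H #> g)) = F g"
  using coset_rep_factor[OF assms(2)] assms by auto

lemma finite_rcosets: "finite (rcosets H)"
  using finite_group by (simp add: RCOSETS_def)

lemma coset_shift:
  assumes "C \<in> rcosets H" "k \<in> carrier G"
  shows "C #> k = H #> (coset_rep C \<otimes> k)" "C #> k \<in> rcosets H"
proof -
  have "(H #> coset_rep C) #> k = H #> (coset_rep C \<otimes> k)"
    by (rule G.coset_mult_assoc[OF subgroup.subset[OF H] coset_rep(1)[OF assms(1)] assms(2)])
  then show 1: "C #> k = H #> (coset_rep C \<otimes> k)" using coset_rep(2)[OF assms(1)] by simp
  show "C #> k \<in> rcosets H"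
    unfolding 1 using coset_rep[OF assms(1)] assms(2) subgroup.subset[OF H]
    by (intro G.rcosetsI) auto
qed

lemma coset_assoc:
  assumes "C \<in> rcosets H" "k \<in> carrier G" "l \<in> carrier G"
  shows "(C #> k) #> l = C #> (k \<otimes> l)"
proof -
  have "C \<subseteq> carrier G" using subgroup.rcosets_carrier[OF H group assms(1)] .
  then show ?thesis using assms by (simp add: G.coset_mult_assoc)
qed

lemma coset_one: "C \<in> rcosets H \<Longrightarrow> C #> \<one> = C"
  using subgroup.rcosets_carrier[OF H group] by simp

lemma coset_sum_shift:
  assumes W: "module K W"
    and F: "\<And>g. g \<in> carrier G \<Longrightarrow> F g \<in> carrier W"
    and inv: "\<And>h g. h \<in> H \<Longrightarrow> g \<in> carrier G \<Longrightarrow> F (h \<otimes> g) = F g"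
    and k: "k \<in> carrier G"
  shows "coset_sum G H W (\<lambda>g. F (g \<otimes> k)) = coset_sum G H W F"
proof -
  interpret W: module K W by (rule W)
  let ?R = "rcosets H"
  have sub: "(\<lambda>C. C #> k) ` ?R \<subseteq> ?R" using coset_shift(2)[OF _ k] by auto
  have img: "(\<lambda>C. C #> k) ` ?R = ?R"
  proof
    show "?R \<subseteq> (\<lambda>C. C #> k) ` ?R"
    proof
      fix C assume C: "C \<in> ?R"
      then have "C = (C #> inv k) #> k" using k by (simp add: coset_assoc coset_one)
      moreover have "C #> inv k \<in> ?R" using C k by (intro coset_shift) auto
      ultimately show "C \<in> (\<lambda>C. C #> k) ` ?R" by blast
    qed
  qed (rule sub)
  have inj: "inj_on (\<lambda>C. C #> k) ?R"
  proof (rule inj_onI)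
    fix C D assume "C \<in> ?R" "D \<in> ?R" "C #> k = D #> k"
    moreover have "(C #> k) #> inv k = C" "(D #> k) #> inv k = D"
      using k \<open>C \<in> ?R\<close> \<open>D \<in> ?R\<close> by (simp_all add: coset_assoc coset_one)
    ultimately show "C = D" by metis
  qed
  have "coset_sum G H W F = finsum W (\<lambda>C. F (coset_rep C)) ((\<lambda>C. C #> k) ` ?R)"
    by (simp add: coset_sum_def img)
  also have "\<dots> = finsum W (\<lambda>C. F (coset_rep (C #> k))) ?R"
    using F coset_rep(1) sub by (intro W.M.finsum_reindex inj) auto
  also have "\<dots> = coset_sum G H W (\<lambda>g. F (g \<otimes> k))"
    unfolding coset_sum_def
  proof (rule W.M.finsum_cong'[OF refl])
    show "(\<lambda>C. F (coset_rep C \<otimes> k)) \<in> ?R \<rightarrow> carrier W"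
      using k by (auto intro!: F coset_rep(1))
    fix C assume C: "C \<in> ?R"
    show "F (coset_rep (C #> k)) = F (coset_rep C \<otimes> k)"
      unfolding coset_shift(1)[OF C k]
      using coset_rep(1)[OF C] k by (intro coset_invariant_rep[of F] inv) auto
  qed
  finally show ?thesis ..
qed

lemma coset_sum_closed:
  assumes "module K W" "\<And>g. g \<in> carrier G \<Longrightarrow> F g \<in> carrier W"
  shows "coset_sum G H W F \<in> carrier W"
proof -
  interpret W: module K W by fact
  show ?thesis unfolding coset_sum_def using assms(2) coset_rep(1) by (intro W.M.finsum_closed) auto
qed

lemma coset_sum_cong:
  assumes "module K W" "\<And>g. g \<in> carrier G \<Longrightarrow> F' g \<in> carrier W"
    and "\<And>g. g \<in> carrier G \<Longrightarrow> F g = F' g"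
  shows "coset_sum G H W F = coset_sum G H W F'"
proof -
  interpret W: module K W by fact
  show ?thesis unfolding coset_sum_def using assms(2,3) coset_rep(1) by (intro W.M.finsum_cong') auto
qed

lemma coset_sum_apply:
  assumes "module K W" "module K X" "a \<in> lin K W X" "\<And>g. g \<in> carrier G \<Longrightarrow> F g \<in> carrier W"
  shows "a (coset_sum G H W F) = coset_sum G H X (\<lambda>g. a (F g))"
  unfolding coset_sum_def
  using assms(4) coset_rep(1) by (intro lin_finsum[OF assms(1-3)]) auto

lemma coset_sum_lin:
  assumes "module K V" "module K W" "\<And>g. g \<in> carrier G \<Longrightarrow> F g \<in> lin K V W"
  shows "(\<lambda>v. coset_sum G H W (\<lambda>g. F g v)) \<in> lin K V W"
  unfolding coset_sum_def using coset_rep(1) by (intro lin_sum[OF assms(1,2)] assms(3))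

lemma coset_sum_const:
  assumes "module K W" "w \<in> carrier W"
  shows "coset_sum G H W (\<lambda>_. w) = ([card (rcosets H)] \<cdot>\<^bsub>K\<^esub> \<one>\<^bsub>K\<^esub>) \<odot>\<^bsub>W\<^esub> w"
proof -
  interpret W: module K W by fact
  have "finsum W (\<lambda>_. w) A = ([card A] \<cdot>\<^bsub>K\<^esub> \<one>\<^bsub>K\<^esub>) \<odot>\<^bsub>W\<^esub> w" if "finite A" for A :: "'g set set"
    using that
  proof (induction A)
    case empty
    then show ?case using assms(2) by simp
  next
    case (insert x F)
    then have "finsum W (\<lambda>_. w) (insert x F) = w \<oplus>\<^bsub>W\<^esub> ([card F] \<cdot>\<^bsub>K\<^esub> \<one>\<^bsub>K\<^esub>) \<odot>\<^bsub>W\<^esub> w"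
      using assms(2) by simp
    moreover have "[card (insert x F)] \<cdot>\<^bsub>K\<^esub> \<one>\<^bsub>K\<^esub> = \<one>\<^bsub>K\<^esub> \<oplus>\<^bsub>K\<^esub> [card F] \<cdot>\<^bsub>K\<^esub> \<one>\<^bsub>K\<^esub>"
      using insert by (simp add: W.R.a_comm)
    ultimately show ?case using assms(2) by (simp add: W.smult_l_distr)
  qed
  then show ?thesis unfolding coset_sum_def using finite_rcosets by simp
qed

text \<open>
  It suffices to treat one \<open>L\<close>-orbit of cosets at a time. Let \<open>C\<close> be a coset in it with stabiliser
  \<open>M\<close>, and let \<open>F\<^sub>C = F'\<^sub>C + \<Sum>\<^bsub>k \<in> M\<^esub> k \<theta> k\<^sup>-\<^sup>1\<close>. By equivariance the coset \<open>C l\<^sup>-\<^sup>1\<close> contributes the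
  error \<open>\<Sum>\<^bsub>k \<in> M\<^esub> (l k) \<theta> (l k)\<^sup>-\<^sup>1\<close>. As \<open>l M\<close> runs over the cosets of \<open>M\<close> in \<open>L\<close>, the total error is
  the trace of \<open>\<theta>\<close> over \<open>L\<close>.
\<close>

theorem stably_eq_coset_sum:
  assumes L: "subgroup L G" and U: "rep L U" and W: "rep L W"
    and F: "\<And>g. g \<in> carrier G \<Longrightarrow> F g \<in> lin K U W"
    and F': "\<And>g. g \<in> carrier G \<Longrightarrow> F' g \<in> lin K U W"
    and inv: "\<And>h g v. h \<in> H \<Longrightarrow> g \<in> carrier G \<Longrightarrow> v \<in> carrier U \<Longrightarrow> F (h \<otimes> g) v = F g v"
    and inv': "\<And>h g v. h \<in> H \<Longrightarrow> g \<in> carrier G \<Longrightarrow> v \<in> carrier U \<Longrightarrow> F' (h \<otimes> g) v = F' g v"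
    and equi: "\<And>l g v. l \<in> L \<Longrightarrow> g \<in> carrier G \<Longrightarrow> v \<in> carrier U \<Longrightarrow>
      F (g \<otimes> inv l) (act U l v) = act W l (F g v)"
    and equi': "\<And>l g v. l \<in> L \<Longrightarrow> g \<in> carrier G \<Longrightarrow> v \<in> carrier U \<Longrightarrow>
      F' (g \<otimes> inv l) (act U l v) = act W l (F' g v)"
    and eq: "\<And>g. g \<in> carrier G \<Longrightarrow> stably_eq (L \<inter> conj_subgroup G H g) U W (F g) (F' g)"
  shows "stably_eq L U W (\<lambda>v. coset_sum G H W (\<lambda>g. F g v)) (\<lambda>v. coset_sum G H W (\<lambda>g. F' g v))"
proof -
  interpret W: module K W by (rule rep_module[OF W])
  let ?R = "rcosets H"
  let ?F = "\<lambda>C. F (coset_rep C)" and ?F' = "\<lambda>C. F' (coset_rep C)"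
  have LG: "l \<in> carrier G" "inv l \<in> L" if "l \<in> L" for l
    using that L by (auto simp: subgroup.mem_carrier subgroup.m_inv_closed)
  have cl: "?F C v \<in> carrier W" "?F' C v \<in> carrier W" if "C \<in> ?R" "v \<in> carrier U" for C v
    using F F' coset_rep(1)[OF that(1)] that(2) by (auto intro: lin_closed)
  have tr: "?F (C #> inv l) v = act W l (?F C (act U (inv l) v))"
    "?F' (C #> inv l) v = act W l (?F' C (act U (inv l) v))"
    if C: "C \<in> ?R" and l: "l \<in> L" and v: "v \<in> carrier U" for C l v
  proof -
    have m: "coset_rep C \<in> carrier G" "inv l \<in> carrier G" "act U (inv l) v \<in> carrier U"
      using coset_rep(1)[OF C] LG l v by (auto intro!: rep_act_closed[OF U])
    have e: "C #> inv l = H #> (coset_rep C \<otimes> inv l)" by (rule coset_shift(1)[OF C m(2)])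
    show "?F (C #> inv l) v = act W l (?F C (act U (inv l) v))"
      using coset_invariant_rep[of "\<lambda>g. F g v" "coset_rep C \<otimes> inv l"] inv v m
        equi[OF l m(1,3)] rep_act_inv(2)[OF U L l v] by (simp add: e)
    show "?F' (C #> inv l) v = act W l (?F' C (act U (inv l) v))"
      using coset_invariant_rep[of "\<lambda>g. F' g v" "coset_rep C \<otimes> inv l"] inv' v m
        equi'[OF l m(1,3)] rep_act_inv(2)[OF U L l v] by (simp add: e)
  qed
  have main: "stably_eq L U W (\<lambda>v. \<Oplus>\<^bsub>W\<^esub>C\<in>X. ?F C v) (\<lambda>v. \<Oplus>\<^bsub>W\<^esub>C\<in>X. ?F' C v)"
    if "finite X" "X \<subseteq> ?R" "\<And>C l. C \<in> X \<Longrightarrow> l \<in> L \<Longrightarrow> C #> inv l \<in> X" for X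
    using that
  proof (induction X rule: finite_psubset_induct)
    case (psubset X)
    show ?case
    proof (cases "X = {}")
      case True
      then show ?thesis by (intro stably_eq_of_eq[OF L U W]) auto
    next
      case False
      then obtain C0 where C0: "C0 \<in> X" by blast
      let ?\<pi> = "\<lambda>l. C0 #> inv l"
      let ?O = "?\<pi> ` L"
      have C0R: "C0 \<in> ?R" using C0 psubset.prems by blast
      have assoc: "(C0 #> k) #> l = C0 #> (k \<otimes> l)" if "k \<in> carrier G" "l \<in> carrier G" for k l
        by (rule coset_assoc[OF C0R that])
      have OX: "?O \<subseteq> X" using psubset.prems(2)[OF C0] by auto
      have "\<one> \<in> L" using L by (rule subgroup.one_closed)
      moreover have "C0 = ?\<pi> \<one>" using coset_one[OF C0R] by simp
      ultimately have C0O: "C0 \<in> ?O" by (rule rev_image_eqI)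
      \<comment> \<open>The complement of the orbit of \<open>C0\<close> is again stable under \<open>L\<close>.\<close>
      have rest: "stably_eq L U W (\<lambda>v. \<Oplus>\<^bsub>W\<^esub>C\<in>X - ?O. ?F C v) (\<lambda>v. \<Oplus>\<^bsub>W\<^esub>C\<in>X - ?O. ?F' C v)"
      proof (rule psubset.IH)
        show "X - ?O \<subset> X" using C0O C0 by blast
        show "X - ?O \<subseteq> ?R" using psubset.prems by blast
        fix C l assume C: "C \<in> X - ?O" and l: "l \<in> L"
        have CR: "C \<in> ?R" using C psubset.prems by blast
        have "C #> inv l \<notin> ?O"
        proof
          assume "C #> inv l \<in> ?O"
          then obtain m where m: "m \<in> L" "C #> inv l = C0 #> inv m" by auto
          have "C = (C #> inv l) #> l" using LG l CR by (simp add: coset_assoc coset_one)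
          also have "\<dots> = C0 #> inv (inv l \<otimes> m)"
            using m LG l by (simp add: assoc G.inv_mult_group)
          finally have "C \<in> ?O" using m l LG L by (auto simp: subgroup.m_closed)
          with C show False by blast
        qed
        then show "C #> inv l \<in> X - ?O" using psubset.prems(2) C l by blast
      qed
      have orbit: "stably_eq L U W (\<lambda>v. \<Oplus>\<^bsub>W\<^esub>C\<in>?O. ?F C v) (\<lambda>v. \<Oplus>\<^bsub>W\<^esub>C\<in>?O. ?F' C v)"
      proof -
        define S where "S = L \<inter> conj_subgroup G H (coset_rep C0)"
        have r: "coset_rep C0 \<in> carrier G" "H #> coset_rep C0 = C0" by (rule coset_rep[OF C0R])+
        have Ssub: "subgroup S G"
          unfolding S_def by (intro G.subgroups_Inter_pair L conj_subgroup_subgroup H r(1))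
        have SL: "S \<subseteq> L" by (auto simp: S_def)
        note US = rep_subgroup[OF U Ssub SL] and WS = rep_subgroup[OF W Ssub SL]
        have stab: "l \<in> S \<longleftrightarrow> C0 #> inv l = C0" if l: "l \<in> L" for l
        proof -
          have lG: "l \<in> carrier G" using LG l by simp
          have "C0 #> inv l = C0 \<longleftrightarrow> H #> (coset_rep C0 \<otimes> inv l) = H #> coset_rep C0"
            using coset_shift(1)[OF C0R, of "inv l"] lG r by simp
          also have "\<dots> \<longleftrightarrow> coset_rep C0 \<in> H #> (coset_rep C0 \<otimes> inv l)"
          proof
            assume "H #> (coset_rep C0 \<otimes> inv l) = H #> coset_rep C0"
            then show "coset_rep C0 \<in> H #> (coset_rep C0 \<otimes> inv l)"
              using G.rcos_self[OF r(1) H] by simp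
          next
            assume "coset_rep C0 \<in> H #> (coset_rep C0 \<otimes> inv l)"
            then show "H #> (coset_rep C0 \<otimes> inv l) = H #> coset_rep C0"
              by (rule G.repr_independence[OF _ _ H]) (use r(1) lG in simp)
          qed
          also have "\<dots> \<longleftrightarrow> coset_rep C0 \<otimes> inv (coset_rep C0 \<otimes> inv l) \<in> H"
            by (rule subgroup.rcos_module[OF H group]) (use r(1) lG in simp_all)
          also have "\<dots> \<longleftrightarrow> coset_rep C0 \<otimes> l \<otimes> inv (coset_rep C0) \<in> H"
            using r(1) lG by (simp add: G.inv_mult_group G.m_assoc)
          also have "\<dots> \<longleftrightarrow> l \<in> S"
            using conj_subgroup_iff[OF r(1) lG subgroup.subset[OF H]] l by (simp add: S_def)
          finally show ?thesis ..
        qed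
        obtain \<theta> where \<theta>: "\<theta> \<in> lin K U W"
          "\<And>v. v \<in> carrier U \<Longrightarrow> ?F C0 v = ?F' C0 v \<oplus>\<^bsub>W\<^esub> trace S U W \<theta> v"
          using eq[OF r(1)] by (auto simp: stably_eq_def S_def)
        have "(\<Oplus>\<^bsub>W\<^esub>C\<in>?O. ?F C v) = (\<Oplus>\<^bsub>W\<^esub>C\<in>?O. ?F' C v) \<oplus>\<^bsub>W\<^esub> trace L U W \<theta> v"
          if v: "v \<in> carrier U" for v
        proof -
          let ?t = "\<lambda>l. act W l (\<theta> (act U (inv l) v))"
          have t: "?t \<in> L \<rightarrow> carrier W" by (rule trace_summand_closed[OF L U W \<theta>(1) v])
          let ?T = "\<lambda>C. \<Oplus>\<^bsub>W\<^esub>l\<in>{l\<in>L. ?\<pi> l = C}. ?t l"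
          have Tcl: "?T C \<in> carrier W" for C using t by (intro W.M.finsum_closed) auto
          \<comment> \<open>The error of the coset \<open>C\<close> is the part of the trace over \<open>L\<close> given by the \<open>l\<close> that carry \<open>C0\<close> to \<open>C\<close>.\<close>
          have FT: "?F C v = ?F' C v \<oplus>\<^bsub>W\<^esub> ?T C" if C: "C \<in> ?O" for C
          proof -
            obtain m where m: "m \<in> L" "C = ?\<pi> m" using C by auto
            have mG: "m \<in> carrier G" "inv m \<in> L" using LG m by auto
            let ?v = "act U (inv m) v"
            have v': "?v \<in> carrier U" by (rule rep_act_closed[OF U mG(2) v])
            have fibre: "{l\<in>L. ?\<pi> l = C} = (\<lambda>k. m \<otimes> k) ` S"
            proof
              show "{l\<in>L. ?\<pi> l = C} \<subseteq> (\<lambda>k. m \<otimes> k) ` S"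
              proof
                fix l assume "l \<in> {l\<in>L. ?\<pi> l = C}"
                then have l: "l \<in> L" "C0 #> inv l = C0 #> inv m" using m by auto
                have "C0 #> inv (inv m \<otimes> l) = (C0 #> inv l) #> m"
                  using l(1) LG mG by (simp add: assoc G.inv_mult_group)
                also have "\<dots> = C0" unfolding l(2) using mG by (simp add: assoc coset_one[OF C0R])
                finally have "inv m \<otimes> l \<in> S" using stab mG l L by (simp add: subgroup.m_closed)
                moreover have "l = m \<otimes> (inv m \<otimes> l)" using mG LG l by simp
                ultimately show "l \<in> (\<lambda>k. m \<otimes> k) ` S" by blast
              qed
              show "(\<lambda>k. m \<otimes> k) ` S \<subseteq> {l\<in>L. ?\<pi> l = C}"
              proof clarify
                fix k assume k: "k \<in> S"
                then have kL: "k \<in> L" "k \<in> carrier G" using SL LG by auto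
                have "?\<pi> (m \<otimes> k) = (C0 #> inv k) #> inv m"
                  using kL mG by (simp add: assoc G.inv_mult_group)
                also have "\<dots> = C" using stab[OF kL(1)] k m by simp
                finally show "m \<otimes> k \<in> L \<and> ?\<pi> (m \<otimes> k) = C" using kL m L by (simp add: subgroup.m_closed)
              qed
            qed
            have inj: "inj_on (\<lambda>k. m \<otimes> k) S" using mG Ssub by (auto intro!: inj_onI simp: subgroup.mem_carrier)
            have "?T C = (\<Oplus>\<^bsub>W\<^esub>k\<in>S. ?t (m \<otimes> k))"
              unfolding fibre using t SL m(1) L
              by (intro W.M.finsum_reindex inj) (auto simp: subgroup.m_closed Pi_iff)
            also have "\<dots> = (\<Oplus>\<^bsub>W\<^esub>k\<in>S. act W m (act W k (\<theta> (act U (inv k) ?v))))"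
            proof (rule W.M.finsum_cong'[OF refl])
              show "(\<lambda>k. act W m (act W k (\<theta> (act U (inv k) ?v)))) \<in> S \<rightarrow> carrier W"
                using trace_summand_closed[OF Ssub US WS \<theta>(1) v'] rep_act_closed[OF W m(1)] by auto
              fix k assume "k \<in> S"
              then have kL: "k \<in> L" "k \<in> carrier G" "inv k \<in> L" using SL LG by auto
              then show "?t (m \<otimes> k) = act W m (act W k (\<theta> (act U (inv k) ?v)))"
                using v v' m mG by (simp add: G.inv_mult_group rep_act_mult[OF U] rep_act_mult[OF W]
                  lin_closed[OF \<theta>(1)] rep_act_closed[OF U])
            qed
            also have "\<dots> = act W m (trace S U W \<theta> ?v)"
              unfolding trace_def using trace_summand_closed[OF Ssub US WS \<theta>(1) v']
              by (intro lin_finsum[symmetric, OF rep_module[OF W] rep_module[OF W] rep_act_lin[OF W m(1)]]) auto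
            finally have T: "?T C = act W m (trace S U W \<theta> ?v)" .
            have "?F C v = act W m (?F' C0 ?v \<oplus>\<^bsub>W\<^esub> trace S U W \<theta> ?v)"
              using tr(1)[OF C0R m(1) v] \<theta>(2)[OF v'] m(2) by simp
            also have "\<dots> = ?F' C v \<oplus>\<^bsub>W\<^esub> ?T C"
              using lin_add[OF rep_act_lin[OF W m(1)] cl(2)[OF C0R v'] trace_closed[OF Ssub US WS \<theta>(1) v']]
                tr(2)[OF C0R m(1) v] m(2) T by simp
            finally show ?thesis .
          qed
          have OR: "C \<in> ?R" if "C \<in> ?O" for C using that OX psubset.prems by blast
          have "(\<Oplus>\<^bsub>W\<^esub>C\<in>?O. ?F C v) = (\<Oplus>\<^bsub>W\<^esub>C\<in>?O. ?F' C v \<oplus>\<^bsub>W\<^esub> ?T C)"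
            using cl(2)[OF OR v] Tcl by (intro W.M.finsum_cong' refl FT Pi_I W.M.a_closed)
          also have "\<dots> = (\<Oplus>\<^bsub>W\<^esub>C\<in>?O. ?F' C v) \<oplus>\<^bsub>W\<^esub> (\<Oplus>\<^bsub>W\<^esub>C\<in>?O. ?T C)"
            using cl(2)[OF OR v] Tcl by (intro W.M.finsum_addf Pi_I)
          also have "(\<Oplus>\<^bsub>W\<^esub>C\<in>?O. ?T C) = trace L U W \<theta> v"
            unfolding trace_def by (rule W.M.finsum_fibres[symmetric, OF finite_subgroup[OF L] t])
          finally show ?thesis .
        qed
        with \<theta>(1) show ?thesis by (auto simp: stably_eq_def)
      qed
      have split: "(\<Oplus>\<^bsub>W\<^esub>C\<in>X. f C) = (\<Oplus>\<^bsub>W\<^esub>C\<in>?O. f C) \<oplus>\<^bsub>W\<^esub> (\<Oplus>\<^bsub>W\<^esub>C\<in>X - ?O. f C)"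
        if "\<And>C. C \<in> X \<Longrightarrow> f C \<in> carrier W" for f
      proof -
        have fin: "finite ?O" "finite (X - ?O)" using finite_subset[OF OX psubset.hyps(1)] psubset.hyps(1) by simp_all
        have X: "?O \<union> (X - ?O) = X" using OX by blast
        have f: "f \<in> ?O \<rightarrow> carrier W" "f \<in> X - ?O \<rightarrow> carrier W"
          using that OX by blast+
        show ?thesis
          using W.M.finsum_Un_disjoint[OF fin _ f] unfolding X by blast
      qed
      have clX: "?F C v \<in> carrier W" "?F' C v \<in> carrier W" if "C \<in> X" "v \<in> carrier U" for C v
        using cl that psubset.prems by blast+
      have sum: "stably_eq L U W (\<lambda>v. (\<Oplus>\<^bsub>W\<^esub>C\<in>?O. ?F C v) \<oplus>\<^bsub>W\<^esub> (\<Oplus>\<^bsub>W\<^esub>C\<in>X - ?O. ?F C v))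
         (\<lambda>v. (\<Oplus>\<^bsub>W\<^esub>C\<in>?O. ?F' C v) \<oplus>\<^bsub>W\<^esub> (\<Oplus>\<^bsub>W\<^esub>C\<in>X - ?O. ?F' C v))"
      proof (rule stably_eq_plus[OF L U W orbit rest])
        fix v assume v: "v \<in> carrier U"
        show "(\<Oplus>\<^bsub>W\<^esub>C\<in>?O. ?F' C v) \<in> carrier W" "(\<Oplus>\<^bsub>W\<^esub>C\<in>X - ?O. ?F' C v) \<in> carrier W"
          by (rule W.M.finsum_closed, rule Pi_I, use clX(2)[OF _ v] OX in blast)+
      qed
      have eqs: "(\<Oplus>\<^bsub>W\<^esub>C\<in>X. ?F C v) = (\<Oplus>\<^bsub>W\<^esub>C\<in>?O. ?F C v) \<oplus>\<^bsub>W\<^esub> (\<Oplus>\<^bsub>W\<^esub>C\<in>X - ?O. ?F C v)"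
        "(\<Oplus>\<^bsub>W\<^esub>C\<in>X. ?F' C v) = (\<Oplus>\<^bsub>W\<^esub>C\<in>?O. ?F' C v) \<oplus>\<^bsub>W\<^esub> (\<Oplus>\<^bsub>W\<^esub>C\<in>X - ?O. ?F' C v)"
        if "v \<in> carrier U" for v
        using split[of "\<lambda>C. ?F C v"] split[of "\<lambda>C. ?F' C v"] clX that by blast+
      from sum show ?thesis unfolding stably_eq_def using eqs by simp
    qed
  qed
  have "stably_eq L U W (\<lambda>v. \<Oplus>\<^bsub>W\<^esub>C\<in>?R. ?F C v) (\<lambda>v. \<Oplus>\<^bsub>W\<^esub>C\<in>?R. ?F' C v)"
    by (rule main) (use finite_rcosets coset_shift(2) LG(1) in auto)
  then show ?thesis unfolding coset_sum_def .
qed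

end

end

section \<open>Higman's criterion for factoring through a projective module\<close>

text \<open>
  Vector spaces of arbitrary dimension, so Zorn's lemma is needed. The partial sections are taken as
  their graphs: subspaces of \<open>W \<times> F\<close> over which \<open>\<pi>\<close> is the identity and which are single-valued. A
  maximal graph is defined everywhere, since it could otherwise be enlarged by a line.
\<close>

lemma linear_surjection_splits:
  assumes "field K" and F: "module K F" and W: "module K W"
    and \<pi>: "\<pi> \<in> lin K F W" and surj: "\<And>w. w \<in> carrier W \<Longrightarrow> \<exists>y\<in>carrier F. \<pi> y = w"
  shows "\<exists>s\<in>lin K W F. \<forall>w\<in>carrier W. \<pi> (s w) = w"
proof -
  interpret K: field K by fact
  interpret F: module K F by fact
  interpret W: module K W by fact
  define \<A> where "\<A> = {\<Gamma>. \<Gamma> \<subseteq> carrier W \<times> carrier F \<and> (\<zero>\<^bsub>W\<^esub>, \<zero>\<^bsub>F\<^esub>) \<in> \<Gamma>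
    \<and> (\<forall>x y x' y'. (x, y) \<in> \<Gamma> \<longrightarrow> (x', y') \<in> \<Gamma> \<longrightarrow> (x \<oplus>\<^bsub>W\<^esub> x', y \<oplus>\<^bsub>F\<^esub> y') \<in> \<Gamma>)
    \<and> (\<forall>a\<in>carrier K. \<forall>x y. (x, y) \<in> \<Gamma> \<longrightarrow> (a \<odot>\<^bsub>W\<^esub> x, a \<odot>\<^bsub>F\<^esub> y) \<in> \<Gamma>)
    \<and> (\<forall>x y. (x, y) \<in> \<Gamma> \<longrightarrow> \<pi> y = x) \<and> (\<forall>y. (\<zero>\<^bsub>W\<^esub>, y) \<in> \<Gamma> \<longrightarrow> y = \<zero>\<^bsub>F\<^esub>)}"
  have "{(\<zero>\<^bsub>W\<^esub>, \<zero>\<^bsub>F\<^esub>)} \<in> \<A>" using lin_zero[OF F W \<pi>] by (auto simp: \<A>_def)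
  then have ne: "\<A> \<noteq> {}" by blast
  have chain: "\<Union>\<C> \<in> \<A>" if "\<C> \<noteq> {}" "subset.chain \<A> \<C>" for \<C>
  proof -
    have sub: "\<C> \<subseteq> \<A>" and ch: "\<And>X Y. X \<in> \<C> \<Longrightarrow> Y \<in> \<C> \<Longrightarrow> X \<subseteq> Y \<or> Y \<subseteq> X"
      using that(2) by (auto simp: subset.chain_def)
    have 1: "\<Union>\<C> \<subseteq> carrier W \<times> carrier F" "(\<zero>\<^bsub>W\<^esub>, \<zero>\<^bsub>F\<^esub>) \<in> \<Union>\<C>"
    proof -
      have "X \<subseteq> carrier W \<times> carrier F \<and> (\<zero>\<^bsub>W\<^esub>, \<zero>\<^bsub>F\<^esub>) \<in> X" if "X \<in> \<C>" for X
        using sub that by (auto simp: \<A>_def)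
      then show "\<Union>\<C> \<subseteq> carrier W \<times> carrier F" "(\<zero>\<^bsub>W\<^esub>, \<zero>\<^bsub>F\<^esub>) \<in> \<Union>\<C>"
        using that(1) by blast+
    qed
    have 2: "(x \<oplus>\<^bsub>W\<^esub> x', y \<oplus>\<^bsub>F\<^esub> y') \<in> \<Union>\<C>" if xy: "(x, y) \<in> \<Union>\<C>" "(x', y') \<in> \<Union>\<C>" for x y x' y'
    proof -
      obtain X Y where XY: "X \<in> \<C>" "(x, y) \<in> X" "Y \<in> \<C>" "(x', y') \<in> Y" using xy by blast
      obtain Z where Z: "Z \<in> \<C>" "(x, y) \<in> Z" "(x', y') \<in> Z" using ch[OF XY(1,3)] XY by blast
      have "(x \<oplus>\<^bsub>W\<^esub> x', y \<oplus>\<^bsub>F\<^esub> y') \<in> Z" using Z sub by (auto simp: \<A>_def)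
      then show ?thesis using Z(1) by blast
    qed
    have 3: "(a \<odot>\<^bsub>W\<^esub> x, a \<odot>\<^bsub>F\<^esub> y) \<in> \<Union>\<C>" if a: "a \<in> carrier K" "(x, y) \<in> \<Union>\<C>" for a x y
    proof -
      obtain X where X: "X \<in> \<C>" "(x, y) \<in> X" using a(2) by blast
      then have "(a \<odot>\<^bsub>W\<^esub> x, a \<odot>\<^bsub>F\<^esub> y) \<in> X" using sub a(1) by (auto simp: \<A>_def)
      then show ?thesis using X(1) by blast
    qed
    have 4: "\<pi> y = x" if "(x, y) \<in> \<Union>\<C>" for x y using that sub by (auto simp: \<A>_def)
    have 5: "y = \<zero>\<^bsub>F\<^esub>" if "(\<zero>\<^bsub>W\<^esub>, y) \<in> \<Union>\<C>" for y using that sub by (auto simp: \<A>_def)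
    show ?thesis unfolding \<A>_def using 1 2 3 4 5 by blast
  qed
  obtain M where M: "M \<in> \<A>" "\<And>X. X \<in> \<A> \<Longrightarrow> M \<subseteq> X \<Longrightarrow> X = M"
    using subset_Zorn_nonempty[OF ne chain] by blast
  have Mc: "x \<in> carrier W" "y \<in> carrier F" "\<pi> y = x" if "(x, y) \<in> M" for x y
    using M(1) that by (auto simp: \<A>_def)
  have M0: "(\<zero>\<^bsub>W\<^esub>, \<zero>\<^bsub>F\<^esub>) \<in> M" using M(1) by (simp add: \<A>_def)
  have Ma: "(x \<oplus>\<^bsub>W\<^esub> x', y \<oplus>\<^bsub>F\<^esub> y') \<in> M" if "(x, y) \<in> M" "(x', y') \<in> M" for x y x' y'
    using M(1) that by (simp add: \<A>_def)
  have Ms: "(a \<odot>\<^bsub>W\<^esub> x, a \<odot>\<^bsub>F\<^esub> y) \<in> M" if "a \<in> carrier K" "(x, y) \<in> M" for a x y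
    using M(1) that by (simp add: \<A>_def)
  have Mz: "y = \<zero>\<^bsub>F\<^esub>" if "(\<zero>\<^bsub>W\<^esub>, y) \<in> M" for y
    using M(1) that by (simp add: \<A>_def)
  have total: "\<exists>y. (x0, y) \<in> M" if x0: "x0 \<in> carrier W" for x0
  proof (rule ccontr)
    assume none: "\<nexists>y. (x0, y) \<in> M"
    obtain y0 where y0: "y0 \<in> carrier F" "\<pi> y0 = x0" using surj[OF x0] by blast
    \<comment> \<open>If the graph \<open>M\<close> misses \<open>x0\<close>, it is enlarged by the line through \<open>(x0, y0)\<close>.\<close>
    define N where "N = {(x \<oplus>\<^bsub>W\<^esub> a \<odot>\<^bsub>W\<^esub> x0, y \<oplus>\<^bsub>F\<^esub> a \<odot>\<^bsub>F\<^esub> y0) | x y a. (x, y) \<in> M \<and> a \<in> carrier K}"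
    have NI: "(x \<oplus>\<^bsub>W\<^esub> a \<odot>\<^bsub>W\<^esub> x0, y \<oplus>\<^bsub>F\<^esub> a \<odot>\<^bsub>F\<^esub> y0) \<in> N" if "(x, y) \<in> M" "a \<in> carrier K" for x y a
      using that by (auto simp: N_def)
    have NE: "\<exists>x y a. (x, y) \<in> M \<and> a \<in> carrier K \<and> u = x \<oplus>\<^bsub>W\<^esub> a \<odot>\<^bsub>W\<^esub> x0 \<and> v = y \<oplus>\<^bsub>F\<^esub> a \<odot>\<^bsub>F\<^esub> y0"
      if "(u, v) \<in> N" for u v
      using that unfolding N_def by blast
    have "M \<subseteq> N"
    proof clarify
      fix x y assume "(x, y) \<in> M"
      then show "(x, y) \<in> N" using NI[of x y "\<zero>\<^bsub>K\<^esub>"] Mc x0 y0 by simp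
    qed
    moreover have "N \<in> \<A>"
    proof -
      have 1: "N \<subseteq> carrier W \<times> carrier F"
      proof clarify
        fix u v assume "(u, v) \<in> N"
        then show "u \<in> carrier W \<and> v \<in> carrier F" using NE[of u v] Mc x0 y0 by auto
      qed
      have 2: "(\<zero>\<^bsub>W\<^esub>, \<zero>\<^bsub>F\<^esub>) \<in> N" using M0 \<open>M \<subseteq> N\<close> by blast
      have 3: "(u \<oplus>\<^bsub>W\<^esub> u', v \<oplus>\<^bsub>F\<^esub> v') \<in> N" if uv: "(u, v) \<in> N" "(u', v') \<in> N" for u v u' v'
      proof -
        obtain x y a where a: "(x, y) \<in> M" "a \<in> carrier K" "u = x \<oplus>\<^bsub>W\<^esub> a \<odot>\<^bsub>W\<^esub> x0" "v = y \<oplus>\<^bsub>F\<^esub> a \<odot>\<^bsub>F\<^esub> y0"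
          using NE[OF uv(1)] by blast
        obtain x' y' b where b: "(x', y') \<in> M" "b \<in> carrier K" "u' = x' \<oplus>\<^bsub>W\<^esub> b \<odot>\<^bsub>W\<^esub> x0" "v' = y' \<oplus>\<^bsub>F\<^esub> b \<odot>\<^bsub>F\<^esub> y0"
          using NE[OF uv(2)] by blast
        have "u \<oplus>\<^bsub>W\<^esub> u' = (x \<oplus>\<^bsub>W\<^esub> x') \<oplus>\<^bsub>W\<^esub> (a \<oplus>\<^bsub>K\<^esub> b) \<odot>\<^bsub>W\<^esub> x0"
          "v \<oplus>\<^bsub>F\<^esub> v' = (y \<oplus>\<^bsub>F\<^esub> y') \<oplus>\<^bsub>F\<^esub> (a \<oplus>\<^bsub>K\<^esub> b) \<odot>\<^bsub>F\<^esub> y0"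
          using a b Mc[OF a(1)] Mc[OF b(1)] x0 y0
          by (simp_all add: W.smult_l_distr F.smult_l_distr W.M.a_ac F.M.a_ac)
        then show ?thesis using NI[OF Ma[OF a(1) b(1)], of "a \<oplus>\<^bsub>K\<^esub> b"] a(2) b(2) by simp
      qed
      have 4: "(c \<odot>\<^bsub>W\<^esub> u, c \<odot>\<^bsub>F\<^esub> v) \<in> N" if c: "c \<in> carrier K" and uv: "(u, v) \<in> N" for c u v
      proof -
        obtain x y a where a: "(x, y) \<in> M" "a \<in> carrier K" "u = x \<oplus>\<^bsub>W\<^esub> a \<odot>\<^bsub>W\<^esub> x0" "v = y \<oplus>\<^bsub>F\<^esub> a \<odot>\<^bsub>F\<^esub> y0"
          using NE[OF uv] by blast
        have "c \<odot>\<^bsub>W\<^esub> u = c \<odot>\<^bsub>W\<^esub> x \<oplus>\<^bsub>W\<^esub> (c \<otimes>\<^bsub>K\<^esub> a) \<odot>\<^bsub>W\<^esub> x0"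
          "c \<odot>\<^bsub>F\<^esub> v = c \<odot>\<^bsub>F\<^esub> y \<oplus>\<^bsub>F\<^esub> (c \<otimes>\<^bsub>K\<^esub> a) \<odot>\<^bsub>F\<^esub> y0"
          using a c Mc[OF a(1)] x0 y0
          by (simp_all add: W.smult_r_distr F.smult_r_distr W.smult_assoc1 F.smult_assoc1)
        then show ?thesis using NI[OF Ms[OF c a(1)], of "c \<otimes>\<^bsub>K\<^esub> a"] a(2) c by simp
      qed
      have 5: "\<pi> v = u" if uv: "(u, v) \<in> N" for u v
      proof -
        obtain x y a where a: "(x, y) \<in> M" "a \<in> carrier K" "u = x \<oplus>\<^bsub>W\<^esub> a \<odot>\<^bsub>W\<^esub> x0" "v = y \<oplus>\<^bsub>F\<^esub> a \<odot>\<^bsub>F\<^esub> y0"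
          using NE[OF uv] by blast
        then show ?thesis
          using Mc[OF a(1)] y0 by (simp add: lin_add[OF \<pi>] lin_smult[OF \<pi>])
      qed
      have 6: "v = \<zero>\<^bsub>F\<^esub>" if uv: "(\<zero>\<^bsub>W\<^esub>, v) \<in> N" for v
      proof -
        obtain x y a where a: "(x, y) \<in> M" "a \<in> carrier K" "\<zero>\<^bsub>W\<^esub> = x \<oplus>\<^bsub>W\<^esub> a \<odot>\<^bsub>W\<^esub> x0" "v = y \<oplus>\<^bsub>F\<^esub> a \<odot>\<^bsub>F\<^esub> y0"
          using NE[OF uv] by blast
        have xc: "x \<in> carrier W" "y \<in> carrier F" using Mc[OF a(1)] by auto
        show ?thesis
        proof (cases "a = \<zero>\<^bsub>K\<^esub>")
          case True
          then have "x = \<zero>\<^bsub>W\<^esub>" "v = y" using a xc x0 y0 by simp_all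
          then show ?thesis using Mz a(1) by simp
        next
          case False
          then have u: "a \<in> Units K" using a(2) K.field_Units by simp
          let ?b = "inv\<^bsub>K\<^esub> a"
          have b: "?b \<in> carrier K" "?b \<otimes>\<^bsub>K\<^esub> a = \<one>\<^bsub>K\<^esub>" using u by auto
          have "x \<oplus>\<^bsub>W\<^esub> a \<odot>\<^bsub>W\<^esub> x0 = \<zero>\<^bsub>W\<^esub>" using a(3) by simp
          then have "a \<odot>\<^bsub>W\<^esub> x0 = \<ominus>\<^bsub>W\<^esub> x"
            using xc x0 a(2) by (metis W.M.a_comm W.M.minus_equality W.smult_closed)
          then have "?b \<odot>\<^bsub>W\<^esub> (a \<odot>\<^bsub>W\<^esub> x0) = ?b \<odot>\<^bsub>W\<^esub> (\<ominus>\<^bsub>W\<^esub> x)" by simp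
          then have "x0 = (\<ominus>\<^bsub>K\<^esub> ?b) \<odot>\<^bsub>W\<^esub> x"
            using b xc x0 a(2) by (simp add: W.smult_assoc1[symmetric] W.smult_r_minus W.smult_l_minus)
          then have "(x0, (\<ominus>\<^bsub>K\<^esub> ?b) \<odot>\<^bsub>F\<^esub> y) \<in> M" using Ms[OF _ a(1), of "\<ominus>\<^bsub>K\<^esub> ?b"] b by simp
          then show ?thesis using none by blast
        qed
      qed
      show ?thesis unfolding \<A>_def using 1 2 3 4 5 6 by blast
    qed
    ultimately have "N = M" using M(2) by blast
    moreover have "(x0, y0) \<in> N" using NI[OF M0, of "\<one>\<^bsub>K\<^esub>"] x0 y0 by simp
    ultimately show False using none by blast
  qed
  define s where "s x = (SOME y. (x, y) \<in> M)" for x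
  have s: "(x, s x) \<in> M" if "x \<in> carrier W" for x
    unfolding s_def using total[OF that] by (rule someI_ex)
  \<comment> \<open>The difference of two values at \<open>x\<close> is a value at \<open>0\<close>, hence zero.\<close>
  have uniq: "y = y'" if "(x, y) \<in> M" "(x, y') \<in> M" for x y y'
  proof -
    have c: "x \<in> carrier W" "y \<in> carrier F" "y' \<in> carrier F" using that Mc by auto
    have "(\<ominus>\<^bsub>K\<^esub> \<one>\<^bsub>K\<^esub> \<odot>\<^bsub>W\<^esub> x, \<ominus>\<^bsub>K\<^esub> \<one>\<^bsub>K\<^esub> \<odot>\<^bsub>F\<^esub> y') \<in> M" by (rule Ms[OF _ that(2)]) simp
    from Ma[OF that(1) this] have "(\<zero>\<^bsub>W\<^esub>, y \<oplus>\<^bsub>F\<^esub> \<ominus>\<^bsub>F\<^esub> y') \<in> M"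
      using c by (simp add: W.smult_l_minus F.smult_l_minus W.M.r_neg)
    from Mz[OF this] show ?thesis using c by (metis F.M.minus_equality F.M.a_inv_closed F.M.minus_minus)
  qed
  have "s \<in> lin K W F"
  proof (rule linI)
    show "s x \<in> carrier F" if "x \<in> carrier W" for x using Mc(2)[OF s[OF that]] .
    show "s (x \<oplus>\<^bsub>W\<^esub> x') = s x \<oplus>\<^bsub>F\<^esub> s x'" if "x \<in> carrier W" "x' \<in> carrier W" for x x'
      by (rule uniq[OF s Ma[OF s s]]) (use that in auto)
    show "s (a \<odot>\<^bsub>W\<^esub> x) = a \<odot>\<^bsub>F\<^esub> s x" if "a \<in> carrier K" "x \<in> carrier W" for a x
      by (rule uniq[OF s Ms[OF _ s]]) (use that in auto)
  qed
  moreover have "\<pi> (s w) = w" if "w \<in> carrier W" for w using Mc(3)[OF s[OF that]] .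
  ultimately show ?thesis by blast
qed

lemma free_gmod_simps:
  "carrier (free_gmod K G X) = {\<phi>. (\<forall>x\<in>X. \<forall>s\<in>carrier G. \<phi> x s \<in> carrier K) \<and>
                   (\<forall>x s. x \<notin> X \<or> s \<notin> carrier G \<longrightarrow> \<phi> x s = \<zero>\<^bsub>K\<^esub>) \<and>
                   finite {(x, s). \<phi> x s \<noteq> \<zero>\<^bsub>K\<^esub>}}"
  "ring.zero (free_gmod K G X) = (\<lambda>x s. \<zero>\<^bsub>K\<^esub>)"
  "ring.add (free_gmod K G X) = (\<lambda>\<phi> \<psi> x s. \<phi> x s \<oplus>\<^bsub>K\<^esub> \<psi> x s)"
  "smult (free_gmod K G X) = (\<lambda>a \<phi> x s. a \<otimes>\<^bsub>K\<^esub> \<phi> x s)"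
  "act (free_gmod K G X) =
    (\<lambda>g \<phi> x s. if s \<in> carrier G then \<phi> x (inv\<^bsub>G\<^esub> g \<otimes>\<^bsub>G\<^esub> s) else \<zero>\<^bsub>K\<^esub>)"
  by (simp_all add: free_gmod_def)

context group_algebra
begin

sublocale K: field K by (rule field)

lemma carrier_update_self [simp]: "G\<lparr>carrier := carrier G\<rparr> = G"
  by simp

lemma free_gmod_mem:
  assumes "\<phi> \<in> carrier (free_gmod K G X)"
  shows "\<phi> x s \<in> carrier K" "x \<notin> X \<or> s \<notin> carrier G \<Longrightarrow> \<phi> x s = \<zero>\<^bsub>K\<^esub>" "finite {(x, s). \<phi> x s \<noteq> \<zero>\<^bsub>K\<^esub>}"
  using assms by (auto simp: free_gmod_simps) (metis K.zero_closed)

lemma free_gmod_memI: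
  assumes "\<And>x s. \<phi> x s \<in> carrier K" "\<And>x s. x \<notin> X \<or> s \<notin> carrier G \<Longrightarrow> \<phi> x s = \<zero>\<^bsub>K\<^esub>"
    "finite {(x, s). \<phi> x s \<noteq> \<zero>\<^bsub>K\<^esub>}"
  shows "\<phi> \<in> carrier (free_gmod K G X)"
  using assms by (auto simp: free_gmod_simps)

lemma free_gmod_module: "module K (free_gmod K G X)"
proof -
  let ?F = "free_gmod K G X"
  have add: "\<phi> \<oplus>\<^bsub>?F\<^esub> \<psi> \<in> carrier ?F" if "\<phi> \<in> carrier ?F" "\<psi> \<in> carrier ?F" for \<phi> \<psi>
  proof (rule free_gmod_memI)
    have "{(x, s). (\<phi> \<oplus>\<^bsub>?F\<^esub> \<psi>) x s \<noteq> \<zero>\<^bsub>K\<^esub>} \<subseteq> {(x, s). \<phi> x s \<noteq> \<zero>\<^bsub>K\<^esub>} \<union> {(x, s). \<psi> x s \<noteq> \<zero>\<^bsub>K\<^esub>}"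
      by (auto simp: free_gmod_simps)
    then show "finite {(x, s). (\<phi> \<oplus>\<^bsub>?F\<^esub> \<psi>) x s \<noteq> \<zero>\<^bsub>K\<^esub>}"
      using free_gmod_mem(3)[OF that(1)] free_gmod_mem(3)[OF that(2)] by (simp add: finite_subset)
  qed (use free_gmod_mem[OF that(1)] free_gmod_mem[OF that(2)] in \<open>simp_all add: free_gmod_simps\<close>)
  have zero: "\<zero>\<^bsub>?F\<^esub> \<in> carrier ?F" by (rule free_gmod_memI) (simp_all add: free_gmod_simps)
  have smult: "a \<odot>\<^bsub>?F\<^esub> \<phi> \<in> carrier ?F" if "a \<in> carrier K" "\<phi> \<in> carrier ?F" for a \<phi>
  proof (rule free_gmod_memI)
    have "{(x, s). (a \<odot>\<^bsub>?F\<^esub> \<phi>) x s \<noteq> \<zero>\<^bsub>K\<^esub>} \<subseteq> {(x, s). \<phi> x s \<noteq> \<zero>\<^bsub>K\<^esub>}"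
      using that(1) by (auto simp: free_gmod_simps)
    then show "finite {(x, s). (a \<odot>\<^bsub>?F\<^esub> \<phi>) x s \<noteq> \<zero>\<^bsub>K\<^esub>}"
      using free_gmod_mem(3)[OF that(2)] by (rule finite_subset)
  qed (use that(1) free_gmod_mem[OF that(2)] in \<open>simp_all add: free_gmod_simps\<close>)
  have "abelian_group ?F"
  proof (rule abelian_groupI)
    fix \<phi> assume \<phi>: "\<phi> \<in> carrier ?F"
    have "(\<ominus>\<^bsub>K\<^esub> \<one>\<^bsub>K\<^esub>) \<odot>\<^bsub>?F\<^esub> \<phi> \<in> carrier ?F" by (rule smult[OF _ \<phi>]) simp
    moreover have "((\<ominus>\<^bsub>K\<^esub> \<one>\<^bsub>K\<^esub>) \<odot>\<^bsub>?F\<^esub> \<phi>) \<oplus>\<^bsub>?F\<^esub> \<phi> = \<zero>\<^bsub>?F\<^esub>"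
      using free_gmod_mem(1)[OF \<phi>] by (simp add: free_gmod_simps fun_eq_iff K.l_minus K.l_neg)
    ultimately show "\<exists>\<psi>\<in>carrier ?F. \<psi> \<oplus>\<^bsub>?F\<^esub> \<phi> = \<zero>\<^bsub>?F\<^esub>" by blast
  qed (use add zero free_gmod_mem(1)[where X = X] in \<open>auto simp: free_gmod_simps(2-5) fun_eq_iff K.a_ac\<close>)
  then show ?thesis
    using smult free_gmod_mem(1)[where X = X] K.is_cring
    by (intro moduleI) (auto simp: free_gmod_simps(2-5) fun_eq_iff K.l_distr K.r_distr K.m_assoc)
qed

lemma free_gmod_act_closed:
  assumes "g \<in> carrier G" "\<phi> \<in> carrier (free_gmod K G X)"
  shows "act (free_gmod K G X) g \<phi> \<in> carrier (free_gmod K G X)"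
proof (rule free_gmod_memI)
  let ?F = "free_gmod K G X"
  have "{(x, s). act ?F g \<phi> x s \<noteq> \<zero>\<^bsub>K\<^esub>} \<subseteq> (\<lambda>(x, s). (x, g \<otimes> s)) ` {(x, s). \<phi> x s \<noteq> \<zero>\<^bsub>K\<^esub>}"
  proof clarify
    fix x s assume "act ?F g \<phi> x s \<noteq> \<zero>\<^bsub>K\<^esub>"
    then have "s \<in> carrier G" "\<phi> x (inv g \<otimes> s) \<noteq> \<zero>\<^bsub>K\<^esub>"
      by (auto simp: free_gmod_simps split: if_splits)
    then show "(x, s) \<in> (\<lambda>(x, s). (x, g \<otimes> s)) ` {(x, s). \<phi> x s \<noteq> \<zero>\<^bsub>K\<^esub>}"
      using assms(1) by (intro image_eqI[of _ _ "(x, inv g \<otimes> s)"]) auto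
  qed
  then show "finite {(x, s). act ?F g \<phi> x s \<noteq> \<zero>\<^bsub>K\<^esub>}"
    using free_gmod_mem(3)[OF assms(2)] finite_subset by blast
qed (use free_gmod_mem[OF assms(2)] in \<open>auto simp: free_gmod_simps\<close>)

lemma free_gmod_gmodule: "gmodule K G (free_gmod K G X)"
proof -
  let ?F = "free_gmod K G X"
  have "rep (carrier G) ?F"
  proof (rule repI[OF G.subgroup_self free_gmod_module])
    show "act ?F g \<in> lin K ?F ?F" if "g \<in> carrier G" for g
      by (rule linI[OF free_gmod_act_closed[OF that]]) (auto simp: free_gmod_simps(2-5) fun_eq_iff)
    show "act ?F \<one> \<phi> = \<phi>" if "\<phi> \<in> carrier ?F" for \<phi>
      using free_gmod_mem(2)[OF that] by (auto simp: free_gmod_simps fun_eq_iff)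
    show "act ?F (g \<otimes> h) \<phi> = act ?F g (act ?F h \<phi>)"
      if "g \<in> carrier G" "h \<in> carrier G" "\<phi> \<in> carrier ?F" for g h \<phi>
      using that(1,2) by (auto simp: free_gmod_simps fun_eq_iff G.inv_mult_group G.m_assoc)
  qed
  then show ?thesis by simp
qed

lemma free_gmod_finsum:
  assumes "\<And>i. i \<in> A \<Longrightarrow> \<Phi> i \<in> carrier (free_gmod K G X)"
  shows "finsum (free_gmod K G X) \<Phi> A x s = finsum K (\<lambda>i. \<Phi> i x s) A"
proof -
  interpret F: module K "free_gmod K G X" by (rule free_gmod_module)
  show ?thesis
  proof (cases "finite A")
    case True
    then show ?thesis using assms
    proof (induction A)
      case empty
      then show ?case by (simp add: free_gmod_simps)
    next
      case (insert i B)
      then have "finsum (free_gmod K G X) \<Phi> (insert i B) = \<Phi> i \<oplus>\<^bsub>free_gmod K G X\<^esub> finsum (free_gmod K G X) \<Phi> B"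
        by (intro F.M.finsum_insert) auto
      moreover have "finsum K (\<lambda>i. \<Phi> i x s) (insert i B) = \<Phi> i x s \<oplus>\<^bsub>K\<^esub> finsum K (\<lambda>i. \<Phi> i x s) B"
        using insert free_gmod_mem(1)[where X = X] by (intro K.finsum_insert) auto
      ultimately show ?case using insert by (simp add: free_gmod_simps)
    qed
  next
    case False
    then show ?thesis by (simp add: free_gmod_simps)
  qed
qed

text \<open>
  The linear endomorphism of a free module that witnesses projectivity: its trace is the identity.
\<close>

definition unit_part :: "('x \<Rightarrow> 'g \<Rightarrow> 'k) \<Rightarrow> 'x \<Rightarrow> 'g \<Rightarrow> 'k" where
  "unit_part \<phi> = (\<lambda>x s. if s = \<one> then \<phi> x s else \<zero>\<^bsub>K\<^esub>)"

lemma unit_part_lin: "unit_part \<in> lin K (free_gmod K G X) (free_gmod K G X)"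
proof (rule linI)
  fix \<phi> assume \<phi>: "\<phi> \<in> carrier (free_gmod K G X)"
  show "unit_part \<phi> \<in> carrier (free_gmod K G X)"
  proof (rule free_gmod_memI)
    have "{(x, s). unit_part \<phi> x s \<noteq> \<zero>\<^bsub>K\<^esub>} \<subseteq> {(x, s). \<phi> x s \<noteq> \<zero>\<^bsub>K\<^esub>}"
      by (auto simp: unit_part_def)
    then show "finite {(x, s). unit_part \<phi> x s \<noteq> \<zero>\<^bsub>K\<^esub>}"
      using free_gmod_mem(3)[OF \<phi>] by (rule finite_subset)
  qed (use free_gmod_mem[OF \<phi>] in \<open>auto simp: unit_part_def\<close>)
qed (auto simp: unit_part_def free_gmod_simps fun_eq_iff)

lemma trace_unit_part:
  assumes \<phi>: "\<phi> \<in> carrier (free_gmod K G X)"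
  shows "trace (carrier G) (free_gmod K G X) (free_gmod K G X) unit_part \<phi> = \<phi>"
proof (intro ext)
  fix x s
  let ?F = "free_gmod K G X"
  have F: "rep (carrier G) ?F" using free_gmod_gmodule by simp
  have val: "act ?F g (unit_part (act ?F (inv g) \<phi>)) x s = (if s = g then \<phi> x s else \<zero>\<^bsub>K\<^esub>)"
    if g: "g \<in> carrier G" for g
  proof (cases "s \<in> carrier G")
    case True
    have "inv g \<otimes> s = \<one> \<longleftrightarrow> s = g" using g True
      by (metis G.inv_closed G.inv_inv G.inv_equality G.l_inv)
    then show ?thesis using g True by (auto simp: unit_part_def free_gmod_simps)
  next
    case False
    then show ?thesis using free_gmod_mem(2)[OF \<phi>] by (auto simp: free_gmod_simps)
  qed
  have "trace (carrier G) ?F ?F unit_part \<phi> x s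
    = finsum K (\<lambda>g. act ?F g (unit_part (act ?F (inv g) \<phi>)) x s) (carrier G)"
    unfolding trace_def
    using trace_summand_closed[OF G.subgroup_self F F unit_part_lin \<phi>]
    by (intro free_gmod_finsum) auto
  also have "\<dots> = finsum K (\<lambda>g. if s = g then \<phi> x s else \<zero>\<^bsub>K\<^esub>) (carrier G)"
    using val free_gmod_mem(1)[OF \<phi>] by (intro K.finsum_cong') auto
  also have "\<dots> = \<phi> x s"
  proof (cases "s \<in> carrier G")
    case True
    then show ?thesis using free_gmod_mem(1)[OF \<phi>] finite_group
      by (intro K.add.finprod_singleton) auto
  next
    case False
    then have "finsum K (\<lambda>g. if s = g then \<phi> x s else \<zero>\<^bsub>K\<^esub>) (carrier G) = finsum K (\<lambda>g. \<zero>\<^bsub>K\<^esub>) (carrier G)"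
      by (intro K.finsum_cong') auto
    then show ?thesis using False free_gmod_mem(2)[OF \<phi>] by simp
  qed
  finally show "trace (carrier G) ?F ?F unit_part \<phi> x s = \<phi> x s" .
qed

text \<open>
  Projectivity is witnessed over a basis in the type of the module itself, so the basis \<open>X\<close> is
  relabelled by the functions \<open>j x\<close>.
\<close>

lemma projective_free_gmod:
  "projective_gmod K G (free_gmod K G (X :: 'w set))"
proof -
  let ?F = "free_gmod K G X"
  \<comment> \<open>Any injection of \<open>X\<close> into the type of the module would do.\<close>
  define j :: "'w \<Rightarrow> 'w \<Rightarrow> 'g \<Rightarrow> 'k" where "j w = (\<lambda>x s. if x = w then \<one>\<^bsub>K\<^esub> else \<zero>\<^bsub>K\<^esub>)" for w
  have "inj j" by (rule injI) (metis j_def K.one_not_zero)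
  then have inv: "inv_into UNIV j (j x) = x" for x by simp
  let ?F' = "free_gmod K G (j ` X)"
  define i where "i \<phi> = (\<lambda>y s. if y \<in> j ` X then \<phi> (inv_into UNIV j y) s else \<zero>\<^bsub>K\<^esub>)" for \<phi> :: "'w \<Rightarrow> 'g \<Rightarrow> 'k"
  define r where "r \<psi> = (\<lambda>x s. if x \<in> X then \<psi> (j x) s else \<zero>\<^bsub>K\<^esub>)" for \<psi> :: "('w \<Rightarrow> 'g \<Rightarrow> 'k) \<Rightarrow> 'g \<Rightarrow> 'k"
  have i: "i \<in> gmod_hom K G ?F ?F'"
  proof -
    have "i \<phi> \<in> carrier ?F'" if \<phi>: "\<phi> \<in> carrier ?F" for \<phi>
    proof (rule free_gmod_memI)
      have "{(y, s). i \<phi> y s \<noteq> \<zero>\<^bsub>K\<^esub>} \<subseteq> (\<lambda>(x, s). (j x, s)) ` {(x, s). \<phi> x s \<noteq> \<zero>\<^bsub>K\<^esub>}"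
        by (auto simp: i_def inv split: if_splits)
      then show "finite {(y, s). i \<phi> y s \<noteq> \<zero>\<^bsub>K\<^esub>}" using free_gmod_mem(3)[OF \<phi>] finite_subset by blast
    qed (use free_gmod_mem[OF \<phi>] in \<open>auto simp: i_def\<close>)
    then show ?thesis
      by (auto simp: gmod_hom_iff free_gmod_simps(2-5) i_def fun_eq_iff intro!: linI)
  qed
  have r: "r \<in> gmod_hom K G ?F' ?F"
  proof -
    have "r \<psi> \<in> carrier ?F" if \<psi>: "\<psi> \<in> carrier ?F'" for \<psi>
    proof (rule free_gmod_memI)
      have "(\<lambda>(x, s). (j x, s)) ` {(x, s). r \<psi> x s \<noteq> \<zero>\<^bsub>K\<^esub>} \<subseteq> {(y, s). \<psi> y s \<noteq> \<zero>\<^bsub>K\<^esub>}"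
        by (auto simp: r_def split: if_splits)
      moreover have "inj_on (\<lambda>(x, s). (j x, s)) {(x, s). r \<psi> x s \<noteq> \<zero>\<^bsub>K\<^esub>}"
        using \<open>inj j\<close> by (auto intro!: inj_onI dest: injD)
      ultimately show "finite {(x, s). r \<psi> x s \<noteq> \<zero>\<^bsub>K\<^esub>}"
        using free_gmod_mem(3)[OF \<psi>] inj_on_finite by blast
    qed (use free_gmod_mem[OF \<psi>] in \<open>auto simp: r_def\<close>)
    then show ?thesis
      by (auto simp: gmod_hom_iff free_gmod_simps(2-5) r_def fun_eq_iff intro!: linI)
  qed
  have "r (i \<phi>) = \<phi>" if "\<phi> \<in> carrier ?F" for \<phi>
    using free_gmod_mem(2)[OF that] by (auto simp: r_def i_def inv fun_eq_iff)
  then show ?thesis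
    unfolding projective_gmod_def
    by (intro conjI free_gmod_gmodule exI[of _ "j ` X"] bexI[OF _ i] bexI[OF _ r]) simp
qed

text \<open>
  The canonical map onto \<open>W\<close> from the free module on the set \<open>W\<close>.
\<close>

definition eval_free :: "('k, 'w, 'g) gmod \<Rightarrow> ('w \<Rightarrow> 'g \<Rightarrow> 'k) \<Rightarrow> 'w" where
  "eval_free W \<phi> =
    finsum W (\<lambda>(x, s). \<phi> x s \<odot>\<^bsub>W\<^esub> act W s x) {(x, s). \<phi> x s \<noteq> \<zero>\<^bsub>K\<^esub>}"

lemma eval_free_hom_surj:
  assumes W: "gmodule K G W"
  shows "eval_free W \<in> gmod_hom K G (free_gmod K G (carrier W)) W"
    and "w \<in> carrier W \<Longrightarrow> \<exists>\<phi>\<in>carrier (free_gmod K G (carrier W)). eval_free W \<phi> = w"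
proof -
  let ?F = "free_gmod K G (carrier W)"
  have RW: "rep (carrier G) W" using W by simp
  interpret W: module K W by (rule rep_module[OF RW])
  let ?supp = "\<lambda>\<phi>. {(x, s). \<phi> x s \<noteq> \<zero>\<^bsub>K\<^esub>}"
  let ?t = "\<lambda>\<phi> (x, s). \<phi> x s \<odot>\<^bsub>W\<^esub> act W s x"
  have supp: "?supp \<phi> \<subseteq> carrier W \<times> carrier G" if "\<phi> \<in> carrier ?F" for \<phi>
    using free_gmod_mem(2)[OF that] by blast
  have t: "?t \<phi> \<in> A \<rightarrow> carrier W" if "\<phi> \<in> carrier ?F" "A \<subseteq> carrier W \<times> carrier G" for \<phi> A
    using that(2) free_gmod_mem(1)[OF that(1)] rep_act_closed[OF RW] by auto
  have ext: "eval_free W \<phi> = finsum W (?t \<phi>) A"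
    if "\<phi> \<in> carrier ?F" "finite A" "?supp \<phi> \<subseteq> A" "A \<subseteq> carrier W \<times> carrier G" for \<phi> A
    unfolding eval_free_def
    using that(2-4) t[OF that(1,4)] rep_act_closed[OF RW]
    by (intro W.M.add.finprod_mono_neutral_cong_left) auto
  have closed: "eval_free W \<phi> \<in> carrier W" if "\<phi> \<in> carrier ?F" for \<phi>
    unfolding eval_free_def using t[OF that supp[OF that]] by (rule W.M.finsum_closed)
  have F: "module K ?F" by (rule free_gmod_module)
  interpret F: module K ?F by (rule F)
  have "eval_free W \<in> lin K ?F W"
  proof (rule linI[OF closed])
    fix \<phi> \<psi> assume m: "\<phi> \<in> carrier ?F" "\<psi> \<in> carrier ?F"
    let ?A = "?supp \<phi> \<union> ?supp \<psi>"
    have A: "finite ?A" "?A \<subseteq> carrier W \<times> carrier G"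
      using free_gmod_mem(3)[OF m(1)] free_gmod_mem(3)[OF m(2)] supp[OF m(1)] supp[OF m(2)] by auto
    have "eval_free W (\<phi> \<oplus>\<^bsub>?F\<^esub> \<psi>) = finsum W (?t (\<phi> \<oplus>\<^bsub>?F\<^esub> \<psi>)) ?A"
      by (rule ext[OF F.M.a_closed[OF m] A(1) _ A(2)]) (auto simp: free_gmod_simps(3))
    also have "\<dots> = finsum W (\<lambda>i. ?t \<phi> i \<oplus>\<^bsub>W\<^esub> ?t \<psi> i) ?A"
    proof (rule W.M.finsum_cong'[OF refl])
      show "(\<lambda>i. ?t \<phi> i \<oplus>\<^bsub>W\<^esub> ?t \<psi> i) \<in> ?A \<rightarrow> carrier W"
        by (intro Pi_I W.M.a_closed funcset_mem[OF t[OF m(1) A(2)]] funcset_mem[OF t[OF m(2) A(2)]])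
      fix i assume "i \<in> ?A"
      then obtain x s where "i = (x, s)" "x \<in> carrier W" "s \<in> carrier G" using A(2) by blast
      then show "?t (\<phi> \<oplus>\<^bsub>?F\<^esub> \<psi>) i = ?t \<phi> i \<oplus>\<^bsub>W\<^esub> ?t \<psi> i"
        using free_gmod_mem(1)[OF m(1)] free_gmod_mem(1)[OF m(2)] rep_act_closed[OF RW]
        by (simp add: free_gmod_simps(3) W.smult_l_distr)
    qed
    also have "\<dots> = finsum W (?t \<phi>) ?A \<oplus>\<^bsub>W\<^esub> finsum W (?t \<psi>) ?A"
      using t[OF m(1) A(2)] t[OF m(2) A(2)] by (rule W.M.finsum_addf)
    also have "\<dots> = eval_free W \<phi> \<oplus>\<^bsub>W\<^esub> eval_free W \<psi>"
      using ext[OF m(1) A(1) _ A(2)] ext[OF m(2) A(1) _ A(2)] by auto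
    finally show "eval_free W (\<phi> \<oplus>\<^bsub>?F\<^esub> \<psi>) = eval_free W \<phi> \<oplus>\<^bsub>W\<^esub> eval_free W \<psi>" .
  next
    fix a \<phi> assume a: "a \<in> carrier K" and m: "\<phi> \<in> carrier ?F"
    let ?A = "?supp \<phi>"
    have A: "finite ?A" "?A \<subseteq> carrier W \<times> carrier G"
      using free_gmod_mem(3)[OF m] supp[OF m] by auto
    have "eval_free W (a \<odot>\<^bsub>?F\<^esub> \<phi>) = finsum W (?t (a \<odot>\<^bsub>?F\<^esub> \<phi>)) ?A"
      by (rule ext[OF F.smult_closed[OF a m] A(1) _ A(2)]) (use a in \<open>auto simp: free_gmod_simps(4)\<close>)
    also have "\<dots> = finsum W (\<lambda>i. a \<odot>\<^bsub>W\<^esub> ?t \<phi> i) ?A"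
    proof (rule W.M.finsum_cong'[OF refl])
      show "(\<lambda>i. a \<odot>\<^bsub>W\<^esub> ?t \<phi> i) \<in> ?A \<rightarrow> carrier W"
        by (intro Pi_I W.smult_closed a funcset_mem[OF t[OF m A(2)]])
      fix i assume "i \<in> ?A"
      then obtain x s where "i = (x, s)" "x \<in> carrier W" "s \<in> carrier G" using A(2) by blast
      then show "?t (a \<odot>\<^bsub>?F\<^esub> \<phi>) i = a \<odot>\<^bsub>W\<^esub> ?t \<phi> i"
        using free_gmod_mem(1)[OF m] rep_act_closed[OF RW] a
        by (simp add: free_gmod_simps(4) W.smult_assoc1)
    qed
    also have "\<dots> = a \<odot>\<^bsub>W\<^esub> eval_free W \<phi>"
      unfolding eval_free_def by (rule W.finsum_smult_ldistr[symmetric, OF A(1) a t[OF m A(2)]])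
    finally show "eval_free W (a \<odot>\<^bsub>?F\<^esub> \<phi>) = a \<odot>\<^bsub>W\<^esub> eval_free W \<phi>" .
  qed
  moreover have "eval_free W (act ?F g \<phi>) = act W g (eval_free W \<phi>)"
    if g: "g \<in> carrier G" and m: "\<phi> \<in> carrier ?F" for g \<phi>
  proof -
    let ?A = "?supp \<phi>" and ?h = "\<lambda>(x, s). (x, g \<otimes> s)"
    have A: "finite ?A" "?A \<subseteq> carrier W \<times> carrier G"
      using free_gmod_mem(3)[OF m] supp[OF m] by auto
    have m': "act ?F g \<phi> \<in> carrier ?F" by (rule free_gmod_act_closed[OF g m])
    have hA: "?h ` ?A \<subseteq> carrier W \<times> carrier G" using A(2) g by auto
    have inj: "inj_on ?h ?A"
      by (rule inj_on_subset[OF _ A(2)]) (use g in \<open>auto intro!: inj_onI\<close>)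
    have e: "?t (act ?F g \<phi>) (?h i) = act W g (?t \<phi> i)" if "i \<in> ?A" for i
    proof -
      obtain x s where i: "i = (x, s)" "x \<in> carrier W" "s \<in> carrier G"
        using subsetD[OF A(2) \<open>i \<in> ?A\<close>] by blast
      then show ?thesis
        using g free_gmod_mem(1)[OF m]
        by (simp add: free_gmod_simps(5) rep_act_mult[OF RW] rep_act_closed[OF RW]
            lin_smult[OF rep_act_lin[OF RW g]])
    qed
    have "eval_free W (act ?F g \<phi>) = finsum W (?t (act ?F g \<phi>)) (?h ` ?A)"
    proof (rule ext[OF m' _ _ hA])
      show "?supp (act ?F g \<phi>) \<subseteq> ?h ` ?A"
      proof clarify
        fix x s assume "act ?F g \<phi> x s \<noteq> \<zero>\<^bsub>K\<^esub>"
        then have "s \<in> carrier G" "\<phi> x (inv g \<otimes> s) \<noteq> \<zero>\<^bsub>K\<^esub>"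
          by (auto simp: free_gmod_simps(5) split: if_splits)
        then show "(x, s) \<in> ?h ` ?A"
          using g by (intro image_eqI[of _ _ "(x, inv g \<otimes> s)"]) auto
      qed
    qed (use A in simp)
    also have "\<dots> = finsum W (\<lambda>i. ?t (act ?F g \<phi>) (?h i)) ?A"
      by (rule W.M.finsum_reindex[OF t[OF m' hA] inj])
    also have "\<dots> = finsum W (\<lambda>i. act W g (?t \<phi> i)) ?A"
      using t[OF m A(2)] rep_act_closed[OF RW g] by (intro W.M.finsum_cong'[OF refl _ e]) blast+
    also have "\<dots> = act W g (eval_free W \<phi>)"
      unfolding eval_free_def using t[OF m A(2)]
      by (intro lin_finsum[symmetric, OF W.module_axioms W.module_axioms rep_act_lin[OF RW g]]) blast
    finally show ?thesis .
  qed
  ultimately show "eval_free W \<in> gmod_hom K G ?F W" by (simp add: gmod_hom_iff)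
  assume w: "w \<in> carrier W"
  define \<delta> where "\<delta> = (\<lambda>x s. if x = w \<and> s = \<one> then \<one>\<^bsub>K\<^esub> else \<zero>\<^bsub>K\<^esub>)"
  have sup: "?supp \<delta> = {(w, \<one>)}" by (auto simp: \<delta>_def)
  have "\<delta> \<in> carrier ?F"
    by (rule free_gmod_memI) (use w sup in \<open>auto simp: \<delta>_def\<close>)
  moreover have "eval_free W \<delta> = w"
    unfolding eval_free_def sup using w rep_act_one[OF RW w]
    by (simp add: \<delta>_def)
  ultimately show "\<exists>\<phi>\<in>carrier ?F. eval_free W \<phi> = w" by blast
qed

text \<open>
  A map that factors as \<open>b \<circ> a\<close> through a summand of a free module is the trace of \<open>b \<pi> a\<close>, where
  \<open>\<pi>\<close> is a linear endomorphism of the free module with trace the identity. Conversely, let \<open>s\<close> be a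
  linear section of the canonical map \<open>b\<close> from the free module on \<open>W\<close>. Then the trace of \<open>\<theta>\<close> is the
  composite of \<open>b\<close> with the trace of \<open>s \<theta>\<close>.
\<close>

lemma factors_proj_iff_trace_whole:
  fixes V :: "('k, 'v, 'g) gmod" and W :: "('k, 'w, 'g) gmod"
  assumes V: "gmodule K G V" and W: "gmodule K G W"
  shows "factors_proj K G V W f \<longleftrightarrow>
    (\<exists>\<theta>\<in>lin K V W. \<forall>v\<in>carrier V. f v = trace (carrier G) V W \<theta> v)"
proof
  note S = G.subgroup_self
  have RV: "rep (carrier G) V" and RW: "rep (carrier G) W" using V W by simp_all
  assume "factors_proj K G V W f"
  then obtain P :: "('k, 'w \<Rightarrow> 'g \<Rightarrow> 'k, 'g) gmod" and a b where
    P: "projective_gmod K G P" and a: "a \<in> gmod_hom K G V P" and b: "b \<in> gmod_hom K G P W"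
    and f: "\<forall>v\<in>carrier V. f v = b (a v)"
    by (auto simp: factors_proj_def)
  obtain X :: "('w \<Rightarrow> 'g \<Rightarrow> 'k) set" and i r where
    i: "i \<in> gmod_hom K G P (free_gmod K G X)" and r: "r \<in> gmod_hom K G (free_gmod K G X) P"
    and ri: "\<forall>x\<in>carrier P. r (i x) = x"
    using P by (auto simp: projective_gmod_def)
  let ?F = "free_gmod K G X"
  have RF: "rep (carrier G) ?F" using free_gmod_gmodule by simp
  have br: "(\<lambda>\<phi>. b (r \<phi>)) \<in> hom (carrier G) ?F W" and ia: "(\<lambda>v. i (a v)) \<in> hom (carrier G) V ?F"
    using hom_comp[of b "carrier G" P W r ?F] hom_comp[of i "carrier G" P ?F a V] a b i r by simp_all
  have l: "(\<lambda>\<phi>. b (r (unit_part \<phi>))) \<in> lin K ?F W"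
    by (rule lin_comp[OF hom_lin[OF br] unit_part_lin])
  have "f v = trace (carrier G) V W (\<lambda>v. b (r (unit_part (i (a v))))) v" if v: "v \<in> carrier V" for v
  proof -
    have iv: "i (a v) \<in> carrier ?F" by (rule hom_closed[OF ia v])
    have "a v \<in> carrier P" using hom_closed[of a "carrier G" V P] a v by simp
    then have "f v = b (r (i (a v)))" using f ri v by simp
    also have "\<dots> = b (r (trace (carrier G) ?F ?F unit_part (i (a v))))"
      using trace_unit_part[OF iv] by simp
    also have "\<dots> = trace (carrier G) ?F W (\<lambda>\<phi>. b (r (unit_part \<phi>))) (i (a v))"
      by (rule trace_postcompose[symmetric, OF S RF RF RW br unit_part_lin iv])
    also have "\<dots> = trace (carrier G) V W (\<lambda>v. b (r (unit_part (i (a v))))) v"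
      by (rule trace_precompose[symmetric, OF S RF RW RV ia l v])
    finally show ?thesis .
  qed
  then show "\<exists>\<theta>\<in>lin K V W. \<forall>v\<in>carrier V. f v = trace (carrier G) V W \<theta> v"
    using lin_comp[OF l hom_lin[OF ia]] by blast
next
  note S = G.subgroup_self
  have RV: "rep (carrier G) V" and RW: "rep (carrier G) W" using V W by simp_all
  let ?F = "free_gmod K G (carrier W)"
  have RF: "rep (carrier G) ?F" using free_gmod_gmodule by simp
  assume "\<exists>\<theta>\<in>lin K V W. \<forall>v\<in>carrier V. f v = trace (carrier G) V W \<theta> v"
  then obtain \<theta> where \<theta>: "\<theta> \<in> lin K V W" and f: "\<And>v. v \<in> carrier V \<Longrightarrow> f v = trace (carrier G) V W \<theta> v"
    by blast
  have b: "eval_free W \<in> hom (carrier G) ?F W" using eval_free_hom_surj(1)[OF W] by simp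
  obtain s where s: "s \<in> lin K W ?F" "\<And>w. w \<in> carrier W \<Longrightarrow> eval_free W (s w) = w"
    using linear_surjection_splits[OF field free_gmod_module rep_module[OF RW] hom_lin[OF b]]
      eval_free_hom_surj(2)[OF W] by metis
  let ?a = "trace (carrier G) V ?F (\<lambda>v. s (\<theta> v))"
  have s\<theta>: "(\<lambda>v. s (\<theta> v)) \<in> lin K V ?F" by (rule lin_comp[OF s(1) \<theta>])
  have a: "?a \<in> hom (carrier G) V ?F" by (rule trace_hom[OF S RV RF s\<theta>])
  have "f v = eval_free W (?a v)" if v: "v \<in> carrier V" for v
  proof -
    have "eval_free W (?a v) = trace (carrier G) V W (\<lambda>v. eval_free W (s (\<theta> v))) v"
      by (rule trace_postcompose[symmetric, OF S RV RF RW b s\<theta> v])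
    also have "\<dots> = trace (carrier G) V W \<theta> v"
    proof -
      interpret W: module K W by (rule rep_module[OF RW])
      show ?thesis unfolding trace_def
        using trace_summand_closed[OF S RV RW \<theta> v] s(2) lin_closed[OF \<theta>] rep_act_closed[OF RV _ v]
        by (intro W.M.finsum_cong') auto
    qed
    finally show ?thesis using f[OF v] by simp
  qed
  then show "factors_proj K G V W f"
    unfolding factors_proj_def using projective_free_gmod a b by auto
qed

lemma subgroup_algebra: "subgroup L G \<Longrightarrow> group_algebra K (G\<lparr>carrier := L\<rparr>)"
  by (simp add: group_algebra_def field G.subgroup_imp_group finite_subgroup)

text \<open>
  The subgroup \<open>L\<close>, taken as a group in its own right, has the same inverses and hence the same trace.
\<close>

lemma factors_proj_iff_trace:
  assumes L: "subgroup L G" and V: "rep L V" and W: "rep L W"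
  shows "factors_proj K (G\<lparr>carrier := L\<rparr>) V W f \<longleftrightarrow>
    (\<exists>\<theta>\<in>lin K V W. \<forall>v\<in>carrier V. f v = trace L V W \<theta> v)"
proof -
  interpret L: group_algebra K "G\<lparr>carrier := L\<rparr>" by (rule subgroup_algebra[OF L])
  interpret W: module K W by (rule rep_module[OF W])
  have "L.trace L V W \<theta> v = trace L V W \<theta> v" if "\<theta> \<in> lin K V W" "v \<in> carrier V" for \<theta> v
    unfolding trace_def L.trace_def using trace_summand_closed[OF L V W that]
    by (intro W.M.finsum_cong') (auto simp: G.m_inv_consistent[OF L])
  then show ?thesis
    unfolding L.factors_proj_iff_trace_whole[OF V W] by (intro bex_cong refl ball_cong) simp
qed

end

section \<open>Stable morphisms and their representatives\<close>

context group_algebra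
begin

text \<open>
  The stable morphism over \<open>L\<close> that is represented by \<open>f\<close>. The lemmas of this section replace each
  operation on stable morphisms by the same operation on representatives, so that later sections
  compute with maps only.
\<close>

abbreviation cls ::
  "'g set \<Rightarrow> ('k, 'v, 'g) gmod \<Rightarrow> ('k, 'w, 'g) gmod \<Rightarrow> ('v \<Rightarrow> 'w) \<Rightarrow> ('v \<Rightarrow> 'w) set" where
  "cls L V W f \<equiv> stab_class K (G\<lparr>carrier := L\<rparr>) V W f"

lemma cls_mem:
  assumes L: "subgroup L G" and V: "rep L V" and W: "rep L W"
  shows "f' \<in> cls L V W f \<longleftrightarrow> f \<in> hom L V W \<and> f' \<in> hom L V W \<and> stably_eq L V W f f'"
proof -
  interpret W: module K W by (rule rep_module[OF W])
  have "factors_proj K (G\<lparr>carrier := L\<rparr>) V W (\<lambda>v. f v \<ominus>\<^bsub>W\<^esub> f' v) \<longleftrightarrow> stably_eq L V W f f'"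
    if h: "f \<in> hom L V W" "f' \<in> hom L V W"
    unfolding factors_proj_iff_trace[OF L V W] stably_eq_def
  proof (intro bex_cong refl ball_cong)
    fix \<theta> v assume m: "\<theta> \<in> lin K V W" "v \<in> carrier V"
    have c: "f v \<in> carrier W" "f' v \<in> carrier W" "trace L V W \<theta> v \<in> carrier W"
      using hom_closed[OF h(1) m(2)] hom_closed[OF h(2) m(2)] trace_closed[OF L V W m] by simp_all
    show "(f v \<ominus>\<^bsub>W\<^esub> f' v = trace L V W \<theta> v) = (f v = f' v \<oplus>\<^bsub>W\<^esub> trace L V W \<theta> v)"
    proof
      assume "f v \<ominus>\<^bsub>W\<^esub> f' v = trace L V W \<theta> v"
      then have "f' v \<oplus>\<^bsub>W\<^esub> trace L V W \<theta> v = f' v \<oplus>\<^bsub>W\<^esub> (f v \<oplus>\<^bsub>W\<^esub> \<ominus>\<^bsub>W\<^esub> f' v)" by (simp add: a_minus_def)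
      also have "\<dots> = f v" using c by (simp add: W.M.a_lcomm[of "f' v" "f v"] W.M.r_neg)
      finally show "f v = f' v \<oplus>\<^bsub>W\<^esub> trace L V W \<theta> v" ..
    next
      assume "f v = f' v \<oplus>\<^bsub>W\<^esub> trace L V W \<theta> v"
      then have "f v \<ominus>\<^bsub>W\<^esub> f' v = (trace L V W \<theta> v \<oplus>\<^bsub>W\<^esub> f' v) \<oplus>\<^bsub>W\<^esub> \<ominus>\<^bsub>W\<^esub> f' v"
        using c by (simp add: a_minus_def W.M.a_comm)
      also have "\<dots> = trace L V W \<theta> v" using c by (simp add: W.M.a_assoc W.M.r_neg)
      finally show "f v \<ominus>\<^bsub>W\<^esub> f' v = trace L V W \<theta> v" .
    qed
  qed
  then show ?thesis by (auto simp: stab_class_def stab_rel_def)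
qed

lemma stably_eq_refl:
  assumes "subgroup L G" "rep L V" "rep L W" "f \<in> hom L V W"
  shows "stably_eq L V W f f"
  using stably_eq_of_eq[OF assms(1-3)] hom_closed[OF assms(4)] by blast

lemma cls_eq_iff:
  assumes L: "subgroup L G" and V: "rep L V" and W: "rep L W"
    and f: "f \<in> hom L V W" "f' \<in> hom L V W"
  shows "cls L V W f = cls L V W f' \<longleftrightarrow> stably_eq L V W f f'"
proof
  assume "cls L V W f = cls L V W f'"
  moreover have "f' \<in> cls L V W f'" using cls_mem[OF L V W] stably_eq_refl[OF L V W] f by blast
  ultimately show "stably_eq L V W f f'" using cls_mem[OF L V W] by blast
next
  assume eq: "stably_eq L V W f f'"
  have "stably_eq L V W f x \<longleftrightarrow> stably_eq L V W f' x" if x: "x \<in> hom L V W" for x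
    using stably_eq_trans[OF L V W eq, of x] stably_eq_sym[OF L V W eq]
      stably_eq_trans[OF L V W _ , of f' f x] hom_closed[OF x] hom_closed[OF f(2)] by blast
  then show "cls L V W f = cls L V W f'" using cls_mem[OF L V W] f by blast
qed

lemma stab_homD:
  assumes "F \<in> stab_hom K (G\<lparr>carrier := L\<rparr>) V W"
  shows "\<exists>f\<in>hom L V W. F = cls L V W f"
  using assms by (auto simp: stab_hom_def stab_class_def quotient_def)

lemma cls_stab_hom: "f \<in> hom L V W \<Longrightarrow> cls L V W f \<in> stab_hom K (G\<lparr>carrier := L\<rparr>) V W"
  by (auto simp: stab_hom_def stab_class_def quotient_def)

lemma UN_cls_const:
  assumes "\<And>x. x \<in> A \<Longrightarrow> B x = C" "A \<noteq> {}"
  shows "(\<Union>x\<in>A. B x) = C"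
  using assms by auto

lemma cls_nonempty:
  assumes "subgroup L G" "rep L V" "rep L W" "f \<in> hom L V W"
  shows "cls L V W f \<noteq> {}"
  using cls_mem[OF assms(1-3)] stably_eq_refl[OF assms] assms(4) by blast

lemma stab_comp_cls:
  assumes L: "subgroup L G" and U: "rep L U" and V: "rep L V" and W: "rep L W"
    and e: "e \<in> hom L V W" and f: "f \<in> hom L U V"
  shows "stab_comp K (G\<lparr>carrier := L\<rparr>) U W (cls L V W e) (cls L U V f) = cls L U W (\<lambda>u. e (f u))"
  unfolding stab_comp_def
proof (intro UN_cls_const cls_nonempty[OF L V W e] cls_nonempty[OF L U V f])
  fix e' f' assume "e' \<in> cls L V W e" "f' \<in> cls L U V f"
  then have m: "e' \<in> hom L V W" "stably_eq L V W e e'" "f' \<in> hom L U V" "stably_eq L U V f f'"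
    using cls_mem[OF L V W] cls_mem[OF L U V] by blast+
  have "stably_eq L U W (\<lambda>u. e (f u)) (\<lambda>u. e (f' u))"
    by (rule stably_eq_postcompose[OF L U V m(4) W e hom_closed[OF m(3)]])
  moreover have "stably_eq L U W (\<lambda>u. e (f' u)) (\<lambda>u. e' (f' u))"
    by (rule stably_eq_precompose[OF L V W m(2) U m(3)])
  ultimately have "stably_eq L U W (\<lambda>u. e (f u)) (\<lambda>u. e' (f' u))"
    using hom_closed[OF hom_comp[OF m(1,3)]] by (rule stably_eq_trans[OF L U W])
  then show "cls L U W (e' \<circ> f') = cls L U W (\<lambda>u. e (f u))"
    using cls_eq_iff[OF L U W hom_comp[OF e f] hom_comp[OF m(1,3)]] by (simp add: comp_def)
qed

lemma stab_iso_cls: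
  assumes L: "subgroup L G" and V: "rep L V" and W: "rep L W" and f: "f \<in> hom L V W"
  shows "cls L V W f \<in> stab_iso K (G\<lparr>carrier := L\<rparr>) V W \<longleftrightarrow>
    (\<exists>g\<in>hom L W V. stably_eq L V V (\<lambda>v. g (f v)) (\<lambda>v. v) \<and> stably_eq L W W (\<lambda>w. f (g w)) (\<lambda>w. w))"
proof -
  have *: "stab_comp K (G\<lparr>carrier := L\<rparr>) V V (cls L W V g) (cls L V W f) = cls L V V id \<and>
     stab_comp K (G\<lparr>carrier := L\<rparr>) W W (cls L V W f) (cls L W V g) = cls L W W id \<longleftrightarrow>
     stably_eq L V V (\<lambda>v. g (f v)) (\<lambda>v. v) \<and> stably_eq L W W (\<lambda>w. f (g w)) (\<lambda>w. w)"
    if g: "g \<in> hom L W V" for g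
    unfolding stab_comp_cls[OF L V W V g f] stab_comp_cls[OF L W V W f g] id_def
      cls_eq_iff[OF L V V hom_comp[OF g f] hom_id] cls_eq_iff[OF L W W hom_comp[OF f g] hom_id] ..
  show ?thesis
  proof
    assume "cls L V W f \<in> stab_iso K (G\<lparr>carrier := L\<rparr>) V W"
    then obtain E where E: "E \<in> stab_hom K (G\<lparr>carrier := L\<rparr>) W V"
      "stab_comp K (G\<lparr>carrier := L\<rparr>) V V E (cls L V W f) = cls L V V id"
      "stab_comp K (G\<lparr>carrier := L\<rparr>) W W (cls L V W f) E = cls L W W id"
      unfolding stab_iso_def by blast
    obtain g where g: "g \<in> hom L W V" "E = cls L W V g" using stab_homD[OF E(1)] by blast
    then show "\<exists>g\<in>hom L W V. stably_eq L V V (\<lambda>v. g (f v)) (\<lambda>v. v) \<and> stably_eq L W W (\<lambda>w. f (g w)) (\<lambda>w. w)"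
      using *[OF g(1)] E(2,3) by blast
  next
    assume "\<exists>g\<in>hom L W V. stably_eq L V V (\<lambda>v. g (f v)) (\<lambda>v. v) \<and> stably_eq L W W (\<lambda>w. f (g w)) (\<lambda>w. w)"
    then obtain g where g: "g \<in> hom L W V"
      "stably_eq L V V (\<lambda>v. g (f v)) (\<lambda>v. v) \<and> stably_eq L W W (\<lambda>w. f (g w)) (\<lambda>w. w)" by blast
    then show "cls L V W f \<in> stab_iso K (G\<lparr>carrier := L\<rparr>) V W"
      using *[OF g(1)] cls_stab_hom[OF f] cls_stab_hom[OF g(1)] unfolding stab_iso_def by blast
  qed
qed

lemma stab_isoD:
  assumes "F \<in> stab_iso K (G\<lparr>carrier := L\<rparr>) V W"
  shows "\<exists>f\<in>hom L V W. F = cls L V W f"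
  using assms stab_homD unfolding stab_iso_def by blast

lemma stab_res_cls:
  assumes M: "subgroup M G" and V: "rep M V" and W: "rep M W" and f: "f \<in> hom M V W"
    and L: "subgroup L G" "L \<subseteq> M"
  shows "stab_res K G L V W (cls M V W f) = cls L V W f"
  unfolding stab_res_def
proof (intro UN_cls_const cls_nonempty[OF M V W f])
  fix f' assume "f' \<in> cls M V W f"
  then have m: "f' \<in> hom M V W" "stably_eq M V W f f'" using cls_mem[OF M V W] by blast+
  have VL: "rep L V" and WL: "rep L W" by (rule rep_subgroup[OF V L] rep_subgroup[OF W L])+
  show "cls L V W f' = cls L V W f"
    using cls_eq_iff[OF L(1) VL WL hom_subgroup[OF f L(2)] hom_subgroup[OF m(1) L(2)]]
      stably_eq_subgroup[OF M V W m(2) L] by simp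
qed

lemma hom_twist:
  assumes "f \<in> hom M V W" "g \<in> carrier G"
    and "\<And>k. k \<in> L \<Longrightarrow> g \<otimes> k \<otimes> inv g \<in> M"
  shows "f \<in> hom L (twist G g V) (twist G g W)"
  using assms by (auto simp: hom_iff)

lemma stably_eq_twist_subgroup:
  assumes M: "subgroup M G" and V: "rep M V" and W: "rep M W" and g: "g \<in> carrier G"
    and L: "subgroup L G" "\<And>k. k \<in> L \<Longrightarrow> g \<otimes> k \<otimes> inv g \<in> M"
    and eq: "stably_eq M V W f f'"
  shows "stably_eq L (twist G g V) (twist G g W) f f'"
proof -
  have MG: "M \<subseteq> carrier G" using M by (rule subgroup.subset)
  have sub: "L \<subseteq> conj_subgroup G M g"
    using conj_subgroup_iff[OF g _ MG] L by (auto simp: subgroup.mem_carrier)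
  have C: "subgroup (conj_subgroup G M g) G" by (rule conj_subgroup_subgroup[OF M g])
  have mem: "g \<otimes> k \<otimes> inv g \<in> M" if "k \<in> conj_subgroup G M g" for k
    using conj_subgroup_iff[OF g _ MG] that conj_subgroup_carrier[OF g MG] by blast
  show ?thesis
    by (rule stably_eq_subgroup[OF C rep_twist[OF V C g mem] rep_twist[OF W C g mem]
          stably_eq_twist[OF M V W g eq] L(1) sub])
qed

lemma stab_twres_cls:
  assumes M: "subgroup M G" and V: "rep M V" and W: "rep M W" and f: "f \<in> hom M V W"
    and g: "g \<in> carrier G"
    and L: "subgroup L G" "\<And>k. k \<in> L \<Longrightarrow> g \<otimes> k \<otimes> inv g \<in> M"
  shows "stab_twres K G g L V W (cls M V W f) = cls L (twist G g V) (twist G g W) f"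
  unfolding stab_twres_def
proof (intro UN_cls_const cls_nonempty[OF M V W f])
  fix f' assume "f' \<in> cls M V W f"
  then have m: "f' \<in> hom M V W" "stably_eq M V W f f'" using cls_mem[OF M V W] by blast+
  have VL: "rep L (twist G g V)" and WL: "rep L (twist G g W)"
    by (rule rep_twist[OF V L(1) g L(2)] rep_twist[OF W L(1) g L(2)], assumption)+
  show "cls L (twist G g V) (twist G g W) f' = cls L (twist G g V) (twist G g W) f"
    using cls_eq_iff[OF L(1) VL WL hom_twist[OF f g L(2)] hom_twist[OF m(1) g L(2)]]
      stably_eq_twist_subgroup[OF M V W g L m(2)] by simp
qed

lemma rep_act_update:
  assumes L: "subgroup L G" and V: "rep L V"
    and eq: "\<And>l v. l \<in> L \<Longrightarrow> v \<in> carrier V \<Longrightarrow> \<alpha> l v = act V l v"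
  shows "rep L (V\<lparr>act := \<alpha>\<rparr>)"
proof (rule repI[OF L])
  show "module K (V\<lparr>act := \<alpha>\<rparr>)" using rep_module[OF V] by simp
  show "act (V\<lparr>act := \<alpha>\<rparr>) g \<in> lin K (V\<lparr>act := \<alpha>\<rparr>) (V\<lparr>act := \<alpha>\<rparr>)" if "g \<in> L" for g
    using lin_cong[OF rep_act_lin[OF V that] _ rep_module[OF V], of "\<alpha> g"] eq that by simp
qed (use eq L rep_act_one[OF V] rep_act_mult[OF V] rep_act_closed[OF V] in
  \<open>auto simp: subgroup.one_closed subgroup.m_closed\<close>)

lemma cls_cod_act_update:
  assumes L: "subgroup L G" and V: "rep L V" and W: "rep L W"
    and eq: "\<And>l w. l \<in> L \<Longrightarrow> w \<in> carrier W \<Longrightarrow> \<beta> l w = act W l w"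
  shows "cls L V (W\<lparr>act := \<beta>\<rparr>) f = cls L V W f"
proof -
  have W': "rep L (W\<lparr>act := \<beta>\<rparr>)" by (rule rep_act_update[OF L W eq])
  have "hom L V (W\<lparr>act := \<beta>\<rparr>) = hom L V W"
    using eq by (auto simp: hom_iff lin_closed)
  moreover have "stably_eq L V (W\<lparr>act := \<beta>\<rparr>) f f' \<longleftrightarrow> stably_eq L V W f f'" for f'
    using stably_eq_act_cong[OF L V W, of "act V" \<beta>] eq by simp
  ultimately show ?thesis using cls_mem[OF L V W] cls_mem[OF L V W'] by blast
qed

end

section \<open>Averaging over an invertible index\<close>

context group_algebra
begin

abbreviation whole :: "'g set" where "whole \<equiv> carrier G"

lemma scale_hom:
  assumes V: "rep L V" and c: "c \<in> carrier K"
  shows "(\<lambda>v. c \<odot>\<^bsub>V\<^esub> v) \<in> hom L V V"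
  using lin_scale[OF rep_module[OF V] lin_id c] lin_smult[OF rep_act_lin[OF V] c]
  by (auto simp: hom_iff)

lemma act_hom_twist:
  assumes V: "rep whole V" and g: "g \<in> carrier G" and L: "L \<subseteq> carrier G"
  shows "act V g \<in> hom L V (twist G g V)" "act V (inv g) \<in> hom L (twist G g V) V"
proof -
  have "act V g (act V k v) = act V (g \<otimes> k \<otimes> inv g) (act V g v)"
    if "k \<in> L" "v \<in> carrier V" for k v
    using that g L by (simp add: rep_act_mult[OF V, symmetric] rep_act_closed[OF V] G.m_assoc subset_iff)
  then show "act V g \<in> hom L V (twist G g V)"
    using rep_act_lin[OF V g] by (simp add: hom_iff)
  have "act V (inv g) (act V (g \<otimes> k \<otimes> inv g) v) = act V k (act V (inv g) v)"
    if "k \<in> L" "v \<in> carrier V" for k v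
    using that g L by (simp add: rep_act_mult[OF V, symmetric] rep_act_closed[OF V] G.m_assoc subset_iff)
  then show "act V (inv g) \<in> hom L (twist G g V) V"
    using rep_act_lin[OF V] g by (simp add: hom_iff)
qed

lemma rep_twist_whole:
  assumes "rep whole V" "g \<in> carrier G" "subgroup L G"
  shows "rep L (twist G g V)"
  using assms by (intro rep_twist[OF assms(1)]) (auto simp: subgroup.mem_carrier)

lemma rep_whole_sub: "rep whole V \<Longrightarrow> subgroup L G \<Longrightarrow> rep L V"
  by (erule rep_subgroup) (simp_all add: subgroup.subset)

end

locale invertible_index = group_algebra K G
  for K :: "('k, 'c) ring_scheme" and G :: "('g, 'd) monoid_scheme" (structure) +
  fixes H :: "'g set"
  assumes H: "subgroup H G"
    and index: "[card (rcosets H)] \<cdot>\<^bsub>K\<^esub> \<one>\<^bsub>K\<^esub> \<noteq> \<zero>\<^bsub>K\<^esub>"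
begin

definition index_inv :: 'k where
  "index_inv = inv\<^bsub>K\<^esub> ([card (rcosets H)] \<cdot>\<^bsub>K\<^esub> \<one>\<^bsub>K\<^esub>)"

lemma index_inv: "index_inv \<in> carrier K" "index_inv \<otimes>\<^bsub>K\<^esub> ([card (rcosets H)] \<cdot>\<^bsub>K\<^esub> \<one>\<^bsub>K\<^esub>) = \<one>\<^bsub>K\<^esub>"
proof -
  have "[card (rcosets H)] \<cdot>\<^bsub>K\<^esub> \<one>\<^bsub>K\<^esub> \<in> Units K"
    using index K.field_Units by simp
  then show "index_inv \<in> carrier K" "index_inv \<otimes>\<^bsub>K\<^esub> ([card (rcosets H)] \<cdot>\<^bsub>K\<^esub> \<one>\<^bsub>K\<^esub>) = \<one>\<^bsub>K\<^esub>"
    by (simp_all add: index_inv_def)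
qed

lemma index_inv_coset_sum_const:
  assumes "module K W" "w \<in> carrier W"
  shows "index_inv \<odot>\<^bsub>W\<^esub> coset_sum G H W (\<lambda>_. w) = w"
proof -
  interpret W: module K W by fact
  show ?thesis
    using index_inv assms(2) by (simp add: coset_sum_const[OF H assms] W.smult_assoc1[symmetric])
qed

text \<open>
  The special case of the orbit argument in which all maps of the family are compared with one and the
  same equivariant map \<open>f\<close>: the sum of \<open>n\<close> copies of \<open>f\<close>, divided by \<open>n\<close>, is \<open>f\<close>.
\<close>

lemma stably_eq_average:
  assumes L: "subgroup L G" and U: "rep L U" and W: "rep L W"
    and F: "\<And>g. g \<in> carrier G \<Longrightarrow> F g \<in> lin K U W"
    and inv: "\<And>h g v. h \<in> H \<Longrightarrow> g \<in> carrier G \<Longrightarrow> v \<in> carrier U \<Longrightarrow> F (h \<otimes> g) v = F g v"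
    and equi: "\<And>l g v. l \<in> L \<Longrightarrow> g \<in> carrier G \<Longrightarrow> v \<in> carrier U \<Longrightarrow>
      F (g \<otimes> inv l) (act U l v) = act W l (F g v)"
    and f: "f \<in> hom L U W"
    and eq: "\<And>g. g \<in> carrier G \<Longrightarrow> stably_eq (L \<inter> conj_subgroup G H g) U W (F g) f"
  shows "stably_eq L U W (\<lambda>v. index_inv \<odot>\<^bsub>W\<^esub> coset_sum G H W (\<lambda>g. F g v)) f"
proof -
  have s: "stably_eq L U W (\<lambda>v. coset_sum G H W (\<lambda>g. F g v)) (\<lambda>v. coset_sum G H W (\<lambda>_. f v))"
    by (rule stably_eq_coset_sum[OF H L U W F _ inv _ equi]) (use hom_lin[OF f] hom_act[OF f] eq in auto)
  have cl: "coset_sum G H W (\<lambda>_. f v) \<in> carrier W" if "v \<in> carrier U" for v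
    by (rule coset_sum_closed[OF H rep_module[OF W] hom_closed[OF f that]])
  have "stably_eq L U W (\<lambda>v. index_inv \<odot>\<^bsub>W\<^esub> coset_sum G H W (\<lambda>g. F g v))
     (\<lambda>v. index_inv \<odot>\<^bsub>W\<^esub> coset_sum G H W (\<lambda>_. f v))"
    by (rule stably_eq_postcompose[OF L U W s W scale_hom[OF W index_inv(1)] cl])
  moreover have "stably_eq L U W (\<lambda>v. index_inv \<odot>\<^bsub>W\<^esub> coset_sum G H W (\<lambda>_. f v)) f"
    using index_inv_coset_sum_const[OF rep_module[OF W]] hom_closed[OF f]
    by (intro stably_eq_of_eq[OF L U W]) auto
  ultimately show ?thesis by (rule stably_eq_trans[OF L U W]) (rule hom_closed[OF f])
qed

text \<open>
  The normalised relative trace from \<open>H\<close> to \<open>G\<close>: it turns maps that are equivariant for \<open>H\<close> into maps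
  that are equivariant for \<open>G\<close>.
\<close>

definition average :: "('k, 'v, 'g) gmod \<Rightarrow> ('k, 'w, 'g) gmod \<Rightarrow> ('v \<Rightarrow> 'w) \<Rightarrow> 'v \<Rightarrow> 'w" where
  "average V W u v = index_inv \<odot>\<^bsub>W\<^esub> coset_sum G H W (\<lambda>g. act W (inv g) (u (act V g v)))"

context
  fixes V :: "('k, 'v, 'g) gmod" and W :: "('k, 'w, 'g) gmod" and u :: "'v \<Rightarrow> 'w"
  assumes V: "rep whole V" and W: "rep whole W" and u: "u \<in> hom H V W"
begin

lemma average_summand_lin:
  "g \<in> carrier G \<Longrightarrow> (\<lambda>v. act W (inv g) (u (act V g v))) \<in> lin K V W"
  by (rule lin_comp[OF rep_act_lin[OF W] lin_comp[OF hom_lin[OF u] rep_act_lin[OF V]]]) simp_all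

lemma average_summand_closed:
  "g \<in> carrier G \<Longrightarrow> v \<in> carrier V \<Longrightarrow> act W (inv g) (u (act V g v)) \<in> carrier W"
  using lin_closed[OF average_summand_lin] .

lemma average_summand_invariant:
  assumes "h \<in> H" "g \<in> carrier G" "v \<in> carrier V"
  shows "act W (inv (h \<otimes> g)) (u (act V (h \<otimes> g) v)) = act W (inv g) (u (act V g v))"
proof -
  have m: "h \<in> carrier G" "act V g v \<in> carrier V" "u (act V g v) \<in> carrier W"
    using assms H rep_act_closed[OF V assms(2,3)] hom_closed[OF u] by (auto simp: subgroup.mem_carrier)
  then show ?thesis
    using assms hom_act[OF u assms(1) m(2)] rep_act_inv(1)[OF W G.subgroup_self m(1)]
    by (simp add: rep_act_mult[OF V] rep_act_mult[OF W] G.inv_mult_group rep_act_closed[OF W])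
qed

lemma average_summand_equivariant:
  assumes "l \<in> carrier G" "g \<in> carrier G" "v \<in> carrier V"
  shows "act W (inv (g \<otimes> inv l)) (u (act V (g \<otimes> inv l) (act V l v)))
    = act W l (act W (inv g) (u (act V g v)))"
proof -
  have m: "act V g v \<in> carrier V" "u (act V g v) \<in> carrier W" "act V l v \<in> carrier V"
    using assms rep_act_closed[OF V] hom_closed[OF u] by auto
  then show ?thesis
    using assms rep_act_inv(1)[OF V G.subgroup_self]
    by (simp add: rep_act_mult[OF V] rep_act_mult[OF W] G.inv_mult_group)
qed

lemma average_hom: "average V W u \<in> hom whole V W"
proof -
  note mV = rep_module[OF V] and mW = rep_module[OF W]
  let ?F = "\<lambda>g v. act W (inv g) (u (act V g v))"
  have l: "average V W u \<in> lin K V W"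
    unfolding average_def[abs_def]
    by (rule lin_scale[OF mW coset_sum_lin[OF H mV mW average_summand_lin] index_inv(1)])
  have "average V W u (act V l v) = act W l (average V W u v)"
    if lv: "l \<in> carrier G" "v \<in> carrier V" for l v
  proof -
    have lv': "act V l v \<in> carrier V" by (rule rep_act_closed[OF V lv])
    have "coset_sum G H W (\<lambda>g. ?F g (act V l v)) = coset_sum G H W (\<lambda>g. ?F (g \<otimes> inv l) (act V l v))"
      by (rule coset_sum_shift[OF H mW, symmetric])
        (use average_summand_closed average_summand_invariant lv lv' in auto)
    also have "\<dots> = coset_sum G H W (\<lambda>g. act W l (?F g v))"
      by (rule coset_sum_cong[OF H mW])
        (use average_summand_closed average_summand_equivariant lv rep_act_closed[OF W lv(1)] in auto)
    also have "\<dots> = act W l (coset_sum G H W (\<lambda>g. ?F g v))"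
      by (rule coset_sum_apply[OF H mW mW rep_act_lin[OF W lv(1)], symmetric])
        (rule average_summand_closed[OF _ lv(2)])
    finally show ?thesis
      unfolding average_def
      using lin_smult[OF rep_act_lin[OF W lv(1)] index_inv(1)]
        coset_sum_closed[OF H mW average_summand_closed[OF _ lv(2)]] by simp
  qed
  with l show ?thesis by (simp add: gmod_hom_iff)
qed

lemma average_stably_eq:
  assumes L: "subgroup L G" and f: "f \<in> hom L V W"
    and eq: "\<And>g. g \<in> carrier G \<Longrightarrow>
      stably_eq (L \<inter> conj_subgroup G H g) V W (\<lambda>v. act W (inv g) (u (act V g v))) f"
  shows "stably_eq L V W (average V W u) f"
  unfolding average_def[abs_def]
  by (rule stably_eq_average[OF L rep_whole_sub[OF V L] rep_whole_sub[OF W L] average_summand_lin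
        average_summand_invariant average_summand_equivariant f eq])
    (use L in \<open>auto simp: subgroup.mem_carrier\<close>)

end

text \<open>
  Restriction to \<open>H\<close> is faithful on stable morphisms: a map that is equivariant for \<open>G\<close> is its own
  average, and it is stably trivial over each conjugate of \<open>H\<close> once it is so over \<open>H\<close>.
\<close>

lemma stably_eq_whole:
  assumes V: "rep whole V" and W: "rep whole W"
    and u: "u \<in> hom whole V W" and u': "u' \<in> hom whole V W"
    and eq: "stably_eq H V W u u'"
  shows "stably_eq whole V W u u'"
proof -
  have sub: "L \<subseteq> carrier G \<Longrightarrow> x \<in> hom whole V W \<Longrightarrow> x \<in> hom L V W" for L x
    by (rule hom_subgroup)
  have uH: "u \<in> hom H V W" by (rule sub[OF subgroup.subset[OF H] u])
  have conj: "act W (inv g) (x (act V g v)) = x v"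
    if "x \<in> hom whole V W" "g \<in> carrier G" "v \<in> carrier V" for x g v
    using hom_act[OF that] rep_act_inv(1)[OF W G.subgroup_self that(2) hom_closed[OF that(1,3)]] by simp
  have e: "stably_eq (whole \<inter> conj_subgroup G H g) V W (\<lambda>v. act W (inv g) (u (act V g v))) u'"
    if g: "g \<in> carrier G" for g
  proof -
    let ?C = "conj_subgroup G H g"
    have C: "subgroup ?C G" by (rule conj_subgroup_subgroup[OF H g])
    have CG: "?C \<subseteq> carrier G" using C by (rule subgroup.subset)
    have tV: "rep ?C (twist G g V)" and tW: "rep ?C (twist G g W)"
      by (rule rep_twist_whole[OF V g C] rep_twist_whole[OF W g C])+
    have "stably_eq ?C (twist G g V) (twist G g W) u u'"
      by (rule stably_eq_twist[OF H rep_whole_sub[OF V H] rep_whole_sub[OF W H] g eq])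
    then have "stably_eq ?C V (twist G g W) (\<lambda>v. u (act V g v)) (\<lambda>v. u' (act V g v))"
      by (rule stably_eq_precompose[OF C tV tW _ rep_whole_sub[OF V C] act_hom_twist(1)[OF V g CG]])
    then have "stably_eq ?C V W (\<lambda>v. act W (inv g) (u (act V g v))) (\<lambda>v. act W (inv g) (u' (act V g v)))"
      by (rule stably_eq_postcompose[OF C rep_whole_sub[OF V C] tW _ rep_whole_sub[OF W C] act_hom_twist(2)[OF W g CG]])
        (use hom_closed[OF u'] rep_act_closed[OF V g] in simp)
    moreover have "stably_eq ?C V W (\<lambda>v. act W (inv g) (u' (act V g v))) u'"
      using conj[OF u' g] hom_closed[OF u']
      by (intro stably_eq_of_eq[OF C rep_whole_sub[OF V C] rep_whole_sub[OF W C]]) auto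
    moreover have "whole \<inter> ?C = ?C" using CG by blast
    ultimately show ?thesis
      using stably_eq_trans[OF C rep_whole_sub[OF V C] rep_whole_sub[OF W C]] hom_closed[OF u'] by simp
  qed
  have "stably_eq whole V W (average V W u) u'"
    by (rule average_stably_eq[OF V W uH G.subgroup_self u' e])
  moreover have "stably_eq whole V W u (average V W u)"
  proof (rule stably_eq_of_eq[OF G.subgroup_self V W])
    fix v assume v: "v \<in> carrier V"
    have "average V W u v = index_inv \<odot>\<^bsub>W\<^esub> coset_sum G H W (\<lambda>g. u v)"
      unfolding average_def using conj[OF u _ v] hom_closed[OF u v]
      by (subst coset_sum_cong[OF H rep_module[OF W]]) auto
    then show "u v = average V W u v"
      using index_inv_coset_sum_const[OF rep_module[OF W] hom_closed[OF u v]] by simp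
    show "average V W u v \<in> carrier W" by (rule hom_closed[OF average_hom[OF V W uH] v])
  qed
  ultimately show ?thesis
    using stably_eq_trans[OF G.subgroup_self V W] hom_closed[OF u'] by blast
qed

end

section \<open>Uniqueness of extensions\<close>

context group_algebra
begin

lemma meet1_mem:
  assumes "subgroup H G" "g \<in> carrier G"
  shows "k \<in> meet1 G H g \<longleftrightarrow> k \<in> H \<and> g \<otimes> k \<otimes> inv g \<in> H"
  using conj_subgroup_iff[OF assms(2) _ subgroup.subset[OF assms(1)]] assms(1)
  by (auto simp: meet1_def subgroup.mem_carrier)

lemma meet1_subgroup: "subgroup H G \<Longrightarrow> g \<in> carrier G \<Longrightarrow> subgroup (meet1 G H g) G"
  unfolding meet1_def by (intro G.subgroups_Inter_pair conj_subgroup_subgroup)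

lemma meet2_subgroup:
  "subgroup H G \<Longrightarrow> g1 \<in> carrier G \<Longrightarrow> g2 \<in> carrier G \<Longrightarrow> subgroup (meet2 G H g2 g1) G"
  unfolding meet2_def by (intro G.subgroups_Inter_pair conj_subgroup_subgroup) auto

lemma meet2_mem:
  assumes "subgroup H G" "g1 \<in> carrier G" "g2 \<in> carrier G"
  shows "k \<in> meet2 G H g2 g1 \<longleftrightarrow> k \<in> H \<and> g1 \<otimes> k \<otimes> inv g1 \<in> H \<and>
     (g2 \<otimes> g1) \<otimes> k \<otimes> inv (g2 \<otimes> g1) \<in> H"
  using conj_subgroup_iff[OF assms(2) _ subgroup.subset[OF assms(1)]]
    conj_subgroup_iff[OF G.m_closed[OF assms(3,2)] _ subgroup.subset[OF assms(1)]] assms(1)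
  by (auto simp: meet2_def subgroup.mem_carrier)

lemma meet1_H:
  assumes "subgroup H G" "h \<in> H"
  shows "meet1 G H h = H"
proof -
  have "h \<otimes> k \<otimes> inv h \<in> H" if "k \<in> H" for k
    using assms that by (simp add: subgroup.m_closed subgroup.m_inv_closed)
  then show ?thesis
    using meet1_mem[OF assms(1) subgroup.mem_carrier[OF assms]] by blast
qed

end

text \<open>
  A descent datum in terms of linear maps: \<open>s g\<close> represents the stable morphism \<open>\<sigma> g\<close>.
\<close>

locale stable_descent = invertible_index K G H
  for K :: "('k, 'c) ring_scheme" and G :: "('g, 'd) monoid_scheme" (structure) and H :: "'g set" +
  fixes W :: "('k, 'w, 'g) gmod" and s :: "'g \<Rightarrow> 'w \<Rightarrow> 'w"
  assumes W: "rep H W"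
    and s_hom: "\<And>g. g \<in> carrier G \<Longrightarrow> s g \<in> hom (meet1 G H g) W (twist G g W)"
    and s_H: "\<And>h. h \<in> H \<Longrightarrow> stably_eq H W (twist G h W) (s h) (act W h)"
    and s_mult: "\<And>g1 g2. g1 \<in> carrier G \<Longrightarrow> g2 \<in> carrier G \<Longrightarrow>
      stably_eq (meet2 G H g2 g1) W (twist G (g2 \<otimes> g1) W) (\<lambda>w. s g2 (s g1 w)) (s (g2 \<otimes> g1))"

context stable_descent
begin

text \<open>
  The map \<open>f\<close> represents the stable isomorphism of an extension, and \<open>f'\<close> represents its inverse.
\<close>

definition models :: "('k, 'v, 'g) gmod \<Rightarrow> ('v \<Rightarrow> 'w) \<Rightarrow> ('w \<Rightarrow> 'v) \<Rightarrow> bool" where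
  "models V f f' \<longleftrightarrow> rep whole V \<and> f \<in> hom H V W \<and> f' \<in> hom H W V \<and>
     stably_eq H V V (\<lambda>v. f' (f v)) (\<lambda>v. v) \<and> stably_eq H W W (\<lambda>w. f (f' w)) (\<lambda>w. w) \<and>
     (\<forall>g\<in>carrier G. stably_eq (meet1 G H g) V (twist G g W) (\<lambda>v. s g (f v)) (\<lambda>v. f (act V g v)))"

lemma meet1_H_mem: "g \<in> carrier G \<Longrightarrow> k \<in> meet1 G H g \<Longrightarrow> g \<otimes> k \<otimes> inv g \<in> H"
  using meet1_mem[OF H] by blast

lemma meet1_sub: "meet1 G H g \<subseteq> H"
  by (simp add: meet1_def)

text \<open>
  Put \<open>u = e' f\<close>. Over \<open>H \<inter> H\<^sup>g\<close> both \<open>e g u\<close> and \<open>f g\<close> agree stably with \<open>s\<^sub>g f\<close>, hence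
  \<open>g u\<close> with \<open>e' f g = u g\<close>. So the conjugates of \<open>u\<close> agree stably with \<open>u\<close>, and the average of \<open>u\<close>
  is the required map.
\<close>

lemma comparison:
  assumes M: "models V f f'" and M': "models V' e e'"
  shows "\<exists>v\<in>hom whole V V'. stably_eq H V V' v (\<lambda>x. e' (f x))"
proof
  have V: "rep whole V" and f: "f \<in> hom H V W" and f': "f' \<in> hom H W V"
    and compat: "\<And>g. g \<in> carrier G \<Longrightarrow>
      stably_eq (meet1 G H g) V (twist G g W) (\<lambda>v. s g (f v)) (\<lambda>v. f (act V g v))"
    using M by (auto simp: models_def)
  have V': "rep whole V'" and e: "e \<in> hom H V' W" and e': "e' \<in> hom H W V'"
    and e'e: "stably_eq H V' V' (\<lambda>v. e' (e v)) (\<lambda>v. v)" and ee': "stably_eq H W W (\<lambda>w. e (e' w)) (\<lambda>w. w)"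
    and compat': "\<And>g. g \<in> carrier G \<Longrightarrow>
      stably_eq (meet1 G H g) V' (twist G g W) (\<lambda>v. s g (e v)) (\<lambda>v. e (act V' g v))"
    using M' by (auto simp: models_def)
  let ?u = "\<lambda>x. e' (f x)"
  have u: "?u \<in> hom H V V'" by (rule hom_comp[OF e' f])
  show "average V V' ?u \<in> hom whole V V'" by (rule average_hom[OF V V' u])
  show "stably_eq H V V' (average V V' ?u) ?u"
  proof (rule average_stably_eq[OF V V' u H u])
    fix g assume g: "g \<in> carrier G"
    define L where "L = meet1 G H g"
    have L: "subgroup L G" and LH: "L \<subseteq> H" and LG: "L \<subseteq> carrier G"
      and mem: "\<And>k. k \<in> L \<Longrightarrow> g \<otimes> k \<otimes> inv g \<in> H"
      using meet1_subgroup[OF H g] meet1_sub meet1_H_mem[OF g] subgroup.subset[OF H]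
      unfolding L_def by auto
    note VL = rep_whole_sub[OF V L] and VL' = rep_whole_sub[OF V' L] and WL = rep_subgroup[OF W L LH]
    have tW: "rep L (twist G g W)" by (rule rep_twist[OF W L g mem])
    have tV': "rep L (twist G g V')" by (rule rep_twist_whole[OF V' g L])
    note fL = hom_subgroup[OF f LH] and eL = hom_subgroup[OF e LH] and e'L = hom_subgroup[OF e' LH]
      and uL = hom_subgroup[OF u LH]
    have sg: "s g \<in> hom L W (twist G g W)" using s_hom[OF g] by (simp add: L_def)
    have gV: "act V g \<in> hom L V (twist G g V)" and gV': "act V' g \<in> hom L V' (twist G g V')"
      and giV': "act V' (inv g) \<in> hom L (twist G g V') V'"
      by (rule act_hom_twist[OF V g LG] act_hom_twist[OF V' g LG])+
    have tf: "f \<in> hom L (twist G g V) (twist G g W)" and te: "e \<in> hom L (twist G g V') (twist G g W)"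
      and te': "e' \<in> hom L (twist G g W) (twist G g V')"
      by (rule hom_twist[OF f g mem] hom_twist[OF e g mem] hom_twist[OF e' g mem], assumption)+
    \<comment> \<open>Steps 1 to 3: \<open>e g u = s\<^sub>g e u = s\<^sub>g f = f g\<close>.\<close>
    have 1: "stably_eq L V (twist G g W) (\<lambda>v. e (act V' g (?u v))) (\<lambda>v. s g (e (?u v)))"
      by (rule stably_eq_precompose[OF L VL' tW stably_eq_sym[OF L VL' tW compat'[OF g, folded L_def]] VL uL])
        (rule hom_closed[OF hom_comp[OF te gV']])
    have "stably_eq L V W (\<lambda>v. e (e' (f v))) f"
      using stably_eq_precompose[OF H W W ee' rep_whole_sub[OF V H] f]
        stably_eq_subgroup[OF H rep_whole_sub[OF V H] W _ L LH] by blast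
    then have 2: "stably_eq L V (twist G g W) (\<lambda>v. s g (e (?u v))) (\<lambda>v. s g (f v))"
      by (rule stably_eq_postcompose[OF L VL WL _ tW sg hom_closed[OF fL]])
    have 3: "stably_eq L V (twist G g W) (\<lambda>v. s g (f v)) (\<lambda>v. f (act V g v))"
      using compat[OF g] by (simp add: L_def)
    note cl = hom_closed[OF hom_comp[OF tf gV]]
    have "stably_eq L V (twist G g W) (\<lambda>v. e (act V' g (?u v))) (\<lambda>v. f (act V g v))"
      by (rule stably_eq_trans[OF L VL tW 1 stably_eq_trans[OF L VL tW 2 3 cl] cl])
    then have 4: "stably_eq L V (twist G g V') (\<lambda>v. e' (e (act V' g (?u v)))) (\<lambda>v. e' (f (act V g v)))"
      by (rule stably_eq_postcompose[OF L VL tW _ tV' te' cl])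
    \<comment> \<open>The stable inverse \<open>e'\<close> of \<open>e\<close>, twisted by \<open>g\<close>, cancels \<open>e\<close>.\<close>
    have "stably_eq L (twist G g V') (twist G g V') (\<lambda>v. e' (e v)) (\<lambda>v. v)"
      by (rule stably_eq_twist_subgroup[OF H rep_whole_sub[OF V' H] rep_whole_sub[OF V' H] g L mem e'e])
    then have 5: "stably_eq L V (twist G g V') (\<lambda>v. e' (e (act V' g (?u v)))) (\<lambda>v. act V' g (?u v))"
      by (rule stably_eq_precompose[OF L tV' tV' _ VL hom_comp[OF gV' uL]])
    note cl' = hom_closed[OF hom_comp[OF gV' uL]]
    have cl4: "e' (f (act V g v)) \<in> carrier (twist G g V')" if "v \<in> carrier V" for v
      by (rule hom_closed[OF te' cl[OF that]])
    have cl5: "e' (e (act V' g (?u v))) \<in> carrier (twist G g V')" if "v \<in> carrier V" for v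
      by (rule hom_closed[OF te' hom_closed[OF te cl'[OF that]]])
    have "stably_eq L V (twist G g V') (\<lambda>v. e' (f (act V g v))) (\<lambda>v. act V' g (?u v))"
      by (rule stably_eq_trans[OF L VL tV' stably_eq_sym[OF L VL tV' 4 cl4] 5 cl'])
    then have 6: "stably_eq L V V' (\<lambda>v. act V' (inv g) (e' (f (act V g v)))) (\<lambda>v. act V' (inv g) (act V' g (?u v)))"
      by (rule stably_eq_postcompose[OF L VL tV' _ VL' giV' cl'])
    have 7: "stably_eq L V V' (\<lambda>v. act V' (inv g) (act V' g (?u v))) ?u"
      using rep_act_inv(1)[OF V' G.subgroup_self g] hom_closed[OF u]
      by (intro stably_eq_of_eq[OF L VL VL']) auto
    have "H \<inter> conj_subgroup G H g = L" by (auto simp: L_def meet1_def)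
    then show "stably_eq (H \<inter> conj_subgroup G H g) V V' (\<lambda>v. act V' (inv g) (e' (f (act V g v)))) ?u"
      using stably_eq_trans[OF L VL VL' 6 7 hom_closed[OF u]] by simp
  qed
qed

lemma comparison_iff:
  assumes M: "models V f f'" and M': "models V' e e'" and v: "v \<in> hom whole V V'"
  shows "stably_eq H V W (\<lambda>x. e (v x)) f \<longleftrightarrow> stably_eq H V V' v (\<lambda>x. e' (f x))"
proof -
  have V: "rep H V" and f: "f \<in> hom H V W"
    using M rep_whole_sub[OF _ H] by (auto simp: models_def)
  have V': "rep H V'" and e: "e \<in> hom H V' W" and e': "e' \<in> hom H W V'"
    and e'e: "stably_eq H V' V' (\<lambda>v. e' (e v)) (\<lambda>v. v)" and ee': "stably_eq H W W (\<lambda>w. e (e' w)) (\<lambda>w. w)"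
    using M' rep_whole_sub[OF _ H] by (auto simp: models_def)
  have vH: "v \<in> hom H V V'" by (rule hom_subgroup[OF v subgroup.subset[OF H]])
  show ?thesis
  proof
    assume "stably_eq H V W (\<lambda>x. e (v x)) f"
    then have 1: "stably_eq H V V' (\<lambda>x. e' (e (v x))) (\<lambda>x. e' (f x))"
      by (rule stably_eq_postcompose[OF H V W _ V' e' hom_closed[OF f]])
    have 2: "stably_eq H V V' (\<lambda>x. e' (e (v x))) v"
      by (rule stably_eq_precompose[OF H V' V' e'e V vH])
    show "stably_eq H V V' v (\<lambda>x. e' (f x))"
      by (rule stably_eq_trans[OF H V V' stably_eq_sym[OF H V V' 2 hom_closed[OF vH]] 1
            hom_closed[OF hom_comp[OF e' f]]])
  next
    assume "stably_eq H V V' v (\<lambda>x. e' (f x))"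
    then have 1: "stably_eq H V W (\<lambda>x. e (v x)) (\<lambda>x. e (e' (f x)))"
      by (rule stably_eq_postcompose[OF H V V' _ W e hom_closed[OF hom_comp[OF e' f]]])
    have 2: "stably_eq H V W (\<lambda>x. e (e' (f x))) f"
      by (rule stably_eq_precompose[OF H W W ee' V f])
    show "stably_eq H V W (\<lambda>x. e (v x)) f"
      by (rule stably_eq_trans[OF H V W 1 2 hom_closed[OF f]])
  qed
qed

text \<open>
  The composite is the identity over \<open>H\<close>, hence over \<open>G\<close> by faithfulness of restriction. By symmetry
  this makes any two comparison maps in opposite directions inverse to each other.
\<close>

lemma comparison_inverse:
  assumes M: "models V f f'" and M': "models V' e e'"
    and v: "v \<in> hom whole V V'" "stably_eq H V V' v (\<lambda>x. e' (f x))"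
    and w: "w \<in> hom whole V' V" "stably_eq H V' V w (\<lambda>x. f' (e x))"
  shows "stably_eq whole V V (\<lambda>x. w (v x)) (\<lambda>x. x)"
proof (rule stably_eq_whole)
  show RV: "rep whole V" "rep whole V" using M by (auto simp: models_def)
  show "(\<lambda>x. w (v x)) \<in> hom whole V V" by (rule hom_comp[OF w(1) v(1)])
  show "(\<lambda>x. x) \<in> hom whole V V" by (rule hom_id)
  have V: "rep H V" and f: "f \<in> hom H V W" and f': "f' \<in> hom H W V"
    and f'f: "stably_eq H V V (\<lambda>v. f' (f v)) (\<lambda>v. v)"
    using M rep_whole_sub[OF _ H] by (auto simp: models_def)
  have V': "rep H V'" and e: "e \<in> hom H V' W" and e': "e' \<in> hom H W V'"
    and ee': "stably_eq H W W (\<lambda>w. e (e' w)) (\<lambda>w. w)"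
    using M' rep_whole_sub[OF _ H] by (auto simp: models_def)
  have vH: "v \<in> hom H V V'" and wH: "w \<in> hom H V' V"
    by (rule hom_subgroup[OF v(1) subgroup.subset[OF H]] hom_subgroup[OF w(1) subgroup.subset[OF H]])+
  have 1: "stably_eq H V V (\<lambda>x. w (v x)) (\<lambda>x. f' (e (v x)))"
    by (rule stably_eq_precompose[OF H V' V w(2) V vH])
  have "stably_eq H V W (\<lambda>x. e (v x)) f" using comparison_iff[OF M M' v(1)] v(2) by simp
  then have 2: "stably_eq H V V (\<lambda>x. f' (e (v x))) (\<lambda>x. f' (f x))"
    by (rule stably_eq_postcompose[OF H V W _ V f' hom_closed[OF f]])
  show "stably_eq H V V (\<lambda>x. w (v x)) (\<lambda>x. x)"
    by (rule stably_eq_trans[OF H V V 1 stably_eq_trans[OF H V V 2 f'f]])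
qed

end

section \<open>Strictly equivariant representatives of a descent datum\<close>

context group_algebra
begin

lemma twist_twist_act:
  assumes "g1 \<in> carrier G" "g2 \<in> carrier G" "l \<in> carrier G"
  shows "act (twist G g1 (twist G g2 W)) l w = act (twist G (g2 \<otimes> g1) W) l w"
  using assms by (simp add: G.inv_mult_group G.m_assoc)

lemma twist_twist_update:
  "twist G g1 (twist G g2 W) =
    (twist G (g2 \<otimes> g1) W)\<lparr>act := act (twist G g1 (twist G g2 W))\<rparr>"
  by (simp add: twist_def)

lemma stably_eq_twist_twist:
  assumes g: "g1 \<in> carrier G" "g2 \<in> carrier G" and L: "subgroup L G"
    and X: "rep L X" and W: "rep L (twist G (g2 \<otimes> g1) W)"
  shows "stably_eq L X (twist G g1 (twist G g2 W)) f f' \<longleftrightarrow>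
    stably_eq L X (twist G (g2 \<otimes> g1) W) f f'"
proof -
  have "act (twist G g1 (twist G g2 W)) l w = act (twist G (g2 \<otimes> g1) W) l w" if "l \<in> L" for l w
    by (rule twist_twist_act[OF g subgroup.mem_carrier[OF L that]])
  then show ?thesis
    using stably_eq_act_cong[OF L X W, of "act X" "act (twist G g1 (twist G g2 W))"]
    by (subst twist_twist_update) simp
qed


lemma hom_twist_twist:
  assumes g: "g1 \<in> carrier G" "g2 \<in> carrier G" and L: "subgroup L G"
  shows "f \<in> hom L X (twist G g1 (twist G g2 W)) \<longleftrightarrow> f \<in> hom L X (twist G (g2 \<otimes> g1) W)"
  using twist_twist_act[OF g, where W = W] subgroup.mem_carrier[OF L] by (auto simp: hom_iff)

lemma twist_one_hom:
  assumes "subgroup L G"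
  shows "f \<in> hom L X (twist G \<one> W) \<longleftrightarrow> f \<in> hom L X W"
  using subgroup.mem_carrier[OF assms] by (auto simp: hom_iff)

lemma twist_one_stably_eq:
  assumes L: "subgroup L G" and X: "rep L X" and W: "rep L W"
  shows "stably_eq L X (twist G \<one> W) f f' \<longleftrightarrow> stably_eq L X W f f'"
  using stably_eq_act_cong[OF L X W, of "act X" "act (twist G \<one> W)"] subgroup.mem_carrier[OF L]
  by (simp add: twist_def)

end

context stable_descent
begin

lemma HG: "h \<in> H \<Longrightarrow> h \<in> carrier G"
  using H by (rule subgroup.mem_carrier)

lemma rep_twist_H:
  assumes "g \<in> carrier G" "subgroup L G" "\<And>k. k \<in> L \<Longrightarrow> g \<otimes> k \<otimes> inv g \<in> H"
  shows "rep L (twist G g W)"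
  by (rule rep_twist[OF W assms(2,1,3)])

lemma act_H_hom_twist:
  assumes "h \<in> H" "L \<subseteq> H"
  shows "act W h \<in> hom L W (twist G h W)"
proof -
  have "act W h (act W k w) = act W (h \<otimes> k \<otimes> inv h) (act W h w)" if "k \<in> L" "w \<in> carrier W" for k w
  proof -
    have "k \<in> H" using that assms by blast
    then show ?thesis
      using that assms(1) H HG
      by (simp add: rep_act_mult[OF W, symmetric] subgroup.m_closed subgroup.m_inv_closed G.m_assoc)
  qed
  then show ?thesis using rep_act_lin[OF W assms(1)] by (simp add: hom_iff)
qed

text \<open>
  The cocycle condition for \<open>h\<close> and \<open>u\<close>, with \<open>s h\<close> replaced by the action of \<open>h\<close>. No restriction to a
  smaller subgroup is lost, because \<open>H \<inter> H\<^bsup>hu\<^esup> = H \<inter> H\<^sup>u\<close>.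
\<close>

lemma s_left:
  assumes h: "h \<in> H" and u: "u \<in> carrier G"
  shows "stably_eq (meet1 G H u) W (twist G (h \<otimes> u) W) (\<lambda>w. act W h (s u w)) (s (h \<otimes> u))"
proof -
  define L where "L = meet1 G H u"
  have hG: "h \<in> carrier G" by (rule HG[OF h])
  have L: "subgroup L G" and LH: "L \<subseteq> H" using meet1_subgroup[OF H u] meet1_sub by (simp_all add: L_def)
  have LG: "k \<in> carrier G" if "k \<in> L" for k using that LH HG by blast
  have mu: "u \<otimes> k \<otimes> inv u \<in> H" if "k \<in> L" for k
    using that meet1_H_mem[OF u] by (simp add: L_def)
  have mhu: "(h \<otimes> u) \<otimes> k \<otimes> inv (h \<otimes> u) \<in> H" if "k \<in> L" for k
  proof -
    have "(h \<otimes> u) \<otimes> k \<otimes> inv (h \<otimes> u) = h \<otimes> (u \<otimes> k \<otimes> inv u) \<otimes> inv h"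
      using hG u LG[OF that] by (simp add: G.inv_mult_group G.m_assoc)
    then show ?thesis using mu[OF that] h H by (simp add: subgroup.m_closed subgroup.m_inv_closed)
  qed
  have m2: "meet2 G H h u = L"
  proof (rule Set.set_eqI)
    fix k
    show "k \<in> meet2 G H h u \<longleftrightarrow> k \<in> L"
      using mhu[of k] meet2_mem[OF H u hG, of k] meet1_mem[OF H u, of k] unfolding L_def by blast
  qed
  have WL: "rep L W" by (rule rep_subgroup[OF W L LH])
  have t: "rep L (twist G (h \<otimes> u) W)" by (rule rep_twist_H[OF G.m_closed[OF hG u] L mhu])
  have tu: "rep L (twist G u W)" by (rule rep_twist_H[OF u L mu])
  have tW: "rep H (twist G h W)"
    by (rule rep_twist_H[OF hG H]) (use h H in \<open>simp add: subgroup.m_closed subgroup.m_inv_closed\<close>)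
  have su: "s u \<in> hom L W (twist G u W)" using s_hom[OF u] by (simp add: L_def)
  have "stably_eq L (twist G u W) (twist G u (twist G h W)) (s h) (act W h)"
    by (rule stably_eq_twist_subgroup[OF H W tW u L mu s_H[OF h]])
  then have "stably_eq L (twist G u W) (twist G (h \<otimes> u) W) (s h) (act W h)"
    using stably_eq_twist_twist[OF u hG L tu t] by simp
  then have 1: "stably_eq L W (twist G (h \<otimes> u) W) (\<lambda>w. s h (s u w)) (\<lambda>w. act W h (s u w))"
    by (rule stably_eq_precompose[OF L tu t _ WL su])
  have cl: "act W h (s u w) \<in> carrier (twist G (h \<otimes> u) W)" if "w \<in> carrier W" for w
    using rep_act_closed[OF W h] hom_closed[OF su that] by simp
  have cl2: "s (h \<otimes> u) w \<in> carrier (twist G (h \<otimes> u) W)" if "w \<in> carrier W" for w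
    using hom_closed[OF s_hom that] hG u by simp
  show ?thesis
    using stably_eq_trans[OF L WL t stably_eq_sym[OF L WL t 1 cl] s_mult[OF u hG, unfolded m2] cl2]
    unfolding L_def .
qed

lemma s_right:
  assumes h: "h \<in> H" and u: "u \<in> carrier G"
  shows "stably_eq (meet1 G H (u \<otimes> h)) W (twist G (u \<otimes> h) W) (\<lambda>w. s u (act W h w)) (s (u \<otimes> h))"
proof -
  define L where "L = meet1 G H (u \<otimes> h)"
  have hG: "h \<in> carrier G" by (rule HG[OF h])
  have uh: "u \<otimes> h \<in> carrier G" using u hG by simp
  have L: "subgroup L G" and LH: "L \<subseteq> H" using meet1_subgroup[OF H uh] meet1_sub by (simp_all add: L_def)
  have LG: "k \<in> carrier G" if "k \<in> L" for k using that LH HG by blast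
  have muh: "(u \<otimes> h) \<otimes> k \<otimes> inv (u \<otimes> h) \<in> H" if "k \<in> L" for k
    using that meet1_H_mem[OF uh] by (simp add: L_def)
  have mh: "h \<otimes> k \<otimes> inv h \<in> H" if "k \<in> L" for k
    using that h LH H by (auto simp: subgroup.m_closed subgroup.m_inv_closed)
  have mu: "h \<otimes> k \<otimes> inv h \<in> meet1 G H u" if "k \<in> L" for k
  proof -
    have "(u \<otimes> h) \<otimes> k \<otimes> inv (u \<otimes> h) = u \<otimes> (h \<otimes> k \<otimes> inv h) \<otimes> inv u"
      using hG u LG[OF that] by (simp add: G.inv_mult_group G.m_assoc)
    then show ?thesis using muh[OF that] mh[OF that] meet1_mem[OF H u] by simp
  qed
  have m2: "meet2 G H u h = L"
  proof (rule Set.set_eqI)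
    fix k
    show "k \<in> meet2 G H u h \<longleftrightarrow> k \<in> L"
      using mh[of k] meet2_mem[OF H hG u, of k] meet1_mem[OF H uh, of k] unfolding L_def by blast
  qed
  have WL: "rep L W" by (rule rep_subgroup[OF W L LH])
  have t: "rep L (twist G (u \<otimes> h) W)" by (rule rep_twist_H[OF uh L muh])
  have th: "rep L (twist G h W)" by (rule rep_twist_H[OF hG L mh])
  have tH: "rep H (twist G h W)"
    by (rule rep_twist_H[OF hG H]) (use h H in \<open>simp add: subgroup.m_closed subgroup.m_inv_closed\<close>)
  have "s u \<in> hom L (twist G h W) (twist G h (twist G u W))"
    by (rule hom_twist[OF s_hom[OF u] hG mu])
  then have su: "s u \<in> hom L (twist G h W) (twist G (u \<otimes> h) W)"
    by (rule hom_twist_twist[OF hG u L, THEN iffD1])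
  have ah: "act W h \<in> hom L W (twist G h W)" by (rule act_H_hom_twist[OF h LH])
  have "stably_eq L W (twist G h W) (s h) (act W h)"
    by (rule stably_eq_subgroup[OF H W tH s_H[OF h] L LH])
  then have 1: "stably_eq L W (twist G (u \<otimes> h) W) (\<lambda>w. s u (s h w)) (\<lambda>w. s u (act W h w))"
    by (rule stably_eq_postcompose[OF L WL th _ t su hom_closed[OF ah]])
  note cl = hom_closed[OF hom_comp[OF su ah]]
  have cl2: "s (u \<otimes> h) w \<in> carrier (twist G (u \<otimes> h) W)" if "w \<in> carrier W" for w
    using hom_closed[OF s_hom[OF uh] that] .
  show ?thesis
    using stably_eq_trans[OF L WL t stably_eq_sym[OF L WL t 1 cl] s_mult[OF hG u, unfolded m2] cl2]
    unfolding L_def .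
qed

definition double_coset_rep :: "'g \<Rightarrow> 'g" where
  "double_coset_rep u = (SOME x. \<exists>a\<in>H. \<exists>b\<in>H. x = a \<otimes> u \<otimes> b)"

text \<open>
  A factorisation \<open>u = a d b\<close> with \<open>a, b \<in> H\<close>, where \<open>d\<close> is the chosen representative of \<open>H u H\<close>.
\<close>

definition double_coset_factors :: "'g \<Rightarrow> 'g \<times> 'g" where
  "double_coset_factors u = (SOME p. fst p \<in> H \<and> snd p \<in> H \<and> u = fst p \<otimes> double_coset_rep u \<otimes> snd p)"

text \<open>
  The representatives \<open>s u\<close> satisfy the compatibility with \<open>H\<close> on both sides only stably. Prescribing
  them on one element of each double coset makes it strict.
\<close>

definition \<tau> :: "'g \<Rightarrow> 'w \<Rightarrow> 'w" where
  "\<tau> u w = act W (fst (double_coset_factors u)) (s (double_coset_rep u) (act W (snd (double_coset_factors u)) w))"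

lemma double_coset_rep:
  assumes u: "u \<in> carrier G"
  shows "double_coset_rep u \<in> carrier G" "fst (double_coset_factors u) \<in> H" "snd (double_coset_factors u) \<in> H"
    "u = fst (double_coset_factors u) \<otimes> double_coset_rep u \<otimes> snd (double_coset_factors u)"
proof -
  have "\<exists>a\<in>H. \<exists>b\<in>H. u = a \<otimes> u \<otimes> b"
    using u H by (intro bexI[of _ "\<one>"]) (auto simp: subgroup.one_closed)
  then have "\<exists>x. \<exists>a\<in>H. \<exists>b\<in>H. x = a \<otimes> u \<otimes> b" by blast
  then have "\<exists>a\<in>H. \<exists>b\<in>H. double_coset_rep u = a \<otimes> u \<otimes> b" unfolding double_coset_rep_def by (rule someI_ex)
  then obtain a b where ab: "a \<in> H" "b \<in> H" "double_coset_rep u = a \<otimes> u \<otimes> b" by blast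
  have abG: "a \<in> carrier G" "b \<in> carrier G" using ab HG by auto
  show "double_coset_rep u \<in> carrier G" using ab abG u by simp
  have "u = inv a \<otimes> double_coset_rep u \<otimes> inv b" using ab(3) abG u by (simp add: G.m_assoc)
  then have "\<exists>p. fst p \<in> H \<and> snd p \<in> H \<and> u = fst p \<otimes> double_coset_rep u \<otimes> snd p"
    using ab H by (intro exI[of _ "(inv a, inv b)"]) (simp add: subgroup.m_inv_closed)
  then have "fst (double_coset_factors u) \<in> H \<and> snd (double_coset_factors u) \<in> H \<and> u = fst (double_coset_factors u) \<otimes> double_coset_rep u \<otimes> snd (double_coset_factors u)"
    unfolding double_coset_factors_def by (rule someI_ex)
  then show "fst (double_coset_factors u) \<in> H" "snd (double_coset_factors u) \<in> H"
    "u = fst (double_coset_factors u) \<otimes> double_coset_rep u \<otimes> snd (double_coset_factors u)" by blast+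
qed

lemma double_coset_rep_invariant:
  assumes u: "u \<in> carrier G" and h: "h \<in> H" and k: "k \<in> H"
  shows "double_coset_rep (h \<otimes> u \<otimes> k) = double_coset_rep u"
proof -
  have hk: "h \<in> carrier G" "k \<in> carrier G" using h k HG by auto
  have "(\<exists>a\<in>H. \<exists>b\<in>H. x = a \<otimes> (h \<otimes> u \<otimes> k) \<otimes> b) \<longleftrightarrow> (\<exists>a\<in>H. \<exists>b\<in>H. x = a \<otimes> u \<otimes> b)" for x
  proof
    assume "\<exists>a\<in>H. \<exists>b\<in>H. x = a \<otimes> (h \<otimes> u \<otimes> k) \<otimes> b"
    then obtain a b where ab: "a \<in> H" "b \<in> H" "x = a \<otimes> (h \<otimes> u \<otimes> k) \<otimes> b" by blast
    then have "x = (a \<otimes> h) \<otimes> u \<otimes> (k \<otimes> b)" using hk u HG by (simp add: G.m_assoc)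
    then show "\<exists>a\<in>H. \<exists>b\<in>H. x = a \<otimes> u \<otimes> b"
      using ab h k H subgroup.m_closed by metis
  next
    assume "\<exists>a\<in>H. \<exists>b\<in>H. x = a \<otimes> u \<otimes> b"
    then obtain a b where ab: "a \<in> H" "b \<in> H" "x = a \<otimes> u \<otimes> b" by blast
    then have "x = (a \<otimes> inv h) \<otimes> (h \<otimes> u \<otimes> k) \<otimes> (inv k \<otimes> b)"
      using hk u HG by (simp add: G.m_assoc)
    then show "\<exists>a\<in>H. \<exists>b\<in>H. x = a \<otimes> (h \<otimes> u \<otimes> k) \<otimes> b"
      using ab h k H subgroup.m_closed subgroup.m_inv_closed by metis
  qed
  then show ?thesis unfolding double_coset_rep_def by simp
qed

text \<open>
  Two factorisations of the same element differ by some \<open>k \<in> H\<close> with \<open>d k d\<^sup>-\<^sup>1 \<in> H\<close>, and \<open>s d\<close> is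
  equivariant for these \<open>k\<close>. So \<open>\<tau>\<close> does not depend on the factorisation.
\<close>

lemma s_double_coset_unique:
  assumes d: "d \<in> carrier G" and m: "a \<in> H" "b \<in> H" "a' \<in> H" "b' \<in> H"
    and eq: "a \<otimes> d \<otimes> b = a' \<otimes> d \<otimes> b'" and w: "w \<in> carrier W"
  shows "act W a (s d (act W b w)) = act W a' (s d (act W b' w))"
proof -
  have mG: "a \<in> carrier G" "b \<in> carrier G" "a' \<in> carrier G" "b' \<in> carrier G" using m HG by auto
  let ?k = "b' \<otimes> inv b" and ?l = "inv a' \<otimes> a"
  have kl: "?k \<in> H" "?l \<in> H" using m H by (auto simp: subgroup.m_closed subgroup.m_inv_closed)
  have "d \<otimes> ?k \<otimes> inv d = inv a' \<otimes> (a' \<otimes> d \<otimes> b') \<otimes> inv b \<otimes> inv d"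
    using mG d by (simp add: G.m_assoc)
  also have "\<dots> = ?l" unfolding eq[symmetric] using mG d by (simp add: G.m_assoc)
  finally have dk: "d \<otimes> ?k \<otimes> inv d = ?l" .
  then have km: "?k \<in> meet1 G H d" using meet1_mem[OF H d] kl by simp
  let ?x = "act W b w"
  have x: "?x \<in> carrier W" by (rule rep_act_closed[OF W m(2) w])
  have sx: "s d ?x \<in> carrier W" using hom_closed[OF s_hom[OF d] x] by simp
  have "?k \<otimes> b = b'" using mG by (simp add: G.m_assoc)
  then have "act W b' w = act W ?k ?x" using rep_act_mult[OF W kl(1) m(2) w] by simp
  then have "s d (act W b' w) = act W ?l (s d ?x)"
    using hom_act[OF s_hom[OF d] km x] dk by simp
  moreover have "a' \<otimes> ?l = a" using mG by simp
  ultimately show ?thesis using rep_act_mult[OF W m(3) kl(2) sx] by simp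
qed

lemma \<tau>_eq:
  assumes d: "u \<in> carrier G" and m: "a \<in> H" "b \<in> H" "u = a \<otimes> double_coset_rep u \<otimes> b" and w: "w \<in> carrier W"
  shows "\<tau> u w = act W a (s (double_coset_rep u) (act W b w))"
  unfolding \<tau>_def
  by (rule s_double_coset_unique[OF double_coset_rep(1)[OF d] double_coset_rep(2,3)[OF d] m(1,2) _ w])
    (use m(3) double_coset_rep(4)[OF d] in simp)

lemma s_lin: "g \<in> carrier G \<Longrightarrow> s g \<in> lin K W W"
  using hom_lin[OF s_hom] by simp

lemma \<tau>_lin: "u \<in> carrier G \<Longrightarrow> \<tau> u \<in> lin K W W"
  unfolding \<tau>_def[abs_def]
  by (rule lin_comp[OF rep_act_lin[OF W double_coset_rep(2)] lin_comp[OF s_lin[OF double_coset_rep(1)] rep_act_lin[OF W double_coset_rep(3)]]])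

lemma \<tau>_closed: "u \<in> carrier G \<Longrightarrow> w \<in> carrier W \<Longrightarrow> \<tau> u w \<in> carrier W"
  by (rule lin_closed[OF \<tau>_lin])

lemma \<tau>_left:
  assumes u: "u \<in> carrier G" and h: "h \<in> H" and w: "w \<in> carrier W"
  shows "\<tau> (h \<otimes> u) w = act W h (\<tau> u w)"
proof -
  have hG: "h \<in> carrier G" by (rule HG[OF h])
  note d = double_coset_rep[OF u]
  have m: "fst (double_coset_factors u) \<in> carrier G" "snd (double_coset_factors u) \<in> carrier G" using d HG by auto
  have r: "double_coset_rep (h \<otimes> u) = double_coset_rep u"
    using double_coset_rep_invariant[OF u h subgroup.one_closed[OF H]] hG u by simp
  have "h \<otimes> u = h \<otimes> (fst (double_coset_factors u) \<otimes> double_coset_rep u \<otimes> snd (double_coset_factors u))" using d(4) by simp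
  also have "\<dots> = (h \<otimes> fst (double_coset_factors u)) \<otimes> double_coset_rep u \<otimes> snd (double_coset_factors u)" using m hG d(1) by (simp add: G.m_assoc)
  finally have e: "h \<otimes> u = (h \<otimes> fst (double_coset_factors u)) \<otimes> double_coset_rep (h \<otimes> u) \<otimes> snd (double_coset_factors u)" unfolding r .
  have "\<tau> (h \<otimes> u) w = act W (h \<otimes> fst (double_coset_factors u)) (s (double_coset_rep (h \<otimes> u)) (act W (snd (double_coset_factors u)) w))"
    by (rule \<tau>_eq[OF _ _ d(3) e w]) (use hG u h d(2) H in \<open>auto simp: subgroup.m_closed\<close>)
  then show ?thesis
    unfolding \<tau>_def r
    using rep_act_mult[OF W h d(2)] lin_closed[OF s_lin[OF d(1)] rep_act_closed[OF W d(3) w]] by simp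
qed

lemma \<tau>_right:
  assumes u: "u \<in> carrier G" and h: "h \<in> H" and w: "w \<in> carrier W"
  shows "\<tau> (u \<otimes> h) w = \<tau> u (act W h w)"
proof -
  have hG: "h \<in> carrier G" by (rule HG[OF h])
  note d = double_coset_rep[OF u]
  have m: "fst (double_coset_factors u) \<in> carrier G" "snd (double_coset_factors u) \<in> carrier G" using d HG by auto
  have r: "double_coset_rep (u \<otimes> h) = double_coset_rep u"
    using double_coset_rep_invariant[OF u subgroup.one_closed[OF H] h] hG u by simp
  have "u \<otimes> h = (fst (double_coset_factors u) \<otimes> double_coset_rep u \<otimes> snd (double_coset_factors u)) \<otimes> h" using d(4) by simp
  also have "\<dots> = fst (double_coset_factors u) \<otimes> double_coset_rep u \<otimes> (snd (double_coset_factors u) \<otimes> h)" using m hG d(1) by (simp add: G.m_assoc)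
  finally have e: "u \<otimes> h = fst (double_coset_factors u) \<otimes> double_coset_rep (u \<otimes> h) \<otimes> (snd (double_coset_factors u) \<otimes> h)" unfolding r .
  have "\<tau> (u \<otimes> h) w = act W (fst (double_coset_factors u)) (s (double_coset_rep (u \<otimes> h)) (act W (snd (double_coset_factors u) \<otimes> h) w))"
    by (rule \<tau>_eq[OF _ d(2) _ e w]) (use hG u h d(3) H in \<open>auto simp: subgroup.m_closed\<close>)
  then show ?thesis unfolding \<tau>_def r using rep_act_mult[OF W d(3) h w] by simp
qed

lemma \<tau>_hom:
  assumes u: "u \<in> carrier G"
  shows "\<tau> u \<in> hom (meet1 G H u) W (twist G u W)"
proof -
  have "\<tau> u (act W k w) = act W (u \<otimes> k \<otimes> inv u) (\<tau> u w)" if k: "k \<in> meet1 G H u" and w: "w \<in> carrier W" for k w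
  proof -
    have kH: "k \<in> H" "u \<otimes> k \<otimes> inv u \<in> H" using k meet1_mem[OF H u] by auto
    have "u \<otimes> k = (u \<otimes> k \<otimes> inv u) \<otimes> u" using HG[OF kH(1)] u by (simp add: G.m_assoc)
    then show ?thesis using \<tau>_left[OF u kH(2) w] \<tau>_right[OF u kH(1) w] by simp
  qed
  then show ?thesis using \<tau>_lin[OF u] by (simp add: hom_iff)
qed

text \<open>
  Two instances of the cocycle condition with one factor in \<open>H\<close>, applied to \<open>u = a (d b)\<close>.
\<close>

lemma \<tau>_stably_eq:
  assumes u: "u \<in> carrier G"
  shows "stably_eq (meet1 G H u) W (twist G u W) (\<tau> u) (s u)"
proof -
  note d = double_coset_rep[OF u]
  define a b e where "a = fst (double_coset_factors u)" and "b = snd (double_coset_factors u)" and "e = double_coset_rep u"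
  have m: "a \<in> H" "b \<in> H" "e \<in> carrier G" "u = a \<otimes> e \<otimes> b" using d by (simp_all add: a_def b_def e_def)
  have mG: "a \<in> carrier G" "b \<in> carrier G" using m HG by auto
  have eb: "e \<otimes> b \<in> carrier G" and u': "a \<otimes> (e \<otimes> b) = u"
    using m mG by (simp_all add: G.m_assoc)
  define L where "L = meet1 G H (e \<otimes> b)"
  have L: "subgroup L G" and LH: "L \<subseteq> H" using meet1_subgroup[OF H eb] meet1_sub by (simp_all add: L_def)
  have mL: "(e \<otimes> b) \<otimes> k \<otimes> inv (e \<otimes> b) \<in> H" if "k \<in> L" for k
    using that meet1_H_mem[OF eb] by (simp add: L_def)
  have aux: "u \<otimes> k \<otimes> inv u = a \<otimes> ((e \<otimes> b) \<otimes> k \<otimes> inv (e \<otimes> b)) \<otimes> inv a"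
    if "k \<in> carrier G" for k
    unfolding u'[symmetric] using that eb mG by (simp add: G.inv_mult_group G.m_assoc m(3))
  have LL: "meet1 G H u = L"
  proof (rule Set.set_eqI)
    fix k
    have "a \<otimes> x \<otimes> inv a \<in> H \<longleftrightarrow> x \<in> H" if x: "x \<in> carrier G" for x
    proof
      assume "a \<otimes> x \<otimes> inv a \<in> H"
      then have "inv a \<otimes> (a \<otimes> x \<otimes> inv a) \<otimes> a \<in> H"
        using m(1) H by (simp add: subgroup.m_closed subgroup.m_inv_closed)
      then show "x \<in> H" using x mG by (simp add: G.m_assoc)
    qed (use m(1) H in \<open>simp add: subgroup.m_closed subgroup.m_inv_closed\<close>)
    then show "k \<in> meet1 G H u \<longleftrightarrow> k \<in> L"
      unfolding L_def meet1_mem[OF H u] meet1_mem[OF H eb] using aux[of k] HG[of k] eb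
      by (metis G.inv_closed G.m_closed)
  qed
  have WL: "rep L W" by (rule rep_subgroup[OF W L LH])
  have t: "rep L (twist G (e \<otimes> b) W)" by (rule rep_twist_H[OF eb L mL])
  have tu: "rep L (twist G u W)"
    by (rule rep_twist_H[OF u L]) (use LL meet1_H_mem[OF u] in blast)
  have ah: "act W a \<in> hom L (twist G (e \<otimes> b) W) (twist G u W)"
  proof -
    have "act W a \<in> hom L (twist G (e \<otimes> b) W) (twist G (e \<otimes> b) (twist G a W))"
      by (rule hom_twist[OF act_H_hom_twist[OF m(1) subset_refl] eb mL])
    then show ?thesis by (rule hom_twist_twist[OF eb mG(1) L, THEN iffD1, unfolded u'])
  qed
  have se: "stably_eq L W (twist G (e \<otimes> b) W) (\<lambda>w. s e (act W b w)) (s (e \<otimes> b))"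
    using s_right[OF m(2,3)] by (simp add: L_def)
  have 1: "stably_eq L W (twist G u W) (\<lambda>w. act W a (s e (act W b w))) (\<lambda>w. act W a (s (e \<otimes> b) w))"
    by (rule stably_eq_postcompose[OF L WL t se tu ah]) (use lin_closed[OF s_lin[OF eb]] in simp)
  have 2: "stably_eq L W (twist G u W) (\<lambda>w. act W a (s (e \<otimes> b) w)) (s u)"
    using s_left[OF m(1) eb] u' by (simp add: L_def)
  have "stably_eq L W (twist G u W) (\<lambda>w. act W a (s e (act W b w))) (s u)"
    by (rule stably_eq_trans[OF L WL tu 1 2]) (use lin_closed[OF s_lin[OF u]] in simp)
  then show ?thesis unfolding LL \<tau>_def[abs_def] a_def b_def e_def .
qed

lemma \<tau>_mult:
  assumes g1: "g1 \<in> carrier G" and g2: "g2 \<in> carrier G"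
  shows "stably_eq (meet2 G H g2 g1) W (twist G (g2 \<otimes> g1) W) (\<lambda>w. \<tau> g2 (\<tau> g1 w)) (\<tau> (g2 \<otimes> g1))"
proof -
  define L where "L = meet2 G H g2 g1"
  have g: "g2 \<otimes> g1 \<in> carrier G" using g1 g2 by simp
  have L: "subgroup L G" by (simp add: L_def meet2_subgroup[OF H g1 g2])
  note mem = meet2_mem[OF H g1 g2, folded L_def]
  have LH: "L \<subseteq> H" and L1: "L \<subseteq> meet1 G H g1" and L21: "L \<subseteq> meet1 G H (g2 \<otimes> g1)"
    using mem meet1_mem[OF H g1] meet1_mem[OF H g] by blast+
  have c1: "g1 \<otimes> k \<otimes> inv g1 \<in> H" if "k \<in> L" for k using mem that by blast
  have c21: "(g2 \<otimes> g1) \<otimes> k \<otimes> inv (g2 \<otimes> g1) \<in> H" if "k \<in> L" for k using mem that by blast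
  have c2: "g1 \<otimes> k \<otimes> inv g1 \<in> meet1 G H g2" if k: "k \<in> L" for k
  proof -
    have kG: "k \<in> carrier G" using k LH HG by blast
    have "g2 \<otimes> (g1 \<otimes> k \<otimes> inv g1) \<otimes> inv g2
      = (g2 \<otimes> g1) \<otimes> k \<otimes> inv (g2 \<otimes> g1)"
      using g1 g2 kG by (simp add: G.inv_mult_group G.m_assoc)
    then show ?thesis using meet1_mem[OF H g2] c1[OF k] c21[OF k] by simp
  qed
  have WL: "rep L W" by (rule rep_subgroup[OF W L LH])
  have t1: "rep L (twist G g1 W)" by (rule rep_twist_H[OF g1 L c1])
  have t21: "rep L (twist G (g2 \<otimes> g1) W)" by (rule rep_twist_H[OF g L c21])
  have M1: "subgroup (meet1 G H g1) G" and M2: "subgroup (meet1 G H g2) G" and M: "subgroup (meet1 G H (g2 \<otimes> g1)) G"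
    by (rule meet1_subgroup[OF H g1] meet1_subgroup[OF H g2] meet1_subgroup[OF H g])+
  note RM = rep_subgroup[OF W _ meet1_sub] and RT = rep_twist_H[OF _ _ meet1_H_mem]
  have 1: "stably_eq L W (twist G g1 W) (\<tau> g1) (s g1)"
    by (rule stably_eq_subgroup[OF M1 RM[OF M1] RT[OF g1 M1 g1] \<tau>_stably_eq[OF g1] L L1])
  have 2: "stably_eq L W (twist G (g2 \<otimes> g1) W) (\<tau> (g2 \<otimes> g1)) (s (g2 \<otimes> g1))"
    by (rule stably_eq_subgroup[OF M RM[OF M] RT[OF g M g] \<tau>_stably_eq[OF g] L L21])
  have "stably_eq L (twist G g1 W) (twist G g1 (twist G g2 W)) (\<tau> g2) (s g2)"
    by (rule stably_eq_twist_subgroup[OF M2 RM[OF M2] RT[OF g2 M2 g2] g1 L c2 \<tau>_stably_eq[OF g2]])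
  then have 3: "stably_eq L (twist G g1 W) (twist G (g2 \<otimes> g1) W) (\<tau> g2) (s g2)"
    using stably_eq_twist_twist[OF g1 g2 L t1 t21] by simp
  have t1h: "\<tau> g1 \<in> hom L W (twist G g1 W)" by (rule hom_subgroup[OF \<tau>_hom[OF g1] L1])
  have s1h: "s g1 \<in> hom L W (twist G g1 W)" by (rule hom_subgroup[OF s_hom[OF g1] L1])
  have s2h: "s g2 \<in> hom L (twist G g1 W) (twist G (g2 \<otimes> g1) W)"
  proof -
    have "s g2 \<in> hom L (twist G g1 W) (twist G g1 (twist G g2 W))"
      by (rule hom_twist[OF s_hom[OF g2] g1 c2])
    then show ?thesis by (rule hom_twist_twist[OF g1 g2 L, THEN iffD1])
  qed
  have 4: "stably_eq L W (twist G (g2 \<otimes> g1) W) (\<lambda>w. \<tau> g2 (\<tau> g1 w)) (\<lambda>w. s g2 (\<tau> g1 w))"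
    by (rule stably_eq_precompose[OF L t1 t21 3 WL t1h])
  have 5: "stably_eq L W (twist G (g2 \<otimes> g1) W) (\<lambda>w. s g2 (\<tau> g1 w)) (\<lambda>w. s g2 (s g1 w))"
    by (rule stably_eq_postcompose[OF L WL t1 1 t21 s2h hom_closed[OF s1h]])
  have cs: "s (g2 \<otimes> g1) w \<in> carrier (twist G (g2 \<otimes> g1) W)" if "w \<in> carrier W" for w
    using hom_closed[OF s_hom[OF g] that] .
  have 6: "stably_eq L W (twist G (g2 \<otimes> g1) W) (\<lambda>w. s g2 (s g1 w)) (s (g2 \<otimes> g1))"
    using s_mult[OF g1 g2] by (simp add: L_def)
  have 7: "stably_eq L W (twist G (g2 \<otimes> g1) W) (s (g2 \<otimes> g1)) (\<tau> (g2 \<otimes> g1))"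
    by (rule stably_eq_sym[OF L WL t21 2 cs])
  note ct = hom_closed[OF \<tau>_hom[OF g]]
  show ?thesis unfolding L_def[symmetric]
    by (rule stably_eq_trans[OF L WL t21 4 stably_eq_trans[OF L WL t21 5 stably_eq_trans[OF L WL t21 6 7 ct] ct] ct])
qed

lemma \<tau>_one: "stably_eq H W W (\<tau> \<one>) (\<lambda>w. w)"
proof -
  have o: "\<one> \<in> H" by (rule subgroup.one_closed[OF H])
  have "stably_eq H W (twist G \<one> W) (\<tau> \<one>) (s \<one>)"
    using \<tau>_stably_eq[of "\<one>"] by (simp add: meet1_H[OF H o])
  then have 1: "stably_eq H W W (\<tau> \<one>) (s \<one>)" using twist_one_stably_eq[OF H W W] by simp
  have 2: "stably_eq H W W (s \<one>) (act W \<one>)"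
    using s_H[OF o] twist_one_stably_eq[OF H W W] by simp
  have 3: "stably_eq H W W (act W \<one>) (\<lambda>w. w)"
    using rep_act_one[OF W] by (intro stably_eq_of_eq[OF H W W]) auto
  show ?thesis by (rule stably_eq_trans[OF H W W 1 stably_eq_trans[OF H W W 2 3]])
qed

end

section \<open>Splitting stable idempotents\<close>

text \<open>
  Functions from \<open>X\<close> to \<open>M\<close>, normalised to be zero outside \<open>X\<close>, with the pointwise vector space
  structure and a prescribed action. This covers both induced modules and modules of sequences.
\<close>

definition fun_gmod ::
  "('k, 'm, 'h) gmod \<Rightarrow> 'x set \<Rightarrow> ('g \<Rightarrow> ('x \<Rightarrow> 'm) \<Rightarrow> 'x \<Rightarrow> 'm) \<Rightarrow> ('k, 'x \<Rightarrow> 'm, 'g) gmod" where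
  "fun_gmod M X a =
    \<lparr>carrier = {\<phi>. (\<forall>x\<in>X. \<phi> x \<in> carrier M) \<and> (\<forall>x. x \<notin> X \<longrightarrow> \<phi> x = \<zero>\<^bsub>M\<^esub>)},
     monoid.mult = undefined, one = undefined,
     ring.zero = (\<lambda>x. \<zero>\<^bsub>M\<^esub>), ring.add = (\<lambda>\<phi> \<psi> x. \<phi> x \<oplus>\<^bsub>M\<^esub> \<psi> x),
     smult = (\<lambda>c \<phi> x. c \<odot>\<^bsub>M\<^esub> \<phi> x), act = a\<rparr>"

lemma fun_gmod_simps:
  "carrier (fun_gmod M X a) = {\<phi>. (\<forall>x\<in>X. \<phi> x \<in> carrier M) \<and> (\<forall>x. x \<notin> X \<longrightarrow> \<phi> x = \<zero>\<^bsub>M\<^esub>)}"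
  "ring.zero (fun_gmod M X a) = (\<lambda>x. \<zero>\<^bsub>M\<^esub>)"
  "ring.add (fun_gmod M X a) = (\<lambda>\<phi> \<psi> x. \<phi> x \<oplus>\<^bsub>M\<^esub> \<psi> x)"
  "smult (fun_gmod M X a) = (\<lambda>c \<phi> x. c \<odot>\<^bsub>M\<^esub> \<phi> x)"
  "act (fun_gmod M X a) = a"
  by (simp_all add: fun_gmod_def)

lemma fun_gmod_value:
  assumes "module K M" "\<phi> \<in> carrier (fun_gmod M X a)"
  shows "\<phi> x \<in> carrier M"
proof -
  interpret M: module K M by fact
  show ?thesis using assms(2) by (cases "x \<in> X") (auto simp: fun_gmod_simps)
qed

lemma fun_gmod_module:
  assumes M: "module K M"
  shows "module K (fun_gmod M X a)"
proof -
  interpret M: module K M by fact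
  let ?F = "fun_gmod M X a"
  have v: "\<phi> x \<in> carrier M" if "\<phi> \<in> carrier ?F" for \<phi> x by (rule fun_gmod_value[OF M that])
  have add: "\<phi> \<oplus>\<^bsub>?F\<^esub> \<psi> \<in> carrier ?F" if "\<phi> \<in> carrier ?F" "\<psi> \<in> carrier ?F" for \<phi> \<psi>
    using that by (auto simp: fun_gmod_simps)
  have zero: "\<zero>\<^bsub>?F\<^esub> \<in> carrier ?F" by (auto simp: fun_gmod_simps)
  have smult: "c \<odot>\<^bsub>?F\<^esub> \<phi> \<in> carrier ?F" if "c \<in> carrier K" "\<phi> \<in> carrier ?F" for c \<phi>
    using that by (auto simp: fun_gmod_simps)
  have "abelian_group ?F"
  proof (rule abelian_groupI)
    fix \<phi> assume \<phi>: "\<phi> \<in> carrier ?F"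
    have "(\<ominus>\<^bsub>K\<^esub> \<one>\<^bsub>K\<^esub>) \<odot>\<^bsub>?F\<^esub> \<phi> \<in> carrier ?F" by (rule smult[OF _ \<phi>]) simp
    moreover have "((\<ominus>\<^bsub>K\<^esub> \<one>\<^bsub>K\<^esub>) \<odot>\<^bsub>?F\<^esub> \<phi>) \<oplus>\<^bsub>?F\<^esub> \<phi> = \<zero>\<^bsub>?F\<^esub>"
      using v[OF \<phi>] by (simp add: fun_gmod_simps(2-5) fun_eq_iff M.smult_l_minus M.M.l_neg)
    ultimately show "\<exists>\<psi>\<in>carrier ?F. \<psi> \<oplus>\<^bsub>?F\<^esub> \<phi> = \<zero>\<^bsub>?F\<^esub>" by blast
  qed (use add zero v in \<open>auto simp: fun_gmod_simps(2-5) fun_eq_iff M.M.a_ac\<close>)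
  then show ?thesis
    using smult v M.R.is_cring
    by (intro moduleI) (auto simp: fun_gmod_simps(2-5) fun_eq_iff M.smult_l_distr M.smult_r_distr M.smult_assoc1)
qed

lemma fun_gmod_eval_lin:
  assumes "module K M"
  shows "(\<lambda>\<phi>. \<phi> x) \<in> lin K (fun_gmod M X a) M"
  using fun_gmod_value[OF assms] by (intro linI) (auto simp: fun_gmod_simps(2-5))

lemma submodule_module:
  assumes M: "module K M" and S: "S \<subseteq> carrier M" "\<zero>\<^bsub>M\<^esub> \<in> S"
    and add: "\<And>x y. x \<in> S \<Longrightarrow> y \<in> S \<Longrightarrow> x \<oplus>\<^bsub>M\<^esub> y \<in> S"
    and smult: "\<And>c x. c \<in> carrier K \<Longrightarrow> x \<in> S \<Longrightarrow> c \<odot>\<^bsub>M\<^esub> x \<in> S"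
  shows "module K (M\<lparr>carrier := S\<rparr>)"
proof -
  interpret M: module K M by fact
  have "abelian_group (M\<lparr>carrier := S\<rparr>)"
  proof (rule abelian_groupI)
    fix x assume x: "x \<in> carrier (M\<lparr>carrier := S\<rparr>)"
    then have xM: "x \<in> carrier M" using S by auto
    have "(\<ominus>\<^bsub>K\<^esub> \<one>\<^bsub>K\<^esub>) \<odot>\<^bsub>M\<^esub> x \<in> S" using x by (intro smult) auto
    then have "\<ominus>\<^bsub>M\<^esub> x \<in> S" using xM by (simp add: M.smult_l_minus)
    then show "\<exists>y\<in>carrier (M\<lparr>carrier := S\<rparr>). y \<oplus>\<^bsub>M\<lparr>carrier := S\<rparr>\<^esub> x = \<zero>\<^bsub>M\<lparr>carrier := S\<rparr>\<^esub>"
      using xM by (auto intro!: bexI[of _ "\<ominus>\<^bsub>M\<^esub> x"] simp: M.M.l_neg)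
  qed (use S add in \<open>auto simp: M.M.a_ac subset_iff\<close>)
  then show ?thesis
    using S smult M.R.is_cring
    by (intro moduleI) (auto simp: subset_iff M.smult_l_distr M.smult_r_distr M.smult_assoc1)
qed



context group_algebra
begin

lemma trace_cong:
  assumes L: "subgroup L G" and V: "rep L V" and W: "rep L W"
    and \<theta>: "\<theta> \<in> lin K V W" and eq: "\<And>v. v \<in> carrier V \<Longrightarrow> \<eta> v = \<theta> v" and v: "v \<in> carrier V"
  shows "trace L V W \<eta> v = trace L V W \<theta> v"
proof -
  interpret W: module K W by (rule rep_module[OF W])
  show ?thesis
    unfolding trace_def using trace_summand_closed[OF L V W \<theta> v]
    by (intro W.M.finsum_cong') (use L in \<open>auto simp: subgroup.m_inv_closed rep_act_closed[OF V] v eq\<close>)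
qed

lemma hom_plus:
  assumes W: "rep L W" and f: "f \<in> hom L V W" and g: "g \<in> hom L V W"
  shows "(\<lambda>v. f v \<oplus>\<^bsub>W\<^esub> g v) \<in> hom L V W"
  using lin_plus[OF rep_module[OF W] hom_lin[OF f] hom_lin[OF g]] hom_closed[OF f] hom_closed[OF g]
    hom_act[OF f] hom_act[OF g] lin_add[OF rep_act_lin[OF W]]
  by (simp add: hom_iff)

lemma hom_uminus:
  assumes W: "rep L W" and f: "f \<in> hom L V W"
  shows "(\<lambda>v. \<ominus>\<^bsub>W\<^esub> f v) \<in> hom L V W"
  using lin_neg[OF rep_module[OF W] hom_lin[OF f]] hom_closed[OF f] hom_act[OF f]
    lin_uminus[OF rep_module[OF W] rep_module[OF W] rep_act_lin[OF W]]
  by (simp add: hom_iff)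

end

text \<open>
  A stable idempotent \<open>e\<close> of a submodule \<open>S\<close> of \<open>Q\<close>, together with a linearly split surjection \<open>b\<close> from \<open>Q\<close>
  onto \<open>S\<close>. The condition on \<open>\<pi>\<close> says that \<open>Q\<close> is projective. The module \<open>S\<close> lies in \<open>Q\<close> so that
  elements of both can be entries of one sequence.
\<close>

locale stable_idempotent = group_algebra K G
  for K :: "('k, 'c) ring_scheme" and G :: "('g, 'd) monoid_scheme" (structure) +
  fixes Q :: "('k, 'q, 'g) gmod" and S :: "'q set" and e :: "'q \<Rightarrow> 'q" and b :: "'q \<Rightarrow> 'q"
    and sec :: "'q \<Rightarrow> 'q" and \<pi> :: "'q \<Rightarrow> 'q"
  assumes Q: "rep whole Q" and SQ: "S \<subseteq> carrier Q" and I: "rep whole (Q\<lparr>carrier := S\<rparr>)"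
    and e: "e \<in> hom whole (Q\<lparr>carrier := S\<rparr>) (Q\<lparr>carrier := S\<rparr>)"
    and b: "b \<in> hom whole Q (Q\<lparr>carrier := S\<rparr>)"
    and sec: "sec \<in> lin K (Q\<lparr>carrier := S\<rparr>) Q" "\<And>x. x \<in> S \<Longrightarrow> b (sec x) = x"
    and \<pi>: "\<pi> \<in> lin K Q Q" "\<And>q. q \<in> carrier Q \<Longrightarrow> trace whole Q Q \<pi> q = q"
    and idem: "stably_eq whole (Q\<lparr>carrier := S\<rparr>) (Q\<lparr>carrier := S\<rparr>) (\<lambda>x. e (e x)) e"
begin

definition I :: "('k, 'q, 'g) gmod" where "I = Q\<lparr>carrier := S\<rparr>"

lemma I_simps: "carrier I = S" "ring.zero I = ring.zero Q" "ring.add I = ring.add Q"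
  "smult I = smult Q" "act I = act Q"
  by (simp_all add: I_def)

lemmas I_rep = I[folded I_def] and e_hom = e[folded I_def] and b_hom = b[folded I_def]
  and sec_lin = sec(1)[folded I_def]

sublocale Q: module K Q by (rule rep_module[OF Q])
sublocale I: module K I by (rule rep_module[OF I_rep])

definition \<theta> :: "'q \<Rightarrow> 'q" where
  "\<theta> = (SOME \<theta>. \<theta> \<in> lin K I I \<and> (\<forall>x\<in>S. e (e x) = e x \<oplus>\<^bsub>I\<^esub> trace whole I I \<theta> x))"

lemma \<theta>: "\<theta> \<in> lin K I I" "x \<in> S \<Longrightarrow> e (e x) = e x \<oplus>\<^bsub>I\<^esub> trace whole I I \<theta> x"
proof -
  have "\<exists>\<theta>. \<theta> \<in> lin K I I \<and> (\<forall>x\<in>S. e (e x) = e x \<oplus>\<^bsub>I\<^esub> trace whole I I \<theta> x)"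
    using idem unfolding stably_eq_def I_def[symmetric] by (auto simp: I_simps)
  from someI_ex[OF this] show "\<theta> \<in> lin K I I" "x \<in> S \<Longrightarrow> e (e x) = e x \<oplus>\<^bsub>I\<^esub> trace whole I I \<theta> x"
    unfolding \<theta>_def by blast+
qed

text \<open>
  The equivariant map through which the error \<open>e e - e\<close> factors: it equals \<open>b t\<close>.
\<close>

definition t :: "'q \<Rightarrow> 'q" where "t = trace whole I Q (\<lambda>x. sec (\<theta> x))"

lemma sec\<theta>: "(\<lambda>x. sec (\<theta> x)) \<in> lin K I Q"
  by (rule lin_comp[OF sec_lin \<theta>(1)])

lemma t_hom: "t \<in> hom whole I Q"
  unfolding t_def by (rule trace_hom[OF G.subgroup_self I_rep Q sec\<theta>])

lemma e_closed: "x \<in> S \<Longrightarrow> e x \<in> S" using hom_closed[OF e_hom] by (simp add: I_simps)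
lemma b_closed: "q \<in> carrier Q \<Longrightarrow> b q \<in> S" using hom_closed[OF b_hom] by (simp add: I_simps)
lemma t_closed: "x \<in> S \<Longrightarrow> t x \<in> carrier Q" using hom_closed[OF t_hom] by (simp add: I_simps)

lemma ee: "x \<in> S \<Longrightarrow> e (e x) = e x \<oplus>\<^bsub>I\<^esub> b (t x)"
proof -
  assume x: "x \<in> S"
  then have xI: "x \<in> carrier I" by (simp add: I_simps)
  have "b (t x) = trace whole I I (\<lambda>x. b (sec (\<theta> x))) x"
    unfolding t_def by (rule trace_postcompose[OF G.subgroup_self I_rep Q I_rep b_hom sec\<theta> xI, symmetric])
  also have "\<dots> = trace whole I I \<theta> x"
    by (rule trace_cong[OF G.subgroup_self I_rep I_rep \<theta>(1) _ xI])
      (use sec(2) lin_closed[OF \<theta>(1)] in \<open>simp add: I_simps\<close>)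
  finally show ?thesis using \<theta>(2)[OF x] by simp
qed

definition sequences :: "('k, nat \<Rightarrow> 'q, 'g) gmod" where
  "sequences = fun_gmod Q UNIV (\<lambda>g \<psi> n. act Q g (\<psi> n))"

text \<open>
  The homotopy limit of the tower with all maps \<open>e\<close>. The even entries \<open>x\<^sub>i\<close> lie in \<open>I\<close>, the odd entries
  \<open>q\<^sub>i\<close> in \<open>Q\<close>. Since \<open>b\<close> is onto, \<open>V\<close> is the kernel of a surjection between products, which makes up
  for \<open>e\<close> not being onto.
\<close>

definition V :: "('k, nat \<Rightarrow> 'q, 'g) gmod" where
  "V = sequences\<lparr>carrier := {\<psi>. (\<forall>n. \<psi> n \<in> carrier Q) \<and> (\<forall>i. \<psi> (2 * i) \<in> S) \<and>
     (\<forall>i. \<psi> (2 * i) = e (\<psi> (2 * Suc i)) \<oplus>\<^bsub>I\<^esub> b (\<psi> (Suc (2 * i))))}\<rparr>"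

lemma V_simps:
  "ring.zero V = (\<lambda>n. \<zero>\<^bsub>Q\<^esub>)" "ring.add V = (\<lambda>\<phi> \<psi> n. \<phi> n \<oplus>\<^bsub>Q\<^esub> \<psi> n)"
  "smult V = (\<lambda>c \<phi> n. c \<odot>\<^bsub>Q\<^esub> \<phi> n)" "act V = (\<lambda>g \<psi> n. act Q g (\<psi> n))"
  by (simp_all add: V_def sequences_def fun_gmod_simps)

lemma V_mem:
  "\<psi> \<in> carrier V \<longleftrightarrow> (\<forall>n. \<psi> n \<in> carrier Q) \<and> (\<forall>i. \<psi> (2 * i) \<in> S) \<and>
     (\<forall>i. \<psi> (2 * i) = e (\<psi> (2 * Suc i)) \<oplus>\<^bsub>I\<^esub> b (\<psi> (Suc (2 * i))))"
  by (simp add: V_def)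

lemma V_rep: "rep whole V"
proof (rule repI[OF G.subgroup_self])
  have sequences: "module K sequences" unfolding sequences_def by (rule fun_gmod_module[OF rep_module[OF Q]])
  have V': "V = sequences\<lparr>carrier := carrier V\<rparr>" by (simp add: V_def)
  have ops: "ring.zero sequences = ring.zero V" "ring.add sequences = ring.add V" "smult sequences = smult V"
    by (simp_all add: V_def)
  have add: "x \<oplus>\<^bsub>V\<^esub> y \<in> carrier V" if xy: "x \<in> carrier V" "y \<in> carrier V" for x y
    unfolding V_mem
  proof (intro conjI allI)
    fix i
    have m: "x n \<in> carrier Q" "y n \<in> carrier Q" "x (2 * j) \<in> carrier I" "y (2 * j) \<in> carrier I" for n j
      using xy by (auto simp: V_mem I_simps)
    show "(x \<oplus>\<^bsub>V\<^esub> y) i \<in> carrier Q" using m by (simp add: V_simps)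
    show "(x \<oplus>\<^bsub>V\<^esub> y) (2 * i) \<in> S" using I.M.a_closed[OF m(3,4)] by (simp add: V_simps I_simps)
    have cl: "e (x (2 * Suc i)) \<in> carrier I" "e (y (2 * Suc i)) \<in> carrier I"
      "b (x (Suc (2 * i))) \<in> carrier I" "b (y (Suc (2 * i))) \<in> carrier I"
      using m by (auto intro: hom_closed[OF e_hom] hom_closed[OF b_hom] simp del: mult_Suc_right)
    have "(x \<oplus>\<^bsub>V\<^esub> y) (2 * i) = (e (x (2 * Suc i)) \<oplus>\<^bsub>I\<^esub> b (x (Suc (2 * i)))) \<oplus>\<^bsub>I\<^esub> (e (y (2 * Suc i)) \<oplus>\<^bsub>I\<^esub> b (y (Suc (2 * i))))"
      using xy by (simp add: V_simps I_simps V_mem)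
    also have "\<dots> = (e (x (2 * Suc i)) \<oplus>\<^bsub>I\<^esub> e (y (2 * Suc i))) \<oplus>\<^bsub>I\<^esub> (b (x (Suc (2 * i))) \<oplus>\<^bsub>I\<^esub> b (y (Suc (2 * i))))"
      using cl by (simp add: I.M.a_ac del: mult_Suc_right)
    also have "\<dots> = e ((x \<oplus>\<^bsub>V\<^esub> y) (2 * Suc i)) \<oplus>\<^bsub>I\<^esub> b ((x \<oplus>\<^bsub>V\<^esub> y) (Suc (2 * i)))"
      using lin_add[OF hom_lin[OF e_hom] m(3,4)] lin_add[OF hom_lin[OF b_hom] m(1,2)]
      by (simp add: V_simps I_simps del: mult_Suc_right)
    finally show "(x \<oplus>\<^bsub>V\<^esub> y) (2 * i) = e ((x \<oplus>\<^bsub>V\<^esub> y) (2 * Suc i)) \<oplus>\<^bsub>I\<^esub> b ((x \<oplus>\<^bsub>V\<^esub> y) (Suc (2 * i)))" .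
  qed
  have lin: "(\<lambda>n. f (x n)) \<in> carrier V"
    if x: "x \<in> carrier V" and f: "f \<in> lin K Q Q" "f \<in> lin K I I"
      and fe: "\<And>x. x \<in> S \<Longrightarrow> f (e x) = e (f x)" and fb: "\<And>q. q \<in> carrier Q \<Longrightarrow> f (b q) = b (f q)" for x f
    unfolding V_mem
  proof (intro conjI allI)
    fix i
    have m: "x n \<in> carrier Q" "x (2 * j) \<in> carrier I" for n j using x by (auto simp: V_mem I_simps)
    show "f (x i) \<in> carrier Q" by (rule lin_closed[OF f(1) m(1)])
    show "f (x (2 * i)) \<in> S" using lin_closed[OF f(2) m(2)] by (simp add: I_simps)
    have "f (x (2 * i)) = f (e (x (2 * Suc i)) \<oplus>\<^bsub>I\<^esub> b (x (Suc (2 * i))))" using x by (simp add: V_mem)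
    also have "\<dots> = f (e (x (2 * Suc i))) \<oplus>\<^bsub>I\<^esub> f (b (x (Suc (2 * i))))"
      by (rule lin_add[OF f(2) hom_closed[OF e_hom m(2)] hom_closed[OF b_hom m(1)]])
    also have "\<dots> = e (f (x (2 * Suc i))) \<oplus>\<^bsub>I\<^esub> b (f (x (Suc (2 * i))))"
      using fe fb m by (simp add: I_simps del: mult_Suc_right)
    finally show "f (x (2 * i)) = e (f (x (2 * Suc i))) \<oplus>\<^bsub>I\<^esub> b (f (x (Suc (2 * i))))" .
  qed
  have zero: "\<zero>\<^bsub>V\<^esub> \<in> carrier V"
    using lin_zero[OF I.module_axioms I.module_axioms hom_lin[OF e_hom]] I.M.zero_closed
      lin_zero[OF Q.module_axioms I.module_axioms hom_lin[OF b_hom]] I.M.l_zero[OF I.M.zero_closed]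
    by (simp add: V_mem V_simps I_simps)
  have smult: "c \<odot>\<^bsub>V\<^esub> x \<in> carrier V" if c: "c \<in> carrier K" and x: "x \<in> carrier V" for c x
    using lin[OF x lin_scale[OF Q.module_axioms lin_id c]] lin_scale[OF I.module_axioms lin_id c]
      lin_smult[OF hom_lin[OF e_hom] c] lin_smult[OF hom_lin[OF b_hom] c]
    by (simp add: V_simps I_simps)
  show "module K V"
    by (subst V', rule submodule_module[OF sequences])
      (use add zero smult in \<open>auto simp: ops\<close>, simp add: V_mem sequences_def fun_gmod_simps)
  show "act V g \<in> lin K V V" if g: "g \<in> carrier G" for g
  proof (rule linI)
    show "act V g x \<in> carrier V" if x: "x \<in> carrier V" for x
      using lin[OF x rep_act_lin[OF Q g]] rep_act_lin[OF I_rep g] hom_act[OF e_hom g] hom_act[OF b_hom g]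
      by (simp add: V_simps I_simps)
  qed (use lin_add[OF rep_act_lin[OF Q g]] lin_smult[OF rep_act_lin[OF Q g]] in \<open>simp_all add: V_simps V_mem fun_eq_iff\<close>)
  show "act V \<one> v = v" if "v \<in> carrier V" for v
    using that rep_act_one[OF Q] by (simp add: V_simps V_mem)
  show "act V (g \<otimes> h) v = act V g (act V h v)"
    if "g \<in> carrier G" "h \<in> carrier G" "v \<in> carrier V" for g h v
    using that rep_act_mult[OF Q] by (simp add: V_simps V_mem)
qed

lemma coord_hom: "(\<lambda>\<psi>. \<psi> n) \<in> hom whole V Q"
  by (auto simp: gmod_hom_iff V_simps V_mem intro!: linI)

lemma even_coord_hom: "(\<lambda>\<psi>. \<psi> (2 * i)) \<in> hom whole V I"
  by (auto simp: gmod_hom_iff V_simps V_mem I_simps intro!: linI)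

text \<open>
  The sequence with constant even entries \<open>e x\<close>; the odd entries make up for \<open>e\<close> being
  idempotent only up to \<open>b t\<close>.
\<close>

definition inc :: "'q \<Rightarrow> nat \<Rightarrow> 'q" where
  "inc x n = (if even n then e x else \<ominus>\<^bsub>Q\<^esub> t x)"

lemma inc_hom: "inc \<in> hom whole I V"
proof -
  have nt: "(\<lambda>x. \<ominus>\<^bsub>Q\<^esub> t x) \<in> hom whole I Q" by (rule hom_uminus[OF Q t_hom])
  have cl: "inc x \<in> carrier V" if x: "x \<in> carrier I" for x
    unfolding V_mem
  proof (intro conjI allI)
    fix i
    have xS: "x \<in> S" using x by (simp add: I_simps)
    show "inc x i \<in> carrier Q"
      using e_closed[OF xS] SQ t_closed[OF xS] by (auto simp: inc_def)
    show "inc x (2 * i) \<in> S" using e_closed[OF xS] by (simp add: inc_def)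
    have c: "e x \<in> carrier I" "b (t x) \<in> carrier I" using e_closed[OF xS] b_closed[OF t_closed[OF xS]] by (simp_all add: I_simps)
    have "b (\<ominus>\<^bsub>Q\<^esub> t x) = \<ominus>\<^bsub>I\<^esub> b (t x)"
      by (rule lin_uminus[OF Q.module_axioms I.module_axioms hom_lin[OF b_hom] t_closed[OF xS]])
    then have "e (e x) \<oplus>\<^bsub>I\<^esub> b (\<ominus>\<^bsub>Q\<^esub> t x) = e x"
      using ee[OF xS] c by (simp add: I.M.a_assoc I.M.r_neg)
    then show "inc x (2 * i) = e (inc x (2 * Suc i)) \<oplus>\<^bsub>I\<^esub> b (inc x (Suc (2 * i)))"
      by (simp add: inc_def)
  qed
  have "inc (x \<oplus>\<^bsub>I\<^esub> y) = inc x \<oplus>\<^bsub>V\<^esub> inc y" if "x \<in> carrier I" "y \<in> carrier I" for x y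
    using lin_add[OF hom_lin[OF e_hom] that] lin_add[OF hom_lin[OF nt] that]
    by (simp add: V_simps inc_def fun_eq_iff I_simps)
  moreover have "inc (c \<odot>\<^bsub>I\<^esub> x) = c \<odot>\<^bsub>V\<^esub> inc x" if "c \<in> carrier K" "x \<in> carrier I" for c x
    using lin_smult[OF hom_lin[OF e_hom] that] lin_smult[OF hom_lin[OF nt] that]
    by (simp add: V_simps inc_def fun_eq_iff I_simps)
  moreover have "inc (act I g x) = act V g (inc x)" if "g \<in> carrier G" "x \<in> carrier I" for g x
    using hom_act[OF e_hom that] hom_act[OF nt that]
    by (simp add: V_simps inc_def fun_eq_iff I_simps)
  ultimately show ?thesis using cl by (auto simp: gmod_hom_iff intro!: linI)
qed


end

lemma (in abelian_group) add_left_imp_eq: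
  assumes "a \<in> carrier G" "x \<in> carrier G" "y \<in> carrier G" "a \<oplus> x = a \<oplus> y"
  shows "x = y"
proof -
  have "\<ominus> a \<oplus> (a \<oplus> x) = \<ominus> a \<oplus> (a \<oplus> y)" using assms(4) by simp
  then show ?thesis using assms(1-3) by (simp add: a_assoc[symmetric] l_neg)
qed

context stable_idempotent
begin

lemma V_S: "\<psi> \<in> carrier V \<Longrightarrow> \<psi> (2 * i) \<in> S" "\<psi> \<in> carrier V \<Longrightarrow> \<psi> 0 \<in> S"
  "\<psi> \<in> carrier V \<Longrightarrow> \<psi> n \<in> carrier Q"
  using V_mem[of \<psi>] by (blast, metis mult_0_right, blast)

lemma V_eq: "\<psi> \<in> carrier V \<Longrightarrow> \<psi> (2 * i) = e (\<psi> (2 * Suc i)) \<oplus>\<^bsub>I\<^esub> b (\<psi> (Suc (2 * i)))"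
  by (simp add: V_mem)

lemmas whole = G.subgroup_self

lemma zero_coord_hom: "(\<lambda>\<psi>. \<psi> 0) \<in> hom whole V I"
  using even_coord_hom[of 0] by simp

lemma trace_\<pi>:
  assumes f: "f \<in> hom whole V Q" and \<psi>: "\<psi> \<in> carrier V"
  shows "trace whole V Q (\<lambda>\<psi>. \<pi> (f \<psi>)) \<psi> = f \<psi>"
  using trace_precompose[OF whole Q Q V_rep f \<pi>(1) \<psi>] \<pi>(2)[OF hom_closed[OF f \<psi>]] by simp

text \<open>
  The difference is \<open>b q\<^sub>i\<close>, which factors through the projective module \<open>Q\<close>.
\<close>

lemma even_coord_step: "stably_eq whole V I (\<lambda>\<psi>. \<psi> (2 * i)) (\<lambda>\<psi>. e (\<psi> (2 * Suc i)))"
proof -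
  let ?q = "\<lambda>\<psi>. \<psi> (Suc (2 * i))"
  have l: "(\<lambda>\<psi>. \<pi> (?q \<psi>)) \<in> lin K V Q" by (rule lin_comp[OF \<pi>(1) hom_lin[OF coord_hom]])
  have "trace whole V I (\<lambda>\<psi>. b (\<pi> (?q \<psi>))) \<psi> = b (?q \<psi>)" if "\<psi> \<in> carrier V" for \<psi>
    using trace_postcompose[OF whole V_rep Q I_rep b_hom l that] trace_\<pi>[OF coord_hom that] by simp
  then show ?thesis
    unfolding stably_eq_def using lin_comp[OF hom_lin[OF b_hom] l] V_eq
    by (intro bexI[of _ "\<lambda>\<psi>. b (\<pi> (?q \<psi>))"]) (simp_all del: mult_Suc_right)
qed

text \<open>
  By idempotency \<open>e x\<^sub>i = e e x\<^bsub>i+1\<^esub> = e x\<^bsub>i+1\<^esub>\<close> stably, so all \<open>e x\<^sub>i\<close> agree stably.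
\<close>

lemma even_coord_stable: "stably_eq whole V I (\<lambda>\<psi>. \<psi> (2 * i)) (\<lambda>\<psi>. e (\<psi> 0))"
proof -
  have cl: "e (\<psi> (2 * j)) \<in> carrier I" if "\<psi> \<in> carrier V" for \<psi> j
    using V_S(1)[OF that] e_closed by (simp add: I_simps)
  have cl0: "e (\<psi> 0) \<in> carrier I" if "\<psi> \<in> carrier V" for \<psi>
    using V_S(2)[OF that] e_closed by (simp add: I_simps)
  have step: "stably_eq whole V I (\<lambda>\<psi>. e (\<psi> (2 * j))) (\<lambda>\<psi>. e (\<psi> (2 * Suc j)))" for j
  proof -
    have 1: "stably_eq whole V I (\<lambda>\<psi>. e (\<psi> (2 * j))) (\<lambda>\<psi>. e (e (\<psi> (2 * Suc j))))"
      by (rule stably_eq_postcompose[OF whole V_rep I_rep even_coord_step I_rep e_hom])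
        (rule cl)
    have 2: "stably_eq whole V I (\<lambda>\<psi>. e (e (\<psi> (2 * Suc j)))) (\<lambda>\<psi>. e (\<psi> (2 * Suc j)))"
      by (rule stably_eq_precompose[OF whole I_rep I_rep idem[folded I_def] V_rep even_coord_hom])
    show ?thesis by (rule stably_eq_trans[OF whole V_rep I_rep 1 2]) (rule cl)
  qed
  have "stably_eq whole V I (\<lambda>\<psi>. e (\<psi> (2 * j))) (\<lambda>\<psi>. e (\<psi> 0))" for j
  proof (induction j)
    case 0
    show ?case by (rule stably_eq_of_eq[OF whole V_rep I_rep]) (simp_all add: cl0)
  next
    case (Suc j)
    show ?case
      by (rule stably_eq_trans[OF whole V_rep I_rep stably_eq_sym[OF whole V_rep I_rep step] Suc])
        (rule cl cl0, assumption)+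
  qed
  from stably_eq_trans[OF whole V_rep I_rep even_coord_step this] cl0 show ?thesis by blast
qed

text \<open>
  Linear maps whose traces are the even coordinates \<open>x\<^sub>i - e x\<^sub>0\<close> of \<open>\<psi> - inc (\<psi> 0)\<close>. The maps \<open>\<alpha>'\<close>
  below do the same for the odd coordinates \<open>\<kappa>\<close>. Together they define a map with the right
  trace, but with values in all sequences instead of \<open>V\<close>.
\<close>

definition \<alpha> :: "nat \<Rightarrow> (nat \<Rightarrow> 'q) \<Rightarrow> 'q" where
  "\<alpha> i = (SOME \<theta>. \<theta> \<in> lin K V I \<and>
     (\<forall>\<psi>\<in>carrier V. \<psi> (2 * i) = e (\<psi> 0) \<oplus>\<^bsub>I\<^esub> trace whole V I \<theta> \<psi>))"

lemma \<alpha>: "\<alpha> i \<in> lin K V I"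
  "\<psi> \<in> carrier V \<Longrightarrow> \<psi> (2 * i) = e (\<psi> 0) \<oplus>\<^bsub>I\<^esub> trace whole V I (\<alpha> i) \<psi>"
proof -
  have "\<exists>\<theta>. \<theta> \<in> lin K V I \<and> (\<forall>\<psi>\<in>carrier V. \<psi> (2 * i) = e (\<psi> 0) \<oplus>\<^bsub>I\<^esub> trace whole V I \<theta> \<psi>)"
    using even_coord_stable[of i] unfolding stably_eq_def by blast
  from someI_ex[OF this] show "\<alpha> i \<in> lin K V I"
    "\<psi> \<in> carrier V \<Longrightarrow> \<psi> (2 * i) = e (\<psi> 0) \<oplus>\<^bsub>I\<^esub> trace whole V I (\<alpha> i) \<psi>"
    unfolding \<alpha>_def by blast+
qed

definition \<kappa> :: "nat \<Rightarrow> (nat \<Rightarrow> 'q) \<Rightarrow> 'q" where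
  "\<kappa> i \<psi> = \<psi> (Suc (2 * i)) \<oplus>\<^bsub>Q\<^esub> t (\<psi> 0)"

lemma \<kappa>_hom: "\<kappa> i \<in> hom whole V Q"
  unfolding \<kappa>_def[abs_def] by (rule hom_plus[OF Q coord_hom hom_comp[OF t_hom zero_coord_hom]])

definition \<alpha>' :: "nat \<Rightarrow> (nat \<Rightarrow> 'q) \<Rightarrow> 'q" where
  "\<alpha>' i \<psi> = \<pi> (\<kappa> i \<psi>)"

lemma \<alpha>'_lin: "\<alpha>' i \<in> lin K V Q"
  unfolding \<alpha>'_def[abs_def] by (rule lin_comp[OF \<pi>(1) hom_lin[OF \<kappa>_hom]])

lemma trace_\<alpha>': "\<psi> \<in> carrier V \<Longrightarrow> trace whole V Q (\<alpha>' i) \<psi> = \<kappa> i \<psi>"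
  unfolding \<alpha>'_def[abs_def] by (rule trace_\<pi>[OF \<kappa>_hom])

text \<open>
  What the defining equation of \<open>V\<close> would require of \<open>\<alpha> i\<close>. It has the same trace as \<open>\<alpha> i\<close>, so the
  defect \<open>\<alpha> i - D i\<close> has trace zero.
\<close>

definition D :: "nat \<Rightarrow> (nat \<Rightarrow> 'q) \<Rightarrow> 'q" where
  "D i \<psi> = e (\<alpha> (Suc i) \<psi>) \<oplus>\<^bsub>I\<^esub> b (\<alpha>' i \<psi>)"

lemma e\<alpha>_lin: "(\<lambda>\<psi>. e (\<alpha> i \<psi>)) \<in> lin K V I"
  by (rule lin_comp[OF hom_lin[OF e_hom] \<alpha>(1)])

lemma b\<alpha>'_lin: "(\<lambda>\<psi>. b (\<alpha>' i \<psi>)) \<in> lin K V I"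
  by (rule lin_comp[OF hom_lin[OF b_hom] \<alpha>'_lin])

lemma D_lin: "D i \<in> lin K V I"
  unfolding D_def[abs_def] by (rule lin_plus[OF I.module_axioms e\<alpha>_lin b\<alpha>'_lin])

lemma trace_D:
  assumes \<psi>: "\<psi> \<in> carrier V"
  shows "trace whole V I (D i) \<psi> = trace whole V I (\<alpha> i) \<psi>"
proof -
  let ?T = "\<lambda>i. trace whole V I (\<alpha> i) \<psi>"
  have T: "?T j \<in> carrier I" for j by (rule trace_closed[OF whole V_rep I_rep \<alpha>(1) \<psi>])
  let ?x0 = "\<psi> 0"
  have x0: "?x0 \<in> S" "?x0 \<in> carrier I" using V_S(2)[OF \<psi>] by (simp_all add: I_simps)
  have c: "e ?x0 \<in> carrier I" "t ?x0 \<in> carrier Q" "\<psi> (Suc (2 * i)) \<in> carrier Q" "e (?T (Suc i)) \<in> carrier I"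
    "b (t ?x0) \<in> carrier I" "b (\<psi> (Suc (2 * i))) \<in> carrier I"
    using e_closed[OF x0(1)] t_closed[OF x0(1)] V_S(3)[OF \<psi>] hom_closed[OF e_hom T] b_closed by (simp_all add: I_simps)
  have "e ?x0 \<oplus>\<^bsub>I\<^esub> ?T i = e (\<psi> (2 * Suc i)) \<oplus>\<^bsub>I\<^esub> b (\<psi> (Suc (2 * i)))"
    using \<alpha>(2)[OF \<psi>, of i] V_eq[OF \<psi>, of i] by simp
  also have "e (\<psi> (2 * Suc i)) = e (e ?x0 \<oplus>\<^bsub>I\<^esub> ?T (Suc i))"
    using \<alpha>(2)[OF \<psi>, of "Suc i"] by simp
  also have "\<dots> = (e ?x0 \<oplus>\<^bsub>I\<^esub> b (t ?x0)) \<oplus>\<^bsub>I\<^esub> e (?T (Suc i))"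
    using lin_add[OF hom_lin[OF e_hom] c(1) T] ee[OF x0(1)] by simp
  finally have "e ?x0 \<oplus>\<^bsub>I\<^esub> ?T i
     = e ?x0 \<oplus>\<^bsub>I\<^esub> (e (?T (Suc i)) \<oplus>\<^bsub>I\<^esub> (b (\<psi> (Suc (2 * i))) \<oplus>\<^bsub>I\<^esub> b (t ?x0)))"
    using c T by (simp add: I.M.a_ac)
  from I.M.add_left_imp_eq[OF c(1) T _ this]
  have "?T i = e (?T (Suc i)) \<oplus>\<^bsub>I\<^esub> (b (\<psi> (Suc (2 * i))) \<oplus>\<^bsub>I\<^esub> b (t ?x0))"
    using c by simp
  also have "b (\<psi> (Suc (2 * i))) \<oplus>\<^bsub>I\<^esub> b (t ?x0) = b (\<kappa> i \<psi>)"
    unfolding \<kappa>_def by (rule lin_add[OF hom_lin[OF b_hom] c(3,2), symmetric])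
  finally have 1: "?T i = e (?T (Suc i)) \<oplus>\<^bsub>I\<^esub> b (\<kappa> i \<psi>)" .
  have "trace whole V I (D i) \<psi> = trace whole V I (\<lambda>\<psi>. e (\<alpha> (Suc i) \<psi>)) \<psi> \<oplus>\<^bsub>I\<^esub> trace whole V I (\<lambda>\<psi>. b (\<alpha>' i \<psi>)) \<psi>"
    unfolding D_def[abs_def] by (rule trace_plus[OF whole V_rep I_rep e\<alpha>_lin b\<alpha>'_lin \<psi>])
  also have "\<dots> = e (?T (Suc i)) \<oplus>\<^bsub>I\<^esub> b (\<kappa> i \<psi>)"
    using trace_postcompose[OF whole V_rep I_rep I_rep e_hom \<alpha>(1) \<psi>]
      trace_postcompose[OF whole V_rep Q I_rep b_hom \<alpha>'_lin \<psi>] trace_\<alpha>'[OF \<psi>] by simp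
  finally show ?thesis using 1 by simp
qed

text \<open>
  The partial sums of the defects. In the group of linear maps of trace zero modulo those that lift
  along \<open>b\<close> to maps of trace zero, the map \<open>e\<close> is idempotent, and there these sums solve the recursion
  for the correction: on the image of \<open>e\<close> the recursion is solved by summation, on the complement by
  the defect itself.
\<close>

primrec \<Sigma> :: "nat \<Rightarrow> (nat \<Rightarrow> 'q) \<Rightarrow> 'q" where
  "\<Sigma> 0 = (\<lambda>\<psi>. \<zero>\<^bsub>I\<^esub>)"
| "\<Sigma> (Suc i) = (\<lambda>\<psi>. (\<Sigma> i \<psi> \<oplus>\<^bsub>I\<^esub> \<alpha> i \<psi>) \<oplus>\<^bsub>I\<^esub> \<ominus>\<^bsub>I\<^esub> D i \<psi>)"

lemma \<Sigma>_lin: "\<Sigma> i \<in> lin K V I"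
proof (induction i)
  case 0
  show ?case using lin_const_zero[OF I.module_axioms] by simp
next
  case (Suc i)
  show ?case
    unfolding \<Sigma>.simps
    by (rule lin_plus[OF I.module_axioms lin_plus[OF I.module_axioms Suc \<alpha>(1)] lin_neg[OF I.module_axioms D_lin]])
qed

lemma trace_\<Sigma>: "\<psi> \<in> carrier V \<Longrightarrow> trace whole V I (\<Sigma> i) \<psi> = \<zero>\<^bsub>I\<^esub>"
proof (induction i)
  case 0
  then show ?case using trace_zero[OF whole V_rep I_rep] by simp
next
  case (Suc i)
  have l: "(\<lambda>\<psi>. \<Sigma> i \<psi> \<oplus>\<^bsub>I\<^esub> \<alpha> i \<psi>) \<in> lin K V I"
    by (rule lin_plus[OF I.module_axioms \<Sigma>_lin \<alpha>(1)])
  have T: "trace whole V I (\<alpha> i) \<psi> \<in> carrier I" by (rule trace_closed[OF whole V_rep I_rep \<alpha>(1) Suc(2)])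
  show ?case
    unfolding \<Sigma>.simps
    using trace_plus[OF whole V_rep I_rep l lin_neg[OF I.module_axioms D_lin] Suc(2)]
      trace_plus[OF whole V_rep I_rep \<Sigma>_lin \<alpha>(1) Suc(2)]
      trace_uminus[OF whole V_rep I_rep D_lin Suc(2)] trace_D[OF Suc(2)] Suc T
    by (simp add: I.M.r_neg)
qed

text \<open>
  The corrected map. Its even entries are \<open>\<alpha> i - (\<alpha> i - D i) + e (\<Sigma> (i + 1))\<close>; the odd entries
  absorb the error \<open>e e - e = b t\<close> that arises when \<open>e\<close> is applied to \<open>e (\<Sigma> (i + 2))\<close>.
\<close>

definition \<rho> :: "(nat \<Rightarrow> 'q) \<Rightarrow> nat \<Rightarrow> 'q" where
  "\<rho> \<psi> n = (if even n then D (n div 2) \<psi> \<oplus>\<^bsub>I\<^esub> e (\<Sigma> (Suc (n div 2)) \<psi>)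
    else \<alpha>' (n div 2) \<psi> \<oplus>\<^bsub>Q\<^esub> \<ominus>\<^bsub>Q\<^esub> t (\<Sigma> (Suc (Suc (n div 2))) \<psi>))"

lemma \<rho>_even: "\<rho> \<psi> (2 * i) = D i \<psi> \<oplus>\<^bsub>I\<^esub> e (\<Sigma> (Suc i) \<psi>)"
  by (simp add: \<rho>_def)

lemma \<rho>_odd: "\<rho> \<psi> (Suc (2 * i)) = \<alpha>' i \<psi> \<oplus>\<^bsub>Q\<^esub> \<ominus>\<^bsub>Q\<^esub> t (\<Sigma> (Suc (Suc i)) \<psi>)"
  by (simp add: \<rho>_def)

lemma e\<Sigma>_lin: "(\<lambda>\<psi>. e (\<Sigma> i \<psi>)) \<in> lin K V I"
  by (rule lin_comp[OF hom_lin[OF e_hom] \<Sigma>_lin])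

lemma t\<Sigma>_lin: "(\<lambda>\<psi>. t (\<Sigma> i \<psi>)) \<in> lin K V Q"
  by (rule lin_comp[OF hom_lin[OF t_hom] \<Sigma>_lin])

lemma \<rho>_even_lin: "(\<lambda>\<psi>. \<rho> \<psi> (2 * i)) \<in> lin K V I"
  unfolding \<rho>_even by (rule lin_plus[OF I.module_axioms D_lin e\<Sigma>_lin])

lemma \<rho>_odd_lin: "(\<lambda>\<psi>. \<rho> \<psi> (Suc (2 * i))) \<in> lin K V Q"
  unfolding \<rho>_odd by (rule lin_plus[OF Q.module_axioms \<alpha>'_lin lin_neg[OF Q.module_axioms t\<Sigma>_lin]])

lemma \<rho>_coord_lin: "(\<lambda>\<psi>. \<rho> \<psi> n) \<in> lin K V Q"
proof (cases "even n")
  case True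
  then obtain i where n: "n = 2 * i" by (elim evenE)
  have "(\<lambda>x. x) \<in> lin K I Q" using SQ by (auto simp: I_simps intro!: linI)
  from lin_comp[OF this \<rho>_even_lin[of i]] show ?thesis by (simp add: n)
next
  case False
  then obtain i where "n = Suc (2 * i)" by (elim oddE) simp
  then show ?thesis using \<rho>_odd_lin[of i] by simp
qed

lemma \<rho>_closed:
  assumes \<psi>: "\<psi> \<in> carrier V"
  shows "\<rho> \<psi> \<in> carrier V"
  unfolding V_mem
proof (intro conjI allI)
  fix i
  show "\<rho> \<psi> i \<in> carrier Q" using lin_closed[OF \<rho>_coord_lin \<psi>] .
  show "\<rho> \<psi> (2 * i) \<in> S" using lin_closed[OF \<rho>_even_lin \<psi>] by (simp add: I_simps)
  let ?s = "\<Sigma> (Suc (Suc i)) \<psi>" and ?s' = "\<Sigma> (Suc i) \<psi>" and ?d = "D (Suc i) \<psi>" and ?a = "\<alpha> (Suc i) \<psi>"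
  have c: "?s \<in> carrier I" "?s' \<in> carrier I" "?d \<in> carrier I" "?a \<in> carrier I" "\<alpha>' i \<psi> \<in> carrier Q"
    "b (\<alpha>' i \<psi>) \<in> carrier I" "e ?s \<in> carrier I" "e ?s' \<in> carrier I" "e ?d \<in> carrier I" "e ?a \<in> carrier I"
    using lin_closed[OF \<Sigma>_lin \<psi>] lin_closed[OF D_lin \<psi>] lin_closed[OF \<alpha>(1) \<psi>] lin_closed[OF \<alpha>'_lin \<psi>]
    by (auto simp del: \<Sigma>.simps intro: hom_closed[OF b_hom] hom_closed[OF e_hom])
  have sS: "?s \<in> S" using c(1) by (simp add: I_simps del: \<Sigma>.simps)
  have ct: "t ?s \<in> carrier Q" "b (t ?s) \<in> carrier I"
    using t_closed[OF sS] b_closed by (auto simp: I_simps simp del: \<Sigma>.simps)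
  \<comment> \<open>The recursion for the sums, in a form without subtraction.\<close>
  have "?s \<oplus>\<^bsub>I\<^esub> ?d = ?s' \<oplus>\<^bsub>I\<^esub> ?a"
    using c(2-4) unfolding \<Sigma>.simps(2)[of "Suc i"] by (simp add: I.M.a_assoc I.M.l_neg del: \<Sigma>.simps)
  then have "e (?s \<oplus>\<^bsub>I\<^esub> ?d) = e (?s' \<oplus>\<^bsub>I\<^esub> ?a)" by (rule arg_cong)
  then have sd: "e ?s \<oplus>\<^bsub>I\<^esub> e ?d = e ?s' \<oplus>\<^bsub>I\<^esub> e ?a"
    using lin_add[OF hom_lin[OF e_hom] c(1,3)] lin_add[OF hom_lin[OF e_hom] c(2,4)] by metis
  have "e (\<rho> \<psi> (2 * Suc i)) \<oplus>\<^bsub>I\<^esub> b (\<rho> \<psi> (Suc (2 * i)))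
    = (e ?d \<oplus>\<^bsub>I\<^esub> (e ?s \<oplus>\<^bsub>I\<^esub> b (t ?s))) \<oplus>\<^bsub>I\<^esub> (b (\<alpha>' i \<psi>) \<oplus>\<^bsub>I\<^esub> \<ominus>\<^bsub>I\<^esub> b (t ?s))"
    unfolding \<rho>_even \<rho>_odd
    using lin_add[OF hom_lin[OF e_hom] c(3,7)] ee[OF sS] lin_add[OF hom_lin[OF b_hom] c(5) Q.M.a_inv_closed[OF ct(1)]]
      lin_uminus[OF Q.module_axioms I.module_axioms hom_lin[OF b_hom] ct(1)] by metis
  also have "\<dots> = (b (t ?s) \<oplus>\<^bsub>I\<^esub> \<ominus>\<^bsub>I\<^esub> b (t ?s)) \<oplus>\<^bsub>I\<^esub> ((e ?s \<oplus>\<^bsub>I\<^esub> e ?d) \<oplus>\<^bsub>I\<^esub> b (\<alpha>' i \<psi>))"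
    using c ct by (simp add: I.M.a_ac del: \<Sigma>.simps)
  also have "\<dots> = (e ?s' \<oplus>\<^bsub>I\<^esub> e ?a) \<oplus>\<^bsub>I\<^esub> b (\<alpha>' i \<psi>)"
    unfolding sd using c ct by (simp add: I.M.r_neg del: \<Sigma>.simps)
  also have "\<dots> = \<rho> \<psi> (2 * i)"
    unfolding \<rho>_even D_def using c by (simp add: I.M.a_ac del: \<Sigma>.simps)
  finally show "\<rho> \<psi> (2 * i) = e (\<rho> \<psi> (2 * Suc i)) \<oplus>\<^bsub>I\<^esub> b (\<rho> \<psi> (Suc (2 * i)))" ..
qed

lemma \<rho>_lin: "\<rho> \<in> lin K V V"
  using lin_add[OF \<rho>_coord_lin] lin_smult[OF \<rho>_coord_lin]
  by (intro linI \<rho>_closed) (auto simp: V_simps fun_eq_iff)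

text \<open>
  The difference is the trace of \<open>\<rho>\<close>, as the corrections have trace zero. Since \<open>inc x\<close> has entry
  \<open>e x\<close> at \<open>0\<close>, this says that \<open>V\<close> splits the stable idempotent \<open>e\<close>.
\<close>

theorem inc_coord: "stably_eq whole V V (\<lambda>\<psi>. inc (\<psi> 0)) (\<lambda>\<psi>. \<psi>)"
proof (rule stably_eq_sym[OF whole V_rep V_rep])
  show "inc (\<psi> 0) \<in> carrier V" if "\<psi> \<in> carrier V" for \<psi>
    by (rule hom_closed[OF inc_hom hom_closed[OF zero_coord_hom that]])
  have "\<psi> = inc (\<psi> 0) \<oplus>\<^bsub>V\<^esub> trace whole V V \<rho> \<psi>" if \<psi>: "\<psi> \<in> carrier V" for \<psi>
  proof
    fix n
    have x0: "\<psi> 0 \<in> S" using V_S(2)[OF \<psi>] .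
    show "\<psi> n = (inc (\<psi> 0) \<oplus>\<^bsub>V\<^esub> trace whole V V \<rho> \<psi>) n"
    proof (cases "even n")
      case True
      then obtain i where n: "n = 2 * i" by (elim evenE)
      have "trace whole V V \<rho> \<psi> (2 * i) = trace whole V I (\<lambda>\<psi>. \<rho> \<psi> (2 * i)) \<psi>"
        by (rule trace_postcompose[OF whole V_rep V_rep I_rep even_coord_hom \<rho>_lin \<psi>, symmetric])
      also have "\<dots> = trace whole V I (D i) \<psi> \<oplus>\<^bsub>I\<^esub> trace whole V I (\<lambda>\<psi>. e (\<Sigma> (Suc i) \<psi>)) \<psi>"
        unfolding \<rho>_even by (rule trace_plus[OF whole V_rep I_rep D_lin e\<Sigma>_lin \<psi>])
      also have "\<dots> = trace whole V I (\<alpha> i) \<psi>"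
        using trace_postcompose[OF whole V_rep I_rep I_rep e_hom \<Sigma>_lin \<psi>, of "Suc i"] trace_\<Sigma>[OF \<psi>, of "Suc i"]
          trace_D[OF \<psi>] trace_closed[OF whole V_rep I_rep \<alpha>(1) \<psi>]
          lin_zero[OF I.module_axioms I.module_axioms hom_lin[OF e_hom]] by (simp del: \<Sigma>.simps)
      finally show ?thesis using \<alpha>(2)[OF \<psi>, of i] by (simp add: n V_simps inc_def I_simps)
    next
      case False
      then obtain i where n: "n = Suc (2 * i)" by (elim oddE) simp
      have nt: "(\<lambda>\<psi>. \<ominus>\<^bsub>Q\<^esub> t (\<Sigma> (Suc (Suc i)) \<psi>)) \<in> lin K V Q"
        by (rule lin_neg[OF Q.module_axioms t\<Sigma>_lin])
      have "trace whole V V \<rho> \<psi> n = trace whole V Q (\<lambda>\<psi>. \<rho> \<psi> n) \<psi>"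
        by (rule trace_postcompose[OF whole V_rep V_rep Q coord_hom \<rho>_lin \<psi>, symmetric])
      also have "\<dots> = trace whole V Q (\<alpha>' i) \<psi> \<oplus>\<^bsub>Q\<^esub> trace whole V Q (\<lambda>\<psi>. \<ominus>\<^bsub>Q\<^esub> t (\<Sigma> (Suc (Suc i)) \<psi>)) \<psi>"
        unfolding n \<rho>_odd by (rule trace_plus[OF whole V_rep Q \<alpha>'_lin nt \<psi>])
      also have "\<dots> = \<kappa> i \<psi>"
        using trace_uminus[OF whole V_rep Q t\<Sigma>_lin[of "Suc (Suc i)"] \<psi>]
          trace_postcompose[OF whole V_rep I_rep Q t_hom \<Sigma>_lin \<psi>, of "Suc (Suc i)"] trace_\<Sigma>[OF \<psi>, of "Suc (Suc i)"]
          lin_zero[OF I.module_axioms Q.module_axioms hom_lin[OF t_hom]] trace_\<alpha>'[OF \<psi>] hom_closed[OF \<kappa>_hom \<psi>]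
        by (simp del: \<Sigma>.simps)
      finally show ?thesis
        using t_closed[OF x0] V_S(3)[OF \<psi>, of n]
        by (simp add: n V_simps inc_def \<kappa>_def Q.M.a_lcomm[of "\<ominus>\<^bsub>Q\<^esub> t (\<psi> 0)"] Q.M.l_neg)
    qed
  qed
  then show "stably_eq whole V V (\<lambda>\<psi>. \<psi>) (\<lambda>\<psi>. inc (\<psi> 0))"
    unfolding stably_eq_def using \<rho>_lin by blast
qed

end

section \<open>The induced module\<close>

lemma coset_sum_twist [simp]: "coset_sum G H (twist G x W) F = coset_sum G H W F"
  by (simp add: coset_sum_def)

lemma (in group_algebra) coset_sum_single:
  assumes H: "subgroup H G" and W: "module K W" and z: "z \<in> carrier G" and w: "w \<in> carrier W"
  shows "coset_sum G H W (\<lambda>g. if z \<otimes> inv g \<in> H then w else \<zero>\<^bsub>W\<^esub>) = w"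
proof -
  interpret W: module K W by (rule W)
  have iff: "z \<otimes> inv (coset_rep C) \<in> H \<longleftrightarrow> H #> z = C" if C: "C \<in> rcosets H" for C
  proof -
    note r = coset_rep[OF H C]
    have "z \<otimes> inv (coset_rep C) \<in> H \<longleftrightarrow> z \<in> H #> coset_rep C"
      by (rule subgroup.rcos_module[OF H group r(1) z, symmetric])
    also have "\<dots> \<longleftrightarrow> H #> z = C"
    proof
      assume "z \<in> H #> coset_rep C"
      from G.repr_independence[OF this r(1) H] show "H #> z = C" using r(2) by simp
    next
      assume "H #> z = C"
      then show "z \<in> H #> coset_rep C" using G.rcos_self[OF z H] r(2) by simp
    qed
    finally show ?thesis .
  qed
  have "coset_sum G H W (\<lambda>g. if z \<otimes> inv g \<in> H then w else \<zero>\<^bsub>W\<^esub>)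
    = (\<Oplus>\<^bsub>W\<^esub>C\<in>rcosets H. if H #> z = C then w else \<zero>\<^bsub>W\<^esub>)"
    unfolding coset_sum_def using iff w by (intro W.M.finsum_cong') auto
  also have "\<dots> = w"
    using w finite_rcosets[OF H] G.rcosetsI[OF subgroup.subset[OF H] z]
    by (intro W.M.add.finprod_singleton) auto
  finally show ?thesis .
qed

context stable_descent
begin

text \<open>
  All functions \<open>G \<rightarrow> W\<close> with the action of \<open>G\<close> by right translation of the argument. This is a
  projective module, and it contains the induced module as those functions that are equivariant for
  \<open>H\<close> under left translation.
\<close>

definition Q :: "('k, 'g \<Rightarrow> 'w, 'g) gmod" where
  "Q = fun_gmod W (carrier G) (\<lambda>u \<phi> g. if g \<in> carrier G then \<phi> (g \<otimes> u) else \<zero>\<^bsub>W\<^esub>)"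

definition S :: "('g \<Rightarrow> 'w) set" where
  "S = {\<phi> \<in> carrier Q. \<forall>h\<in>H. \<forall>g\<in>carrier G. \<phi> (h \<otimes> g) = act W h (\<phi> g)}"

definition Ind :: "('k, 'g \<Rightarrow> 'w, 'g) gmod" where "Ind = Q\<lparr>carrier := S\<rparr>"

sublocale W: module K W by (rule rep_module[OF W])

lemma Q_simps:
  "\<phi> \<in> carrier Q \<longleftrightarrow> (\<forall>g\<in>carrier G. \<phi> g \<in> carrier W) \<and> (\<forall>g. g \<notin> carrier G \<longrightarrow> \<phi> g = \<zero>\<^bsub>W\<^esub>)"
  "ring.zero Q = (\<lambda>g. \<zero>\<^bsub>W\<^esub>)" "ring.add Q = (\<lambda>\<phi> \<psi> g. \<phi> g \<oplus>\<^bsub>W\<^esub> \<psi> g)"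
  "smult Q = (\<lambda>c \<phi> g. c \<odot>\<^bsub>W\<^esub> \<phi> g)"
  "act Q = (\<lambda>u \<phi> g. if g \<in> carrier G then \<phi> (g \<otimes> u) else \<zero>\<^bsub>W\<^esub>)"
  by (simp_all add: Q_def fun_gmod_simps)

lemma Ind_simps:
  "carrier Ind = S" "ring.zero Ind = ring.zero Q" "ring.add Ind = ring.add Q"
  "smult Ind = smult Q" "act Ind = act Q"
  by (simp_all add: Ind_def)

lemma Ind_mem:
  "\<phi> \<in> carrier Ind \<longleftrightarrow> (\<forall>g\<in>carrier G. \<phi> g \<in> carrier W) \<and> (\<forall>g. g \<notin> carrier G \<longrightarrow> \<phi> g = \<zero>\<^bsub>W\<^esub>) \<and>
     (\<forall>h\<in>H. \<forall>g\<in>carrier G. \<phi> (h \<otimes> g) = act W h (\<phi> g))"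
  by (auto simp: Ind_simps S_def Q_simps)

lemma Q_module: "module K Q"
  unfolding Q_def by (rule fun_gmod_module[OF W.module_axioms])

lemma Q_value: "\<phi> \<in> carrier Q \<Longrightarrow> \<phi> g \<in> carrier W"
  unfolding Q_def by (rule fun_gmod_value[OF W.module_axioms])

lemma Q_rep: "rep whole Q"
proof (rule repI[OF G.subgroup_self Q_module])
  show "act Q g \<in> lin K Q Q" if g: "g \<in> carrier G" for g
    using g by (auto intro!: linI simp: Q_simps fun_eq_iff)
  show "act Q \<one> v = v" if "v \<in> carrier Q" for v
    using that by (auto simp: Q_simps fun_eq_iff)
  show "act Q (g \<otimes> h) v = act Q g (act Q h v)" if "g \<in> carrier G" "h \<in> carrier G" "v \<in> carrier Q" for g h v
    using that by (auto simp: Q_simps fun_eq_iff G.m_assoc)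
qed

lemma act_Ind_closed:
  assumes "g \<in> carrier G" "\<phi> \<in> carrier Ind"
  shows "act Q g \<phi> \<in> carrier Ind"
  unfolding Ind_mem
proof (intro conjI ballI allI impI)
  fix h x assume "h \<in> H" "x \<in> carrier G"
  then show "act Q g \<phi> (h \<otimes> x) = act W h (act Q g \<phi> x)"
    using assms HG by (auto simp: Q_simps Ind_mem G.m_assoc)
qed (use assms in \<open>auto simp: Q_simps Ind_mem\<close>)

lemma Ind_module: "module K Ind"
  unfolding Ind_def
proof (rule submodule_module[OF Q_module])
  interpret Q: module K Q by (rule Q_module)
  have cl: "\<phi> g \<in> carrier W" if "\<phi> \<in> S" for \<phi> g using that Q_value by (auto simp: S_def)
  have S: "\<phi> \<in> carrier Q" "h \<in> H \<Longrightarrow> g \<in> carrier G \<Longrightarrow> \<phi> (h \<otimes> g) = act W h (\<phi> g)" if "\<phi> \<in> S" for \<phi> h g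
    using that by (auto simp: S_def)
  show "S \<subseteq> carrier Q" by (auto simp: S_def)
  show "\<zero>\<^bsub>Q\<^esub> \<in> S"
    using Q.M.zero_closed lin_zero[OF W.module_axioms W.module_axioms rep_act_lin[OF W]]
    by (auto simp: S_def Q_simps(2))
  show "\<phi> \<oplus>\<^bsub>Q\<^esub> \<psi> \<in> S" if "\<phi> \<in> S" "\<psi> \<in> S" for \<phi> \<psi>
    using Q.M.a_closed[OF S(1)[OF that(1)] S(1)[OF that(2)]] S(2)[OF that(1)] S(2)[OF that(2)]
      lin_add[OF rep_act_lin[OF W] cl[OF that(1)] cl[OF that(2)]]
    unfolding S_def by (simp add: Q_simps(3))
  show "c \<odot>\<^bsub>Q\<^esub> \<phi> \<in> S" if "c \<in> carrier K" "\<phi> \<in> S" for c \<phi>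
    using Q.smult_closed[OF that(1) S(1)[OF that(2)]] S(2)[OF that(2)]
      lin_smult[OF rep_act_lin[OF W] that(1) cl[OF that(2)]]
    unfolding S_def by (simp add: Q_simps(4))
qed

lemma Ind_rep: "rep whole Ind"
proof (rule repI[OF G.subgroup_self Ind_module])
  show "act Ind g \<in> lin K Ind Ind" if g: "g \<in> carrier G" for g
    using act_Ind_closed[OF g] by (auto intro!: linI simp: Ind_simps Q_simps(3-5) fun_eq_iff)
  show "act Ind \<one> v = v" if "v \<in> carrier Ind" for v
    using that rep_act_one[OF Q_rep] by (simp add: Ind_simps S_def)
  show "act Ind (g \<otimes> h) v = act Ind g (act Ind h v)" if "g \<in> carrier G" "h \<in> carrier G" "v \<in> carrier Ind" for g h v
    using that rep_act_mult[OF Q_rep] by (simp add: Ind_simps S_def)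
qed

lemma Ind_value: "\<phi> \<in> carrier Ind \<Longrightarrow> \<phi> g \<in> carrier W"
  using Q_value by (simp add: Ind_simps S_def)

lemma Ind_left: "\<phi> \<in> carrier Ind \<Longrightarrow> h \<in> H \<Longrightarrow> g \<in> carrier G \<Longrightarrow> \<phi> (h \<otimes> g) = act W h (\<phi> g)"
  by (simp add: Ind_mem)

lemma eval_lin: "(\<lambda>\<phi>. \<phi> g) \<in> lin K Ind W"
  using Ind_value by (auto intro!: linI simp: Ind_simps(2-5) Q_simps(3-5))

lemma eval_hom:
  assumes g: "g \<in> carrier G" and L: "subgroup L G" and mem: "\<And>k. k \<in> L \<Longrightarrow> g \<otimes> k \<otimes> inv g \<in> H"
  shows "(\<lambda>\<phi>. \<phi> g) \<in> hom L Ind (twist G g W)"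
proof -
  have "act Ind k \<phi> g = act W (g \<otimes> k \<otimes> inv g) (\<phi> g)" if k: "k \<in> L" and \<phi>: "\<phi> \<in> carrier Ind" for k \<phi>
  proof -
    have "k \<in> carrier G" using k L by (simp add: subgroup.mem_carrier)
    then have "g \<otimes> k = (g \<otimes> k \<otimes> inv g) \<otimes> g" using g by (simp add: G.m_assoc)
    then show ?thesis using Ind_left[OF \<phi> mem[OF k] g] g by (simp add: Ind_simps Q_simps)
  qed
  then show ?thesis using eval_lin by (simp add: hom_iff)
qed

lemma eval_one_hom: "(\<lambda>\<phi>. \<phi> \<one>) \<in> hom H Ind W"
proof -
  have "(\<lambda>\<phi>. \<phi> \<one>) \<in> hom H Ind (twist G \<one> W)"
    by (rule eval_hom[OF G.one_closed H]) (simp add: HG)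
  then show ?thesis by (rule twist_one_hom[OF H, THEN iffD1])
qed

text \<open>
  Restriction of a function to the coset \<open>H g\<close>. These projections decompose the induced module into
  pieces that are permuted by \<open>G\<close>, the piece of \<open>H g\<close> being the \<open>g\<close>-twist of \<open>W\<close>, embedded by
  \<open>extend g\<close>.
\<close>

definition on_coset :: "'g \<Rightarrow> ('g \<Rightarrow> 'w) \<Rightarrow> 'g \<Rightarrow> 'w" where
  "on_coset g \<phi> z = (if z \<in> carrier G \<and> z \<otimes> inv g \<in> H then \<phi> z else \<zero>\<^bsub>W\<^esub>)"

definition extend :: "'g \<Rightarrow> 'w \<Rightarrow> 'g \<Rightarrow> 'w" where
  "extend g w z = (if z \<in> carrier G \<and> z \<otimes> inv g \<in> H then act W (z \<otimes> inv g) w else \<zero>\<^bsub>W\<^esub>)"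

lemma H_mult_iff: "h \<in> H \<Longrightarrow> x \<in> carrier G \<Longrightarrow> h \<otimes> x \<in> H \<longleftrightarrow> x \<in> H"
proof
  assume h: "h \<in> H" and x: "x \<in> carrier G" and hx: "h \<otimes> x \<in> H"
  have "inv h \<otimes> (h \<otimes> x) \<in> H"
    by (rule subgroup.m_closed[OF H subgroup.m_inv_closed[OF H h] hx])
  then show "x \<in> H" using HG[OF h] x by simp
qed (simp add: subgroup.m_closed[OF H])

lemma extend_hom:
  assumes g: "g \<in> carrier G"
  shows "extend g \<in> hom (conj_subgroup G H g) (twist G g W) Ind"
proof -
  have HH: "subgroup H G" by (rule H)
  have a: "act W (z \<otimes> inv g) \<in> lin K W W" if "z \<otimes> inv g \<in> H" for z
    by (rule rep_act_lin[OF W that])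
  have cl: "extend g w \<in> carrier Ind" if w: "w \<in> carrier W" for w
    unfolding Ind_mem
  proof (intro conjI ballI allI impI)
    fix h z assume h: "h \<in> H" and z: "z \<in> carrier G"
    have e: "h \<otimes> z \<otimes> inv g = h \<otimes> (z \<otimes> inv g)" using HG[OF h] z g by (simp add: G.m_assoc)
    show "extend g w (h \<otimes> z) = act W h (extend g w z)"
      using H_mult_iff[OF h, of "z \<otimes> inv g"] h z g w HG[OF h] rep_act_mult[OF W h]
        lin_zero[OF W.module_axioms W.module_axioms rep_act_lin[OF W h]]
      by (simp add: extend_def e)
  qed (use w rep_act_closed[OF W] in \<open>auto simp: extend_def\<close>)
  moreover have "extend g (act W (g \<otimes> k \<otimes> inv g) w) = act Ind k (extend g w)"
    if k: "k \<in> conj_subgroup G H g" and w: "w \<in> carrier W" for k w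
  proof
    fix z
    have kG: "k \<in> carrier G" using k conj_subgroup_carrier[OF g subgroup.subset[OF H]] by blast
    have m: "g \<otimes> k \<otimes> inv g \<in> H" using k conj_subgroup_iff[OF g kG subgroup.subset[OF H]] by simp
    show "extend g (act W (g \<otimes> k \<otimes> inv g) w) z = act Ind k (extend g w) z"
    proof (cases "z \<in> carrier G")
      case True
      have e: "z \<otimes> k \<otimes> inv g = (z \<otimes> inv g) \<otimes> (g \<otimes> k \<otimes> inv g)"
        using True kG g by (simp add: G.m_assoc)
      have iff: "z \<otimes> k \<otimes> inv g \<in> H \<longleftrightarrow> z \<otimes> inv g \<in> H"
      proof
        assume "z \<otimes> inv g \<in> H"
        then show "z \<otimes> k \<otimes> inv g \<in> H" unfolding e using m by (rule subgroup.m_closed[OF H])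
      next
        assume "z \<otimes> k \<otimes> inv g \<in> H"
        from subgroup.m_closed[OF H this subgroup.m_inv_closed[OF H m]] show "z \<otimes> inv g \<in> H" using True kG g by (simp add: G.inv_mult_group G.m_assoc)
      qed
      have r: "act Ind k (extend g w) z
        = (if z \<otimes> inv g \<in> H then act W (z \<otimes> k \<otimes> inv g) w else \<zero>\<^bsub>W\<^esub>)"
        using True kG iff by (simp add: Ind_simps Q_simps extend_def)
      show ?thesis
      proof (cases "z \<otimes> inv g \<in> H")
        case zH: True
        show ?thesis
          unfolding r unfolding e rep_act_mult[OF W zH m w] using zH True by (simp add: extend_def)
      next
        case False
        then show ?thesis unfolding r by (simp add: extend_def)
      qed
    qed (simp add: extend_def Ind_simps Q_simps)
  qed
  ultimately show ?thesis
    using lin_add[OF a] lin_smult[OF a]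
    by (auto simp: hom_iff Ind_simps(3,4) Q_simps(3,4) fun_eq_iff extend_def intro!: linI)
qed

lemma on_coset_extend:
  assumes g: "g \<in> carrier G" and \<phi>: "\<phi> \<in> carrier Ind"
  shows "on_coset g \<phi> = extend g (\<phi> g)"
proof
  fix z
  have "\<phi> z = act W (z \<otimes> inv g) (\<phi> g)" if "z \<in> carrier G" "z \<otimes> inv g \<in> H"
    using Ind_left[OF \<phi> that(2) g] that(1) g by (simp add: G.m_assoc)
  then show "on_coset g \<phi> z = extend g (\<phi> g) z" by (simp add: on_coset_def extend_def)
qed

lemma on_coset_lin:
  assumes g: "g \<in> carrier G"
  shows "on_coset g \<in> lin K Ind Ind"
proof (rule lin_cong[OF _ on_coset_extend[OF g] Ind_module])
  have "extend g \<in> lin K W Ind" using hom_lin[OF extend_hom[OF g]] by simp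
  then show "(\<lambda>\<phi>. extend g (\<phi> g)) \<in> lin K Ind Ind" by (rule lin_comp[OF _ eval_lin])
qed

lemma coset_sum_on_coset:
  assumes \<phi>: "\<phi> \<in> carrier Ind"
  shows "coset_sum G H Ind (\<lambda>g. on_coset g \<phi>) = \<phi>"
proof
  fix z
  have cl: "on_coset g \<phi> \<in> carrier Ind" if "g \<in> carrier G" for g by (rule lin_closed[OF on_coset_lin[OF that] \<phi>])
  have "coset_sum G H Ind (\<lambda>g. on_coset g \<phi>) z = coset_sum G H W (\<lambda>g. on_coset g \<phi> z)"
    by (rule coset_sum_apply[OF H Ind_module W.module_axioms eval_lin cl])
  also have "\<dots> = \<phi> z"
  proof (cases "z \<in> carrier G")
    case True
    then show ?thesis
      using coset_sum_single[OF H W.module_axioms True Ind_value[OF \<phi>]] by (simp add: on_coset_def)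
  next
    case False
    then show ?thesis using \<phi> by (simp add: on_coset_def Ind_mem coset_sum_def)
  qed
  finally show "coset_sum G H Ind (\<lambda>g. on_coset g \<phi>) z = \<phi> z" .
qed

text \<open>
  A map into the induced module is the sum of its components on the cosets \<open>H x\<close>, and \<open>L\<close> permutes
  these. So by the orbit argument it is enough to compare, for each \<open>x\<close>, the values at \<open>x\<close> over the
  stabiliser \<open>L \<inter> H\<^sup>x\<close>.
\<close>

lemma stably_eq_into_Ind:
  assumes L: "subgroup L G" and U: "rep L U" and f: "f \<in> hom L U Ind" and f': "f' \<in> hom L U Ind"
    and eq: "\<And>x. x \<in> carrier G \<Longrightarrow>
      stably_eq (L \<inter> conj_subgroup G H x) U (twist G x W) (\<lambda>v. f v x) (\<lambda>v. f' v x)"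
  shows "stably_eq L U Ind f f'"
proof -
  have LG: "\<And>l. l \<in> L \<Longrightarrow> l \<in> carrier G" using L by (rule subgroup.mem_carrier)
  have RI: "rep L Ind" by (rule rep_whole_sub[OF Ind_rep L])
  have inv: "on_coset (h \<otimes> g) \<phi> = on_coset g \<phi>" if h: "h \<in> H" and g: "g \<in> carrier G" for h g \<phi>
  proof
    fix z
    have "z \<otimes> inv (h \<otimes> g) \<in> H \<longleftrightarrow> z \<otimes> inv g \<in> H" if z: "z \<in> carrier G"
    proof
      assume "z \<otimes> inv (h \<otimes> g) \<in> H"
      from subgroup.m_closed[OF H this h] show "z \<otimes> inv g \<in> H"
        using z g HG[OF h] by (simp add: G.inv_mult_group G.m_assoc)
    next
      assume "z \<otimes> inv g \<in> H"
      from subgroup.m_closed[OF H this subgroup.m_inv_closed[OF H h]] show "z \<otimes> inv (h \<otimes> g) \<in> H"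
        using z g HG[OF h] by (simp add: G.inv_mult_group G.m_assoc)
    qed
    then show "on_coset (h \<otimes> g) \<phi> z = on_coset g \<phi> z" by (auto simp: on_coset_def)
  qed
  have equi: "on_coset (g \<otimes> inv l) (act Ind l \<phi>) = act Ind l (on_coset g \<phi>)"
    if "l \<in> L" "g \<in> carrier G" for l g \<phi>
    using that LG[OF that(1)]
    by (auto simp: on_coset_def Ind_simps Q_simps fun_eq_iff G.inv_mult_group G.m_assoc)
  have stable: "stably_eq (L \<inter> conj_subgroup G H g) U Ind (\<lambda>v. on_coset g (f v)) (\<lambda>v. on_coset g (f' v))"
    if g: "g \<in> carrier G" for g
  proof -
    define M where "M = L \<inter> conj_subgroup G H g"
    have M: "subgroup M G" unfolding M_def by (intro G.subgroups_Inter_pair L conj_subgroup_subgroup H g)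
    have mem: "g \<otimes> k \<otimes> inv g \<in> H" if "k \<in> M" for k
      using that conj_subgroup_iff[OF g LG subgroup.subset[OF H]] by (auto simp: M_def)
    have UM: "rep M U" by (rule rep_subgroup[OF U M]) (simp add: M_def)
    have "stably_eq M U Ind (\<lambda>v. extend g (f v g)) (\<lambda>v. extend g (f' v g))"
    proof (rule stably_eq_postcompose[OF M UM rep_twist_H[OF g M mem] _ rep_whole_sub[OF Ind_rep M]])
      show "stably_eq M U (twist G g W) (\<lambda>v. f v g) (\<lambda>v. f' v g)" using eq[OF g] by (simp add: M_def)
      show "extend g \<in> hom M (twist G g W) Ind"
        by (rule hom_subgroup[OF extend_hom[OF g]]) (simp add: M_def)
    qed (use hom_closed[OF f'] Ind_value in simp_all)
    then show ?thesis
      unfolding M_def[symmetric] stably_eq_def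
      using on_coset_extend[OF g] hom_closed[OF f] hom_closed[OF f'] by simp
  qed
  have "stably_eq L U Ind (\<lambda>v. coset_sum G H Ind (\<lambda>g. on_coset g (f v))) (\<lambda>v. coset_sum G H Ind (\<lambda>g. on_coset g (f' v)))"
  proof (rule stably_eq_coset_sum[OF H L U RI, where F = "\<lambda>g v. on_coset g (f v)" and F' = "\<lambda>g v. on_coset g (f' v)"])
    show "(\<lambda>v. on_coset g (f v)) \<in> lin K U Ind" "(\<lambda>v. on_coset g (f' v)) \<in> lin K U Ind" if "g \<in> carrier G" for g
      by (rule lin_comp[OF on_coset_lin[OF that] hom_lin[OF f]] lin_comp[OF on_coset_lin[OF that] hom_lin[OF f']])+
  qed (use inv equi stable hom_act[OF f] hom_act[OF f'] in simp_all)
  then show ?thesis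
    unfolding stably_eq_def
    using coset_sum_on_coset hom_closed[OF f] hom_closed[OF f'] by simp
qed

end

section \<open>The idempotent attached to a descent datum\<close>

context stable_descent
begin

text \<open>
  The map \<open>w \<mapsto> (x \<mapsto> \<tau>\<^sub>x w)\<close>; for an actual \<open>G\<close>-module \<open>W\<close> and \<open>\<tau>\<^sub>x w = x w\<close> it is the unit of
  induction.
\<close>

definition j :: "'w \<Rightarrow> 'g \<Rightarrow> 'w" where
  "j w x = (if x \<in> carrier G then \<tau> x w else \<zero>\<^bsub>W\<^esub>)"

lemma j_hom: "j \<in> hom H W Ind"
proof -
  have cl: "j w \<in> carrier Ind" if w: "w \<in> carrier W" for w
    using w \<tau>_closed \<tau>_left HG by (simp add: Ind_mem j_def)
  moreover have "j (act W h w) = act Ind h (j w)" if "h \<in> H" "w \<in> carrier W" for h w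
    using that \<tau>_right HG by (simp add: j_def Ind_simps Q_simps fun_eq_iff)
  ultimately show ?thesis
    using lin_add[OF \<tau>_lin] lin_smult[OF \<tau>_lin]
    by (auto simp: hom_iff j_def Ind_simps(3,4) Q_simps(3,4) fun_eq_iff intro!: linI)
qed

lemma j_eval_hom: "(\<lambda>\<phi>. j (\<phi> \<one>)) \<in> hom H Ind Ind"
  by (rule hom_comp[OF j_hom eval_one_hom])

text \<open>
  The average of \<open>j\<close> composed with evaluation at \<open>1\<close>, so equivariant for \<open>G\<close> by construction.
\<close>

definition \<epsilon> :: "('g \<Rightarrow> 'w) \<Rightarrow> 'g \<Rightarrow> 'w" where
  "\<epsilon> = average Ind Ind (\<lambda>\<phi>. j (\<phi> \<one>))"

lemma \<epsilon>_hom: "\<epsilon> \<in> hom whole Ind Ind"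
  unfolding \<epsilon>_def by (rule average_hom[OF Ind_rep Ind_rep j_eval_hom])

lemma \<epsilon>_hom_H: "\<epsilon> \<in> hom H Ind Ind"
  by (rule hom_subgroup[OF \<epsilon>_hom subgroup.subset[OF H]])

lemma \<epsilon>_value:
  assumes \<phi>: "\<phi> \<in> carrier Ind" and x: "x \<in> carrier G"
  shows "\<epsilon> \<phi> x = index_inv \<odot>\<^bsub>W\<^esub> coset_sum G H W (\<lambda>g. \<tau> (x \<otimes> inv g) (\<phi> g))"
proof -
  let ?F = "\<lambda>g. act Ind (inv g) (j (act Ind g \<phi> \<one>))"
  have cl: "?F g \<in> carrier Ind" if "g \<in> carrier G" for g
    by (rule average_summand_closed[OF Ind_rep Ind_rep j_eval_hom that \<phi>])
  have s: "coset_sum G H Ind ?F \<in> carrier Ind" by (rule coset_sum_closed[OF H Ind_module cl])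
  have "\<epsilon> \<phi> x = index_inv \<odot>\<^bsub>W\<^esub> coset_sum G H Ind ?F x"
    unfolding \<epsilon>_def average_def by (simp add: Ind_simps Q_simps)
  also have "coset_sum G H Ind ?F x = coset_sum G H W (\<lambda>g. ?F g x)"
    by (rule coset_sum_apply[OF H Ind_module W.module_axioms eval_lin cl])
  also have "\<dots> = coset_sum G H W (\<lambda>g. \<tau> (x \<otimes> inv g) (\<phi> g))"
    by (rule coset_sum_cong[OF H W.module_axioms])
      (use x \<tau>_closed Ind_value[OF \<phi>] in \<open>simp_all add: Ind_simps Q_simps j_def\<close>)
  finally show ?thesis .
qed

lemma meet1_conj: "H \<inter> conj_subgroup G H x = meet1 G H x"
  by (auto simp: meet1_def)

text \<open>
  At \<open>x\<close> the left side is the average over \<open>g\<close> of \<open>\<tau>\<^bsub>x g\<^sup>-\<^sup>1\<^esub> \<tau>\<^sub>g\<close>. By the cocycle condition each term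
  agrees stably with \<open>\<tau>\<^sub>x\<close> over \<open>H \<inter> H\<^sup>x \<inter> H\<^sup>g\<close>, which is the stabiliser of the coset \<open>H g\<close>.
\<close>

lemma \<epsilon>_j: "stably_eq H W Ind (\<lambda>w. \<epsilon> (j w)) j"
proof (rule stably_eq_into_Ind[OF H W hom_comp[OF \<epsilon>_hom_H j_hom] j_hom])
  fix x assume x: "x \<in> carrier G"
  define L where "L = meet1 G H x"
  have L: "subgroup L G" and LH: "L \<subseteq> H" using meet1_subgroup[OF H x] meet1_sub by (simp_all add: L_def)
  have LG: "l \<in> carrier G" if "l \<in> L" for l using that LH HG by blast
  have mem: "x \<otimes> k \<otimes> inv x \<in> H" if "k \<in> L" for k using that meet1_H_mem[OF x] by (simp add: L_def)
  have WL: "rep L W" by (rule rep_subgroup[OF W L LH])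
  have tW: "rep L (twist G x W)" by (rule rep_twist_H[OF x L mem])
  have "stably_eq L W (twist G x W)
     (\<lambda>w. index_inv \<odot>\<^bsub>twist G x W\<^esub> coset_sum G H (twist G x W) (\<lambda>g. \<tau> (x \<otimes> inv g) (\<tau> g w))) (\<tau> x)"
  proof (rule stably_eq_average[OF L WL tW, where F = "\<lambda>g w. \<tau> (x \<otimes> inv g) (\<tau> g w)"])
    show "(\<lambda>w. \<tau> (x \<otimes> inv g) (\<tau> g w)) \<in> lin K W (twist G x W)" if "g \<in> carrier G" for g
      using lin_comp[OF \<tau>_lin \<tau>_lin] x that by simp
    show "\<tau> (x \<otimes> inv (h \<otimes> g)) (\<tau> (h \<otimes> g) w) = \<tau> (x \<otimes> inv g) (\<tau> g w)"
      if h: "h \<in> H" and g: "g \<in> carrier G" and w: "w \<in> carrier W" for h g w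
    proof -
      have ih: "inv h \<in> H" by (rule subgroup.m_inv_closed[OF H h])
      have e: "x \<otimes> inv (h \<otimes> g) = (x \<otimes> inv g) \<otimes> inv h"
        using x g HG[OF h] by (simp add: G.inv_mult_group G.m_assoc)
      have tg: "\<tau> g w \<in> carrier W" by (rule \<tau>_closed[OF g w])
      show ?thesis
        unfolding e \<tau>_left[OF g h w]
        using \<tau>_right[OF _ ih rep_act_closed[OF W h tg], of "x \<otimes> inv g"]
          rep_act_inv(1)[OF W H h tg] x g by simp
    qed
    show "\<tau> (x \<otimes> inv (g \<otimes> inv l)) (\<tau> (g \<otimes> inv l) (act W l w))
      = act (twist G x W) l (\<tau> (x \<otimes> inv g) (\<tau> g w))"
      if l: "l \<in> L" and g: "g \<in> carrier G" and w: "w \<in> carrier W" for l g w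
    proof -
      have lH: "l \<in> H" using l LH by blast
      have lG: "l \<in> carrier G" by (rule LG[OF l])
      have 1: "\<tau> (g \<otimes> inv l) (act W l w) = \<tau> g w"
        using \<tau>_right[OF _ lH w, of "g \<otimes> inv l"] g lG by (simp add: G.m_assoc)
      have e: "x \<otimes> inv (g \<otimes> inv l) = (x \<otimes> l \<otimes> inv x) \<otimes> (x \<otimes> inv g)"
        using x g lG by (simp add: G.inv_mult_group G.m_assoc)
      show ?thesis
        unfolding 1 e using \<tau>_left[OF _ mem[OF l] \<tau>_closed[OF g w], of "x \<otimes> inv g"] x g by simp
    qed
    show "\<tau> x \<in> hom L W (twist G x W)" using \<tau>_hom[OF x] by (simp add: L_def)
    show "stably_eq (L \<inter> conj_subgroup G H g) W (twist G x W) (\<lambda>w. \<tau> (x \<otimes> inv g) (\<tau> g w)) (\<tau> x)"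
      if g: "g \<in> carrier G" for g
    proof -
      have "meet2 G H (x \<otimes> inv g) g = L \<inter> conj_subgroup G H g"
        using x g by (auto simp: meet2_def meet1_def L_def G.m_assoc)
      then show ?thesis using \<tau>_mult[OF g, of "x \<otimes> inv g"] x g by (simp add: G.m_assoc)
    qed
  qed
  note sum = this
  have "stably_eq L W (twist G x W) (\<lambda>w. \<epsilon> (j w) x) (\<lambda>w. j w x)"
  proof -
    have "\<epsilon> (j w) x = index_inv \<odot>\<^bsub>W\<^esub> coset_sum G H W (\<lambda>g. \<tau> (x \<otimes> inv g) (\<tau> g w))" if w: "w \<in> carrier W" for w
    proof -
      have "coset_sum G H W (\<lambda>g. \<tau> (x \<otimes> inv g) (j w g)) = coset_sum G H W (\<lambda>g. \<tau> (x \<otimes> inv g) (\<tau> g w))"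
        by (rule coset_sum_cong[OF H W.module_axioms]) (use \<tau>_closed w x in \<open>simp_all add: j_def\<close>)
      then show ?thesis using \<epsilon>_value[OF hom_closed[OF j_hom w] x] by simp
    qed
    with sum x show ?thesis by (simp add: stably_eq_def j_def)
  qed
  then show "stably_eq (H \<inter> conj_subgroup G H x) W (twist G x W) (\<lambda>w. \<epsilon> (j w) x) (\<lambda>w. j w x)"
    by (simp add: meet1_conj L_def)
qed

text \<open>
  At \<open>x\<close> both sides are averages over \<open>g\<close>, of \<open>\<tau>\<^sub>x \<tau>\<^bsub>g\<^sup>-\<^sup>1\<^esub> (\<phi> g)\<close> and of \<open>\<tau>\<^bsub>x g\<^sup>-\<^sup>1\<^esub> (\<phi> g)\<close>. They are compared
  term by term by the cocycle condition for \<open>x\<close> and \<open>g\<^sup>-\<^sup>1\<close>, twisted by \<open>g\<close>.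
\<close>

lemma j_\<epsilon>: "stably_eq H Ind Ind (\<lambda>\<phi>. j (\<epsilon> \<phi> \<one>)) \<epsilon>"
proof (rule stably_eq_into_Ind[OF H rep_whole_sub[OF Ind_rep H] hom_comp[OF j_eval_hom \<epsilon>_hom_H] \<epsilon>_hom_H])
  fix x assume x: "x \<in> carrier G"
  define L where "L = meet1 G H x"
  have L: "subgroup L G" and LH: "L \<subseteq> H" using meet1_subgroup[OF H x] meet1_sub by (simp_all add: L_def)
  have LG: "l \<in> carrier G" if "l \<in> L" for l using that LH HG by blast
  have mem: "x \<otimes> k \<otimes> inv x \<in> H" if "k \<in> L" for k using that meet1_H_mem[OF x] by (simp add: L_def)
  have IL: "rep L Ind" by (rule rep_whole_sub[OF Ind_rep L])
  have tW: "rep L (twist G x W)" by (rule rep_twist_H[OF x L mem])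
  \<comment> \<open>The two families to be compared. The facts about them are stated with a parameter \<open>y\<close>, used for \<open>y = 1\<close> and \<open>y = x\<close>.\<close>
  let ?F = "\<lambda>g \<phi>. \<tau> x (\<tau> (inv g) (\<phi> g))" and ?F' = "\<lambda>g \<phi>. \<tau> (x \<otimes> inv g) (\<phi> g)"
  have inv: "\<tau> (y \<otimes> inv (h \<otimes> g)) (\<phi> (h \<otimes> g)) = \<tau> (y \<otimes> inv g) (\<phi> g)"
    if h: "h \<in> H" and g: "g \<in> carrier G" and \<phi>: "\<phi> \<in> carrier Ind" and y: "y \<in> carrier G" for h g \<phi> y
  proof -
    have ih: "inv h \<in> H" by (rule subgroup.m_inv_closed[OF H h])
    have e: "y \<otimes> inv (h \<otimes> g) = (y \<otimes> inv g) \<otimes> inv h"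
      using y g HG[OF h] by (simp add: G.inv_mult_group G.m_assoc)
    have pg: "\<phi> g \<in> carrier W" by (rule Ind_value[OF \<phi>])
    show ?thesis
      unfolding e Ind_left[OF \<phi> h g]
      using \<tau>_right[OF _ ih rep_act_closed[OF W h pg], of "y \<otimes> inv g"]
        rep_act_inv(1)[OF W H h pg] y g by simp
  qed
  have shift: "act Ind l \<phi> (g \<otimes> inv l) = \<phi> g" if "l \<in> L" "g \<in> carrier G" for l g \<phi>
    using that LG[OF that(1)] by (simp add: Ind_simps Q_simps G.m_assoc)
  have conj: "\<tau> (y \<otimes> inv (g \<otimes> inv l)) w = act W (y \<otimes> l \<otimes> inv y) (\<tau> (y \<otimes> inv g) w)"
    if l: "l \<in> L" and g: "g \<in> carrier G" and y: "y \<in> carrier G" "y \<otimes> l \<otimes> inv y \<in> H" and w: "w \<in> carrier W" for l g y w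
  proof -
    have e: "y \<otimes> inv (g \<otimes> inv l) = (y \<otimes> l \<otimes> inv y) \<otimes> (y \<otimes> inv g)"
      using y(1) g LG[OF l] by (simp add: G.inv_mult_group G.m_assoc)
    show ?thesis unfolding e using \<tau>_left[OF _ y(2) w, of "y \<otimes> inv g"] y(1) g by simp
  qed
  have sum: "stably_eq L Ind (twist G x W) (\<lambda>\<phi>. coset_sum G H (twist G x W) (\<lambda>g. ?F g \<phi>))
     (\<lambda>\<phi>. coset_sum G H (twist G x W) (\<lambda>g. ?F' g \<phi>))"
  proof (rule stably_eq_coset_sum[OF H L IL tW, where F = ?F and F' = ?F'])
    fix g assume g: "g \<in> carrier G"
    show "?F g \<in> lin K Ind (twist G x W)" "?F' g \<in> lin K Ind (twist G x W)"
      using lin_comp[OF \<tau>_lin[OF x] lin_comp[OF \<tau>_lin eval_lin]] lin_comp[OF \<tau>_lin eval_lin] g x by simp_all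
    define M where "M = L \<inter> conj_subgroup G H g"
    have MsubL: "M \<subseteq> L" by (simp add: M_def)
    have M: "subgroup M G" unfolding M_def by (intro G.subgroups_Inter_pair L conj_subgroup_subgroup H g)
    have memg: "g \<otimes> k \<otimes> inv g \<in> H" if "k \<in> M" for k
      using that conj_subgroup_iff[OF g LG subgroup.subset[OF H]] by (auto simp: M_def)
    have ig: "inv g \<in> carrier G" and xg: "x \<otimes> inv g \<in> carrier G" using g x by auto
    let ?N = "meet2 G H x (inv g)"
    have N: "subgroup ?N G" by (rule meet2_subgroup[OF H ig x])
    note Nmem = meet2_mem[OF H ig x]
    have MN: "g \<otimes> k \<otimes> inv g \<in> ?N" if k: "k \<in> M" for k
    proof -
      have kG: "k \<in> carrier G" using k MsubL LG by blast
      have "inv g \<otimes> (g \<otimes> k \<otimes> inv g) \<otimes> inv (inv g) = k"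
        "(x \<otimes> inv g) \<otimes> (g \<otimes> k \<otimes> inv g) \<otimes> inv (x \<otimes> inv g) = x \<otimes> k \<otimes> inv x"
        using g x kG by (simp_all add: G.inv_mult_group G.m_assoc)
      moreover have "k \<in> H" "x \<otimes> k \<otimes> inv x \<in> H" using k MsubL LH mem by auto
      ultimately show ?thesis using Nmem memg[OF k] by simp
    qed
    have WN: "rep ?N W" by (rule rep_subgroup[OF W N]) (simp add: meet2_def)
    have tN: "rep ?N (twist G (x \<otimes> inv g) W)"
      by (rule rep_twist_H[OF xg N]) (use Nmem in blast)
    have tg: "rep M (twist G g W)" by (rule rep_twist_H[OF g M memg])
    have txM: "rep M (twist G x W)" by (rule rep_subgroup[OF tW M MsubL])
    have xgg: "x \<otimes> inv g \<otimes> g = x" using x g by (simp add: G.m_assoc)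
    \<comment> \<open>The cocycle condition for \<open>x\<close> and \<open>inv g\<close> lives on \<open>W\<close>; the twist by \<open>g\<close> moves it to where \<open>\<phi> g\<close> lives.\<close>
    have "stably_eq M (twist G g W) (twist G g (twist G (x \<otimes> inv g) W))
        (\<lambda>w. \<tau> x (\<tau> (inv g) w)) (\<tau> (x \<otimes> inv g))"
      by (rule stably_eq_twist_subgroup[OF N WN tN g M MN \<tau>_mult[OF ig x]])
    then have "stably_eq M (twist G g W) (twist G x W) (\<lambda>w. \<tau> x (\<tau> (inv g) w)) (\<tau> (x \<otimes> inv g))"
      using stably_eq_twist_twist[OF g xg M tg, unfolded xgg, OF txM] by simp
    then have "stably_eq M Ind (twist G x W) (?F g) (?F' g)"
      by (rule stably_eq_precompose[OF M tg txM _ rep_whole_sub[OF Ind_rep M] eval_hom[OF g M memg]])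
    then show "stably_eq (L \<inter> conj_subgroup G H g) Ind (twist G x W) (?F g) (?F' g)" by (simp add: M_def)
  next
    fix h g \<phi> assume h: "h \<in> H" and g: "g \<in> carrier G" and \<phi>: "\<phi> \<in> carrier Ind"
    show "?F' (h \<otimes> g) \<phi> = ?F' g \<phi>" by (rule inv[OF h g \<phi> x])
    show "?F (h \<otimes> g) \<phi> = ?F g \<phi>" using inv[OF h g \<phi> G.one_closed] h g HG by simp
  next
    fix l g \<phi> assume l: "l \<in> L" and g: "g \<in> carrier G" and \<phi>: "\<phi> \<in> carrier Ind"
    have pg: "\<phi> g \<in> carrier W" by (rule Ind_value[OF \<phi>])
    have lH: "l \<in> H" using l LH by blast
    show "?F' (g \<otimes> inv l) (act Ind l \<phi>) = act (twist G x W) l (?F' g \<phi>)"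
      unfolding shift[OF l g] using conj[OF l g x mem[OF l] pg] by simp
    have "\<tau> (inv (g \<otimes> inv l)) (\<phi> g) = act W l (\<tau> (inv g) (\<phi> g))"
      using conj[OF l g G.one_closed _ pg] lH HG[OF lH] g by simp
    then show "?F (g \<otimes> inv l) (act Ind l \<phi>) = act (twist G x W) l (?F g \<phi>)"
      unfolding shift[OF l g]
      using hom_act[OF \<tau>_hom[OF x] l[unfolded L_def] \<tau>_closed[OF G.inv_closed[OF g] pg]] by simp
  qed
  have cF': "coset_sum G H (twist G x W) (\<lambda>g. ?F' g \<phi>) \<in> carrier (twist G x W)" if \<phi>: "\<phi> \<in> carrier Ind" for \<phi>
    by (rule coset_sum_closed[OF H]) (use \<tau>_closed Ind_value[OF \<phi>] x W.module_axioms in simp_all)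
  have "stably_eq L Ind (twist G x W) (\<lambda>\<phi>. index_inv \<odot>\<^bsub>twist G x W\<^esub> coset_sum G H (twist G x W) (\<lambda>g. ?F g \<phi>))
     (\<lambda>\<phi>. index_inv \<odot>\<^bsub>twist G x W\<^esub> coset_sum G H (twist G x W) (\<lambda>g. ?F' g \<phi>))"
    by (rule stably_eq_postcompose[OF L IL tW sum tW scale_hom[OF tW index_inv(1)] cF'])
  moreover have "j (\<epsilon> \<phi> \<one>) x = index_inv \<odot>\<^bsub>twist G x W\<^esub> coset_sum G H (twist G x W) (\<lambda>g. ?F g \<phi>)"
    if \<phi>: "\<phi> \<in> carrier Ind" for \<phi>
  proof -
    have cl: "\<tau> (\<one> \<otimes> inv g) (\<phi> g) \<in> carrier W" if "g \<in> carrier G" for g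
      using that \<tau>_closed Ind_value[OF \<phi>] by simp
    have s: "coset_sum G H W (\<lambda>g. \<tau> (\<one> \<otimes> inv g) (\<phi> g)) \<in> carrier W"
      by (rule coset_sum_closed[OF H W.module_axioms cl])
    have "j (\<epsilon> \<phi> \<one>) x = index_inv \<odot>\<^bsub>W\<^esub> \<tau> x (coset_sum G H W (\<lambda>g. \<tau> (\<one> \<otimes> inv g) (\<phi> g)))"
      using x \<epsilon>_value[OF \<phi> G.one_closed] lin_smult[OF \<tau>_lin[OF x] index_inv(1) s] by (simp add: j_def)
    also have "\<tau> x (coset_sum G H W (\<lambda>g. \<tau> (\<one> \<otimes> inv g) (\<phi> g)))
      = coset_sum G H W (\<lambda>g. \<tau> x (\<tau> (\<one> \<otimes> inv g) (\<phi> g)))"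
      by (rule coset_sum_apply[OF H W.module_axioms W.module_axioms \<tau>_lin[OF x] cl])
    also have "\<dots> = coset_sum G H W (\<lambda>g. ?F g \<phi>)"
      by (rule coset_sum_cong[OF H W.module_axioms]) (use \<tau>_closed Ind_value[OF \<phi>] x in simp_all)
    finally show ?thesis by simp
  qed
  ultimately have "stably_eq L Ind (twist G x W) (\<lambda>\<phi>. j (\<epsilon> \<phi> \<one>) x) (\<lambda>\<phi>. \<epsilon> \<phi> x)"
    unfolding stably_eq_def using \<epsilon>_value[OF _ x] by simp
  then show "stably_eq (H \<inter> conj_subgroup G H x) Ind (twist G x W) (\<lambda>\<phi>. j (\<epsilon> \<phi> \<one>) x) (\<lambda>\<phi>. \<epsilon> \<phi> x)"
    by (simp add: meet1_conj L_def)
qed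

text \<open>
  Over \<open>H\<close> one has \<open>\<epsilon> \<epsilon> = \<epsilon> j ev\<^sub>1 \<epsilon> = j ev\<^sub>1 \<epsilon> = \<epsilon>\<close>, where \<open>ev\<^sub>1\<close> is evaluation at \<open>1\<close>; faithfulness
  of restriction carries this to \<open>G\<close>.
\<close>

lemma \<epsilon>_idempotent: "stably_eq whole Ind Ind (\<lambda>\<phi>. \<epsilon> (\<epsilon> \<phi>)) \<epsilon>"
proof (rule stably_eq_whole[OF Ind_rep Ind_rep hom_comp[OF \<epsilon>_hom \<epsilon>_hom] \<epsilon>_hom])
  have I: "rep H Ind" by (rule rep_whole_sub[OF Ind_rep H])
  have je: "(\<lambda>\<phi>. j (\<epsilon> \<phi> \<one>)) \<in> hom H Ind Ind" by (rule hom_comp[OF j_eval_hom \<epsilon>_hom_H])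
  have 1: "stably_eq H Ind Ind (\<lambda>\<phi>. \<epsilon> (\<epsilon> \<phi>)) (\<lambda>\<phi>. \<epsilon> (j (\<epsilon> \<phi> \<one>)))"
    by (rule stably_eq_postcompose[OF H I I stably_eq_sym[OF H I I j_\<epsilon> hom_closed[OF \<epsilon>_hom_H]] I \<epsilon>_hom_H hom_closed[OF je]])
  have 2: "stably_eq H Ind Ind (\<lambda>\<phi>. \<epsilon> (j (\<epsilon> \<phi> \<one>))) (\<lambda>\<phi>. j (\<epsilon> \<phi> \<one>))"
    by (rule stably_eq_precompose[OF H W I \<epsilon>_j I hom_comp[OF eval_one_hom \<epsilon>_hom_H]])
  show "stably_eq H Ind Ind (\<lambda>\<phi>. \<epsilon> (\<epsilon> \<phi>)) \<epsilon>"
    by (rule stably_eq_trans[OF H I I 1 stably_eq_trans[OF H I I 2 j_\<epsilon> hom_closed[OF \<epsilon>_hom_H]] hom_closed[OF \<epsilon>_hom_H]])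
qed

text \<open>
  Symmetrisation over \<open>H\<close>: a surjection from all functions onto the functions that are equivariant for
  \<open>H\<close>. The linear section below keeps only the values at the coset representatives.
\<close>

definition cover :: "('g \<Rightarrow> 'w) \<Rightarrow> 'g \<Rightarrow> 'w" where
  "cover q g = (if g \<in> carrier G then (\<Oplus>\<^bsub>W\<^esub>h\<in>H. act W (inv h) (q (h \<otimes> g))) else \<zero>\<^bsub>W\<^esub>)"

definition cover_section_map :: "('g \<Rightarrow> 'w) \<Rightarrow> 'g \<Rightarrow> 'w" where
  "cover_section_map \<phi> g = (if g \<in> carrier G \<and> coset_rep (H #> g) = g then \<phi> g else \<zero>\<^bsub>W\<^esub>)"

text \<open>
  Its trace is the identity, which shows that \<open>Q\<close> is projective.
\<close>

definition at_one :: "('g \<Rightarrow> 'w) \<Rightarrow> 'g \<Rightarrow> 'w" where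
  "at_one q g = (if g = \<one> then q g else \<zero>\<^bsub>W\<^esub>)"

lemma cover_summand:
  assumes "q \<in> carrier Q"
  shows "(\<lambda>h. act W (inv h) (q (h \<otimes> g))) \<in> H \<rightarrow> carrier W"
  using Q_value[OF assms] by (auto intro!: rep_act_closed[OF W] subgroup.m_inv_closed[OF H])

lemma cover_hom: "cover \<in> hom whole Q Ind"
proof -
  have cl: "cover q \<in> carrier Ind" if q: "q \<in> carrier Q" for q
    unfolding Ind_mem
  proof (intro conjI ballI allI impI)
    show "cover q g \<in> carrier W" if "g \<in> carrier G" for g
      using W.M.finsum_closed[OF cover_summand[OF q]] that by (simp add: cover_def)
    fix k g assume k: "k \<in> H" and g: "g \<in> carrier G"
    have kG: "k \<in> carrier G" by (rule HG[OF k])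
    let ?f = "\<lambda>h. act W k (act W (inv h) (q (h \<otimes> g)))"
    have f: "?f \<in> H \<rightarrow> carrier W" using cover_summand[OF q] rep_act_closed[OF W k] by auto
    have img: "(\<lambda>h. h \<otimes> k) ` H = H"
    proof
      show "H \<subseteq> (\<lambda>h. h \<otimes> k) ` H"
      proof
        fix h assume h: "h \<in> H"
        have "h = (h \<otimes> inv k) \<otimes> k" using HG[OF h] kG by (simp add: G.m_assoc)
        moreover have "h \<otimes> inv k \<in> H" by (rule subgroup.m_closed[OF H h subgroup.m_inv_closed[OF H k]])
        ultimately show "h \<in> (\<lambda>h. h \<otimes> k) ` H" by (rule image_eqI)
      qed
    qed (use k in \<open>auto intro: subgroup.m_closed[OF H]\<close>)
    have inj: "inj_on (\<lambda>h. h \<otimes> k) H" using kG HG by (auto intro!: inj_onI)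
    have "cover q (k \<otimes> g) = (\<Oplus>\<^bsub>W\<^esub>h\<in>H. ?f (h \<otimes> k))"
    proof -
      have e: "?f (h \<otimes> k) = act W (inv h) (q (h \<otimes> (k \<otimes> g)))" if h: "h \<in> H" for h
      proof -
        have m: "inv h \<in> H" "inv k \<in> H" "h \<in> carrier G" "inv k \<otimes> inv h \<in> H"
          using h k by (auto intro: subgroup.m_inv_closed[OF H] subgroup.m_closed[OF H] HG)
        show ?thesis
          using rep_act_mult[OF W k m(4) Q_value[OF q], symmetric] m(3) kG g
          by (simp add: G.inv_mult_group G.m_assoc)
      qed
      have "(\<Oplus>\<^bsub>W\<^esub>h\<in>H. ?f (h \<otimes> k)) = (\<Oplus>\<^bsub>W\<^esub>h\<in>H. act W (inv h) (q (h \<otimes> (k \<otimes> g))))"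
        by (rule W.M.finsum_cong'[OF refl cover_summand[OF q] e])
      then show ?thesis using kG g by (simp add: cover_def)
    qed
    also have "\<dots> = finsum W ?f H"
      using W.M.finsum_reindex[OF _ inj, of ?f] f by (simp add: img)
    also have "\<dots> = act W k (cover q g)"
      unfolding cover_def using g cover_summand[OF q, of g]
      by (simp add: lin_finsum[OF W.module_axioms W.module_axioms rep_act_lin[OF W k], symmetric] Pi_iff)
    finally show "cover q (k \<otimes> g) = act W k (cover q g)" .
  qed (simp add: cover_def)
  have ih: "act W (inv h) \<in> lin K W W" if "h \<in> H" for h
    by (rule rep_act_lin[OF W subgroup.m_inv_closed[OF H that]])
  have val: "(\<lambda>q. cover q g) \<in> lin K Q W" if g: "g \<in> carrier G" for g
  proof -
    have "(\<lambda>q. \<Oplus>\<^bsub>W\<^esub>h\<in>H. act W (inv h) (q (h \<otimes> g))) \<in> lin K Q W"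
      by (rule lin_sum[OF Q_module W.module_axioms lin_comp[OF ih]])
        (simp_all add: Q_def fun_gmod_eval_lin[OF W.module_axioms])
    then show ?thesis using g by (simp add: cover_def)
  qed
  have "cover (act Q u q) = act Ind u (cover q)" if u: "u \<in> carrier G" and q: "q \<in> carrier Q" for u q
  proof
    fix g
    show "cover (act Q u q) g = act Ind u (cover q) g"
    proof (cases "g \<in> carrier G")
      case g: True
      have "(\<Oplus>\<^bsub>W\<^esub>h\<in>H. act W (inv h) (act Q u q (h \<otimes> g)))
        = (\<Oplus>\<^bsub>W\<^esub>h\<in>H. act W (inv h) (q (h \<otimes> (g \<otimes> u))))"
        by (rule W.M.finsum_cong'[OF refl cover_summand[OF q]])
          (use u g HG in \<open>simp add: Q_simps(5) G.m_assoc\<close>)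
      then show ?thesis using u g by (simp add: cover_def Ind_simps(5) Q_simps(5))
    qed (simp add: cover_def Ind_simps(5) Q_simps(5))
  qed
  moreover have "cover (q \<oplus>\<^bsub>Q\<^esub> q') = cover q \<oplus>\<^bsub>Ind\<^esub> cover q'" if "q \<in> carrier Q" "q' \<in> carrier Q" for q q'
    using lin_add[OF val that] by (auto simp: Ind_simps Q_simps(3) fun_eq_iff cover_def)
  moreover have "cover (c \<odot>\<^bsub>Q\<^esub> q) = c \<odot>\<^bsub>Ind\<^esub> cover q" if "c \<in> carrier K" "q \<in> carrier Q" for c q
    using lin_smult[OF val that] that(1) by (auto simp: Ind_simps Q_simps(4) fun_eq_iff cover_def)
  ultimately show ?thesis using cl by (auto simp: gmod_hom_iff intro!: linI)
qed

lemma section_lin: "cover_section_map \<in> lin K Ind Q"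
  by (rule linI) (auto simp: cover_section_map_def Ind_simps(3,4) Q_simps(1,3,4) Ind_value fun_eq_iff)

lemma cover_cover_section_map:
  assumes \<phi>: "\<phi> \<in> carrier Ind"
  shows "cover (cover_section_map \<phi>) = \<phi>"
proof
  fix g
  show "cover (cover_section_map \<phi>) g = \<phi> g"
  proof (cases "g \<in> carrier G")
    case g: True
    obtain h0 where h0: "h0 \<in> H" "coset_rep (H #> g) = h0 \<otimes> g" using coset_rep_factor[OF H g] by blast
    have e: "act W (inv h) (cover_section_map \<phi> (h \<otimes> g)) = (if h0 = h then \<phi> g else \<zero>\<^bsub>W\<^esub>)" if h: "h \<in> H" for h
    proof -
      have hG: "h \<in> carrier G" by (rule HG[OF h])
      have "H #> (h \<otimes> g) = (H #> h) #> g"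
        by (rule G.coset_mult_assoc[OF subgroup.subset[OF H] hG g, symmetric])
      also have "\<dots> = H #> g" using G.coset_join2[OF hG H h] by simp
      finally have "coset_rep (H #> (h \<otimes> g)) = h \<otimes> g \<longleftrightarrow> h0 = h"
        using h0 hG HG[OF h0(1)] g by simp
      then show ?thesis
        using hG g Ind_left[OF \<phi> h g] rep_act_inv(1)[OF W H h Ind_value[OF \<phi>]]
          lin_zero[OF W.module_axioms W.module_axioms rep_act_lin[OF W subgroup.m_inv_closed[OF H h]]]
        by (simp add: cover_section_map_def)
    qed
    have "cover (cover_section_map \<phi>) g = (\<Oplus>\<^bsub>W\<^esub>h\<in>H. if h0 = h then \<phi> g else \<zero>\<^bsub>W\<^esub>)"
      using g e Ind_value[OF \<phi>] by (simp add: cover_def cong: W.M.finsum_cong)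
    also have "\<dots> = \<phi> g"
      using W.M.add.finprod_singleton[OF h0(1) finite_subgroup[OF H], of "\<lambda>_. \<phi> g"] Ind_value[OF \<phi>] by simp
    finally show ?thesis .
  next
    case False
    then show ?thesis using \<phi> by (simp add: cover_def Ind_mem)
  qed
qed

lemma at_one_lin: "at_one \<in> lin K Q Q"
  by (rule linI) (auto simp: at_one_def Q_simps(1,3,4) fun_eq_iff)

lemma trace_at_one:
  assumes q: "q \<in> carrier Q"
  shows "trace whole Q Q at_one q = q"
proof
  fix g
  have ev: "(\<lambda>q. q g) \<in> lin K Q W" unfolding Q_def by (rule fun_gmod_eval_lin[OF W.module_axioms])
  have "trace whole Q Q at_one q g = (\<Oplus>\<^bsub>W\<^esub>k\<in>whole. act Q k (at_one (act Q (inv k) q)) g)"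
    unfolding trace_def
    using trace_summand_closed[OF G.subgroup_self Q_rep Q_rep at_one_lin q]
    by (intro lin_finsum[OF Q_module W.module_axioms ev]) auto
  also have "\<dots> = q g"
  proof (cases "g \<in> carrier G")
    case g: True
    have "act Q k (at_one (act Q (inv k) q)) g = (if inv g = k then q g else \<zero>\<^bsub>W\<^esub>)" if k: "k \<in> carrier G" for k
    proof -
      have "g \<otimes> k = \<one> \<longleftrightarrow> inv g = k"
        using g k by (metis G.inv_equality G.r_inv G.inv_inv G.inv_closed)
      then show ?thesis using g k by (auto simp: Q_simps(5) at_one_def)
    qed
    then have "(\<Oplus>\<^bsub>W\<^esub>k\<in>whole. act Q k (at_one (act Q (inv k) q)) g) = (\<Oplus>\<^bsub>W\<^esub>k\<in>whole. if inv g = k then q g else \<zero>\<^bsub>W\<^esub>)"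
      using Q_value[OF q] by (intro W.M.finsum_cong') auto
    also have "\<dots> = q g"
      using W.M.add.finprod_singleton[OF G.inv_closed[OF g] finite_group, of "\<lambda>_. q g"] Q_value[OF q] by simp
    finally show ?thesis .
  next
    case False
    then show ?thesis using q by (simp add: Q_simps(1,5))
  qed
  finally show "trace whole Q Q at_one q g = q g" .
qed

text \<open>
  Let \<open>V\<close> split \<open>\<epsilon>\<close>, with projection to the first entry and the map \<open>inc\<close>. Over \<open>H\<close> the idempotent \<open>\<epsilon>\<close>
  is also split by \<open>W\<close>, through \<open>j\<close> and the evaluation at \<open>1\<close>; this gives \<open>f\<close> and \<open>f'\<close>.
  Compatibility with \<open>s g\<close> holds as \<open>\<tau>\<^sub>g ((\<epsilon> \<phi>) 1) = (j ((\<epsilon> \<phi>) 1)) g\<close> agrees stably with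
  \<open>(\<epsilon> \<phi>) g\<close>.
\<close>

theorem model_exists:
  "\<exists>(V :: ('k, nat \<Rightarrow> 'g \<Rightarrow> 'w, 'g) gmod) f f'. models V f f'"
proof -
  interpret E: stable_idempotent K G Q S \<epsilon> cover cover_section_map at_one
  proof (rule stable_idempotent.intro[OF group_algebra_axioms stable_idempotent_axioms.intro])
    show "rep whole Q" by (rule Q_rep)
    show "S \<subseteq> carrier Q" by (auto simp: S_def)
    show "rep whole (Q\<lparr>carrier := S\<rparr>)" using Ind_rep by (simp add: Ind_def)
    show "\<epsilon> \<in> hom whole (Q\<lparr>carrier := S\<rparr>) (Q\<lparr>carrier := S\<rparr>)" using \<epsilon>_hom by (simp add: Ind_def)
    show "cover \<in> hom whole Q (Q\<lparr>carrier := S\<rparr>)" using cover_hom by (simp add: Ind_def)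
    show "cover_section_map \<in> lin K (Q\<lparr>carrier := S\<rparr>) Q" using section_lin by (simp add: Ind_def)
    show "cover (cover_section_map x) = x" if "x \<in> S" for x using cover_cover_section_map that by (simp add: Ind_simps)
    show "at_one \<in> lin K Q Q" by (rule at_one_lin)
    show "trace whole Q Q at_one q = q" if "q \<in> carrier Q" for q by (rule trace_at_one[OF that])
    show "stably_eq whole (Q\<lparr>carrier := S\<rparr>) (Q\<lparr>carrier := S\<rparr>) (\<lambda>x. \<epsilon> (\<epsilon> x)) \<epsilon>"
      using \<epsilon>_idempotent by (simp add: Ind_def)
  qed
  \<comment> \<open>The first coordinate is the projection, and \<open>\<epsilon>\<close> acts stably as the identity on it.\<close>
  have EI: "E.I = Ind" by (simp add: E.I_def Ind_def)
  let ?V = E.V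
  have HGs: "H \<subseteq> carrier G" by (rule subgroup.subset[OF H])
  have V: "rep whole ?V" by (rule E.V_rep)
  have VH: "rep H ?V" by (rule rep_whole_sub[OF V H])
  have IH: "rep H Ind" by (rule rep_whole_sub[OF Ind_rep H])
  have p: "(\<lambda>\<psi>. \<psi> 0) \<in> hom whole ?V Ind" using E.zero_coord_hom unfolding EI .
  have pH: "(\<lambda>\<psi>. \<psi> 0) \<in> hom H ?V Ind" by (rule hom_subgroup[OF p HGs])
  have inc: "E.inc \<in> hom whole Ind ?V" using E.inc_hom unfolding EI .
  have incH: "E.inc \<in> hom H Ind ?V" by (rule hom_subgroup[OF inc HGs])
  have p\<epsilon>: "stably_eq whole ?V Ind (\<lambda>\<psi>. \<psi> 0) (\<lambda>\<psi>. \<epsilon> (\<psi> 0))"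
    using E.even_coord_stable[of 0] unfolding EI by simp
  have p\<epsilon>L: "stably_eq L ?V Ind (\<lambda>\<psi>. \<psi> 0) (\<lambda>\<psi>. \<epsilon> (\<psi> 0))" if "subgroup L G" for L
    by (rule stably_eq_subgroup[OF G.subgroup_self V Ind_rep p\<epsilon> that subgroup.subset[OF that]])
  have \<epsilon>pL: "stably_eq L ?V Ind (\<lambda>\<psi>. \<epsilon> (\<psi> 0)) (\<lambda>\<psi>. \<psi> 0)" if L: "subgroup L G" for L
  proof (rule stably_eq_sym[OF L rep_whole_sub[OF V L] rep_whole_sub[OF Ind_rep L] p\<epsilon>L[OF L]])
    show "\<epsilon> (\<psi> 0) \<in> carrier Ind" if "\<psi> \<in> carrier ?V" for \<psi>
      by (rule hom_closed[OF \<epsilon>_hom hom_closed[OF p that]])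
  qed
  have incp: "stably_eq H ?V ?V (\<lambda>\<psi>. E.inc (\<psi> 0)) (\<lambda>\<psi>. \<psi>)"
    by (rule stably_eq_subgroup[OF G.subgroup_self V V E.inc_coord H HGs])
  define f where "f = (\<lambda>\<psi> :: nat \<Rightarrow> 'g \<Rightarrow> 'w. \<psi> 0 \<one>)"
  define f' where "f' = (\<lambda>w. E.inc (j w))"
  have f: "f \<in> hom H ?V W" unfolding f_def by (rule hom_comp[OF eval_one_hom pH])
  have f': "f' \<in> hom H W ?V" unfolding f'_def by (rule hom_comp[OF incH j_hom])
  have ep: "(\<lambda>\<psi>. \<epsilon> (\<psi> 0)) \<in> hom H ?V Ind" by (rule hom_comp[OF \<epsilon>_hom_H pH])
  have cl\<epsilon>: "\<epsilon> (\<psi> 0) \<in> carrier Ind" if "\<psi> \<in> carrier ?V" for \<psi> by (rule hom_closed[OF ep that])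
  have cl0: "\<psi> 0 \<in> carrier Ind" if "\<psi> \<in> carrier ?V" for \<psi> by (rule hom_closed[OF pH that])
  have ff': "stably_eq H W W (\<lambda>w. f (f' w)) (\<lambda>w. w)"
  proof -
    have 0: "f (f' w) = \<epsilon> (j w) \<one>" for w by (simp add: f_def f'_def E.inc_def)
    have 1: "stably_eq H W W (\<lambda>w. \<epsilon> (j w) \<one>) (\<lambda>w. j w \<one>)"
      by (rule stably_eq_postcompose[OF H W IH \<epsilon>_j W eval_one_hom hom_closed[OF j_hom]])
    have 2: "(\<lambda>w. j w \<one>) = \<tau> \<one>" by (simp add: j_def fun_eq_iff)
    show ?thesis unfolding 0 by (rule stably_eq_trans[OF H W W 1[unfolded 2] \<tau>_one])
  qed
  have f'f: "stably_eq H ?V ?V (\<lambda>\<psi>. f' (f \<psi>)) (\<lambda>\<psi>. \<psi>)"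
  proof -
    have ij: "(\<lambda>\<phi>. E.inc (j (\<phi> \<one>))) \<in> hom H Ind ?V" by (rule hom_comp[OF incH j_eval_hom])
    have 1: "stably_eq H ?V ?V (\<lambda>\<psi>. f' (f \<psi>)) (\<lambda>\<psi>. E.inc (j (\<epsilon> (\<psi> 0) \<one>)))"
      unfolding f_def f'_def by (rule stably_eq_postcompose[OF H VH IH p\<epsilon>L[OF H] VH ij]) (rule cl\<epsilon>)
    have "stably_eq H ?V Ind (\<lambda>\<psi>. j (\<epsilon> (\<psi> 0) \<one>)) (\<lambda>\<psi>. \<epsilon> (\<psi> 0))"
      by (rule stably_eq_precompose[OF H IH IH j_\<epsilon> VH pH])
    then have 2: "stably_eq H ?V ?V (\<lambda>\<psi>. E.inc (j (\<epsilon> (\<psi> 0) \<one>))) (\<lambda>\<psi>. E.inc (\<epsilon> (\<psi> 0)))"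
      by (rule stably_eq_postcompose[OF H VH IH _ VH incH]) (rule cl\<epsilon>)
    have 3: "stably_eq H ?V ?V (\<lambda>\<psi>. E.inc (\<epsilon> (\<psi> 0))) (\<lambda>\<psi>. E.inc (\<psi> 0))"
      by (rule stably_eq_postcompose[OF H VH IH \<epsilon>pL[OF H] VH incH]) (rule cl0)
    show ?thesis
      by (rule stably_eq_trans[OF H VH VH 1 stably_eq_trans[OF H VH VH 2 stably_eq_trans[OF H VH VH 3 incp]]])
  qed
  have "stably_eq (meet1 G H g) ?V (twist G g W) (\<lambda>\<psi>. s g (f \<psi>)) (\<lambda>\<psi>. f (act ?V g \<psi>))" if g: "g \<in> carrier G" for g
  proof -
    define L where "L = meet1 G H g"
    have L: "subgroup L G" and LH: "L \<subseteq> H" using meet1_subgroup[OF H g] meet1_sub by (simp_all add: L_def)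
    have mem: "g \<otimes> k \<otimes> inv g \<in> H" if "k \<in> L" for k using that meet1_H_mem[OF g] by (simp add: L_def)
    have WL: "rep L W" by (rule rep_subgroup[OF W L LH])
    have tW: "rep L (twist G g W)" by (rule rep_twist_H[OF g L mem])
    have VL: "rep L ?V" and IL: "rep L Ind" by (rule rep_whole_sub[OF V L] rep_whole_sub[OF Ind_rep L])+
    have fL: "f \<in> hom L ?V W" by (rule hom_subgroup[OF f LH])
    have tg: "\<tau> g \<in> hom L W (twist G g W)" using \<tau>_hom[OF g] by (simp add: L_def)
    have eg: "(\<lambda>\<phi>. \<phi> g) \<in> hom L Ind (twist G g W)" by (rule eval_hom[OF g L mem])
    have clt: "\<tau> g w \<in> carrier (twist G g W)" if "w \<in> carrier W" for w using \<tau>_closed[OF g that] by simp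
    have cls: "s g w \<in> carrier (twist G g W)" if "w \<in> carrier W" for w using lin_closed[OF s_lin[OF g] that] by simp
    have "stably_eq L W (twist G g W) (s g) (\<tau> g)"
      by (rule stably_eq_sym[OF L WL tW \<tau>_stably_eq[OF g, folded L_def] cls])
    then have 1: "stably_eq L ?V (twist G g W) (\<lambda>\<psi>. s g (f \<psi>)) (\<lambda>\<psi>. \<tau> g (\<psi> 0 \<one>))"
      using stably_eq_precompose[OF L WL tW _ VL fL] unfolding f_def by blast
    have te: "(\<lambda>\<phi>. \<tau> g (\<phi> \<one>)) \<in> hom L Ind (twist G g W)"
      by (rule hom_comp[OF tg hom_subgroup[OF eval_one_hom LH]])
    have 2: "stably_eq L ?V (twist G g W) (\<lambda>\<psi>. \<tau> g (\<psi> 0 \<one>)) (\<lambda>\<psi>. \<tau> g (\<epsilon> (\<psi> 0) \<one>))"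
      by (rule stably_eq_postcompose[OF L VL IL p\<epsilon>L[OF L] tW te]) (rule cl\<epsilon>)
    have "stably_eq L Ind Ind (\<lambda>\<phi>. j (\<epsilon> \<phi> \<one>)) \<epsilon>"
      by (rule stably_eq_subgroup[OF H IH IH j_\<epsilon> L LH])
    then have "stably_eq L Ind (twist G g W) (\<lambda>\<phi>. j (\<epsilon> \<phi> \<one>) g) (\<lambda>\<phi>. \<epsilon> \<phi> g)"
      by (rule stably_eq_postcompose[OF L IL IL _ tW eg hom_closed[OF \<epsilon>_hom]])
    then have "stably_eq L Ind (twist G g W) (\<lambda>\<phi>. \<tau> g (\<epsilon> \<phi> \<one>)) (\<lambda>\<phi>. \<epsilon> \<phi> g)"
      using g by (simp add: j_def)
    then have 3: "stably_eq L ?V (twist G g W) (\<lambda>\<psi>. \<tau> g (\<epsilon> (\<psi> 0) \<one>)) (\<lambda>\<psi>. \<epsilon> (\<psi> 0) g)"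
      by (rule stably_eq_precompose[OF L IL tW _ VL hom_subgroup[OF pH LH]])
    have 4: "stably_eq L ?V (twist G g W) (\<lambda>\<psi>. \<epsilon> (\<psi> 0) g) (\<lambda>\<psi>. \<psi> 0 g)"
      by (rule stably_eq_postcompose[OF L VL IL \<epsilon>pL[OF L] tW eg]) (rule cl0)
    have 5: "f (act ?V g \<psi>) = \<psi> 0 g" for \<psi>
      using g by (simp add: f_def E.V_simps Q_simps(5))
    have c: "\<psi> 0 g \<in> carrier (twist G g W)" if "\<psi> \<in> carrier ?V" for \<psi> using Ind_value[OF cl0[OF that]] by simp
    have c\<epsilon>: "\<epsilon> (\<psi> 0) g \<in> carrier (twist G g W)" if "\<psi> \<in> carrier ?V" for \<psi> using Ind_value[OF cl\<epsilon>[OF that]] by simp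
    show ?thesis
      unfolding L_def[symmetric] 5
      by (rule stably_eq_trans[OF L VL tW 1 stably_eq_trans[OF L VL tW 2 stably_eq_trans[OF L VL tW 3 4]]]) (rule c, assumption)+
  qed
  then have "models ?V f f'"
    unfolding models_def using V f f' ff' f'f by blast
  then show ?thesis by blast
qed

end

section \<open>Extensions of a module along a descent datum\<close>

context stable_descent
begin

lemma extension_iff_models:
  assumes \<sigma>: "\<And>g. g \<in> carrier G \<Longrightarrow> \<sigma> g = cls (meet1 G H g) W (twist G g W) (s g)"
  shows "extension K G H W \<sigma> V F \<longleftrightarrow> (\<exists>f f'. models V f f' \<and> F = cls H V W f)"
proof -
  have square: "(stab_comp K (G\<lparr>carrier := meet1 G H g\<rparr>) V (twist G g W)
          (\<sigma> g) (stab_res K G (meet1 G H g) V W (cls H V W f))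
        = stab_comp K (G\<lparr>carrier := meet1 G H g\<rparr>) V (twist G g W)
            (stab_twres K G g (meet1 G H g) V W (cls H V W f))
            (cls (meet1 G H g) V (twist G g V) (act V g))) \<longleftrightarrow>
      stably_eq (meet1 G H g) V (twist G g W) (\<lambda>v. s g (f v)) (\<lambda>v. f (act V g v))"
    if V: "rep whole V" and f: "f \<in> hom H V W" and g: "g \<in> carrier G" for f g
  proof -
    define L where "L = meet1 G H g"
    have L: "subgroup L G" and LH: "L \<subseteq> H" and LG: "L \<subseteq> carrier G"
      and mem: "\<And>k. k \<in> L \<Longrightarrow> g \<otimes> k \<otimes> inv g \<in> H"
      using meet1_subgroup[OF H g] meet1_sub meet1_H_mem[OF g] subgroup.subset[OF H]
      unfolding L_def by auto
    note VH = rep_whole_sub[OF V H] and VL = rep_whole_sub[OF V L] and WL = rep_subgroup[OF W L LH]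
    have tV: "rep L (twist G g V)" by (rule rep_twist_whole[OF V g L])
    have tW: "rep L (twist G g W)" by (rule rep_twist_H[OF g L mem])
    have fL: "f \<in> hom L V W" by (rule hom_subgroup[OF f LH])
    have tf: "f \<in> hom L (twist G g V) (twist G g W)" by (rule hom_twist[OF f g mem])
    have sg: "s g \<in> hom L W (twist G g W)" using s_hom[OF g] by (simp add: L_def)
    have ag: "act V g \<in> hom L V (twist G g V)" by (rule act_hom_twist(1)[OF V g LG])
    have tw: "stab_twres K G g L V W (cls H V W f) = cls L (twist G g V) (twist G g W) f"
      by (rule stab_twres_cls[OF H VH W f g L mem])
    show ?thesis
      unfolding \<sigma>[OF g] L_def[symmetric] stab_res_cls[OF H VH W f L LH] tw
        stab_comp_cls[OF L VL WL tW sg fL] stab_comp_cls[OF L VL tV tW tf ag]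
      by (rule cls_eq_iff[OF L VL tW hom_comp[OF sg fL] hom_comp[OF tf ag]])
  qed
  show ?thesis
  proof
    assume ext: "extension K G H W \<sigma> V F"
    then have V: "rep whole V" by (simp add: extension_def)
    note VH = rep_whole_sub[OF V H]
    have F: "F \<in> stab_iso K (G\<lparr>carrier := H\<rparr>) V W" using ext by (simp add: extension_def)
    then obtain f where f: "f \<in> hom H V W" "F = cls H V W f" using stab_isoD by blast
    obtain f' where f': "f' \<in> hom H W V" "stably_eq H V V (\<lambda>v. f' (f v)) (\<lambda>v. v)"
        "stably_eq H W W (\<lambda>w. f (f' w)) (\<lambda>w. w)"
      using F stab_iso_cls[OF H VH W f(1)] f(2) by blast
    have "stably_eq (meet1 G H g) V (twist G g W) (\<lambda>v. s g (f v)) (\<lambda>v. f (act V g v))" if "g \<in> carrier G" for g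
      using square[OF V f(1) that] ext that by (simp add: extension_def f(2))
    then have "models V f f'" unfolding models_def using V f f' by blast
    then show "\<exists>f f'. models V f f' \<and> F = cls H V W f" using f(2) by blast
  next
    assume "\<exists>f f'. models V f f' \<and> F = cls H V W f"
    then obtain f f' where M: "models V f f'" and F: "F = cls H V W f" by blast
    have V: "rep whole V" and f: "f \<in> hom H V W"
      and sq: "\<And>g. g \<in> carrier G \<Longrightarrow>
        stably_eq (meet1 G H g) V (twist G g W) (\<lambda>v. s g (f v)) (\<lambda>v. f (act V g v))"
      using M by (auto simp: models_def)
    have "F \<in> stab_iso K (G\<lparr>carrier := H\<rparr>) V W"
      unfolding F stab_iso_cls[OF H rep_whole_sub[OF V H] W f] using M by (auto simp: models_def)
    then show "extension K G H W \<sigma> V F"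
      unfolding extension_def using V square[OF V f] sq by (simp add: F)
  qed
qed

lemma comparison_class:
  assumes M: "models V f f'" and M': "models V' e e'" and w: "w \<in> hom whole V V'"
  shows "stab_comp K (G\<lparr>carrier := H\<rparr>) V W (cls H V' W e) (stab_res K G H V V' (cls whole V V' w))
      = cls H V W f \<longleftrightarrow> stably_eq H V V' w (\<lambda>x. e' (f x))"
proof -
  have V: "rep whole V" and f: "f \<in> hom H V W" and V': "rep whole V'" and e: "e \<in> hom H V' W"
    using M M' by (auto simp: models_def)
  note VH = rep_whole_sub[OF V H] and V'H = rep_whole_sub[OF V' H]
  have wH: "w \<in> hom H V V'" by (rule hom_subgroup[OF w subgroup.subset[OF H]])
  show ?thesis
    unfolding stab_res_cls[OF G.subgroup_self V V' w H subgroup.subset[OF H]]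
      stab_comp_cls[OF H VH V'H W e wH] cls_eq_iff[OF H VH W hom_comp[OF e wH] f]
    by (rule comparison_iff[OF M M' w])
qed

text \<open>
  By \<open>comparison_class\<close> the condition on \<open>v\<close> determines its restriction to \<open>H\<close>, and restriction to \<open>H\<close> is
  faithful.
\<close>

lemma unique_comparison:
  assumes M: "models V f f'" and M': "models V' e e'"
  shows "\<exists>!v. v \<in> stab_iso K G V V' \<and>
    stab_comp K (G\<lparr>carrier := H\<rparr>) V W (cls H V' W e) (stab_res K G H V V' v) = cls H V W f"
proof -
  have V: "rep whole V" and f: "f \<in> hom H V W" and V': "rep whole V'" and e': "e' \<in> hom H W V'"
    using M M' by (auto simp: models_def)
  note VH = rep_whole_sub[OF V H] and V'H = rep_whole_sub[OF V' H]
  obtain w where w: "w \<in> hom whole V V'" "stably_eq H V V' w (\<lambda>x. e' (f x))"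
    using comparison[OF M M'] by blast
  obtain w' where w': "w' \<in> hom whole V' V" "stably_eq H V' V w' (\<lambda>x. f' (e x))"
    using comparison[OF M' M] by blast
  have iso: "cls whole V V' w \<in> stab_iso K (G\<lparr>carrier := whole\<rparr>) V V'"
    unfolding stab_iso_cls[OF G.subgroup_self V V' w(1)]
    using w'(1) comparison_inverse[OF M M' w w'] comparison_inverse[OF M' M w' w] by blast
  show ?thesis
  proof (rule ex1I[of _ "cls whole V V' w"], intro conjI)
    show "cls whole V V' w \<in> stab_iso K G V V'" using iso by simp
    show "stab_comp K (G\<lparr>carrier := H\<rparr>) V W (cls H V' W e) (stab_res K G H V V' (cls whole V V' w)) = cls H V W f"
      using comparison_class[OF M M' w(1)] w(2) by simp
    fix v
    assume v: "v \<in> stab_iso K G V V' \<and>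
      stab_comp K (G\<lparr>carrier := H\<rparr>) V W (cls H V' W e) (stab_res K G H V V' v) = cls H V W f"
    then have "v \<in> stab_iso K (G\<lparr>carrier := whole\<rparr>) V V'" by simp
    then obtain x where x: "x \<in> hom whole V V'" "v = cls whole V V' x" using stab_isoD by blast
    have xs: "stably_eq H V V' x (\<lambda>x. e' (f x))"
      using comparison_class[OF M M' x(1)] v x(2) by blast
    have cl: "w y \<in> carrier V'" if "y \<in> carrier V" for y by (rule hom_closed[OF w(1) that])
    have cl': "e' (f y) \<in> carrier V'" if "y \<in> carrier V" for y
      by (rule hom_closed[OF e' hom_closed[OF f that]])
    have "stably_eq H V V' x w"
      by (rule stably_eq_trans[OF H VH V'H xs stably_eq_sym[OF H VH V'H w(2)]]) (rule cl' cl, assumption)+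
    then have "stably_eq whole V V' x w" by (rule stably_eq_whole[OF V V' x(1) w(1)])
    then show "v = cls whole V V' w"
      using cls_eq_iff[OF G.subgroup_self V V' x(1) w(1)] x(2) by blast
  qed
qed

end

text \<open>
  The iterated twist in the cocycle condition and the twist by the product have the same action on \<open>G\<close>,
  so they have the same stable morphisms.
\<close>

lemma (in invertible_index) descent_datum_representatives:
  fixes W :: "('k, 'w, 'g) gmod"
  assumes W: "rep H W" and datum: "descent_datum K G H W \<sigma>"
  shows "\<exists>s. stable_descent K G H W s \<and>
    (\<forall>g\<in>carrier G. \<sigma> g = cls (meet1 G H g) W (twist G g W) (s g))"
proof -
  have iso: "\<sigma> g \<in> stab_iso K (G\<lparr>carrier := meet1 G H g\<rparr>) W (twist G g W)" if "g \<in> carrier G" for g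
    using datum that by (simp add: descent_datum_def)
  have \<sigma>H: "\<sigma> h = cls H W (twist G h W) (act W h)" if "h \<in> H" for h
    using datum that by (simp add: descent_datum_def)
  have \<sigma>mult: "stab_comp K (G\<lparr>carrier := meet2 G H g2 g1\<rparr>) W (twist G (g2 \<otimes> g1) W)
          (stab_twres K G g1 (meet2 G H g2 g1) W (twist G g2 W) (\<sigma> g2))
          (stab_res K G (meet2 G H g2 g1) W (twist G g1 W) (\<sigma> g1))
        = stab_res K G (meet2 G H g2 g1) W (twist G (g2 \<otimes> g1) W) (\<sigma> (g2 \<otimes> g1))"
    if "g1 \<in> carrier G" "g2 \<in> carrier G" for g1 g2
    using datum that by (simp add: descent_datum_def)
  have "\<forall>g\<in>carrier G. \<exists>f. f \<in> hom (meet1 G H g) W (twist G g W) \<and> \<sigma> g = cls (meet1 G H g) W (twist G g W) f"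
    using iso stab_isoD by blast
  then obtain s where s: "\<And>g. g \<in> carrier G \<Longrightarrow> s g \<in> hom (meet1 G H g) W (twist G g W)"
    "\<And>g. g \<in> carrier G \<Longrightarrow> \<sigma> g = cls (meet1 G H g) W (twist G g W) (s g)"
    by metis
  have HG: "h \<in> carrier G" if "h \<in> H" for h using H that by (rule subgroup.mem_carrier)
  have tw: "rep L (twist G g W)" if "g \<in> carrier G" "subgroup L G" "\<And>k. k \<in> L \<Longrightarrow> g \<otimes> k \<otimes> inv g \<in> H" for L g
    by (rule rep_twist[OF W that(2,1,3)])
  have "stable_descent K G H W s"
  proof (rule stable_descent.intro[OF invertible_index_axioms stable_descent_axioms.intro])
    show "rep H W" by (rule W)
    show "s g \<in> hom (meet1 G H g) W (twist G g W)" if "g \<in> carrier G" for g by (rule s(1)[OF that])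
    show "stably_eq H W (twist G h W) (s h) (act W h)" if h: "h \<in> H" for h
    proof -
      have m: "meet1 G H h = H" by (rule meet1_H[OF H h])
      have t: "rep H (twist G h W)"
        by (rule tw[OF HG[OF h] H]) (use h in \<open>simp add: subgroup.m_closed[OF H] subgroup.m_inv_closed[OF H]\<close>)
      have eq: "cls H W (twist G h W) (s h) = cls H W (twist G h W) (act W h)"
        using s(2)[OF HG[OF h]] \<sigma>H[OF h] m by simp
      have "s h \<in> cls H W (twist G h W) (s h)"
        using cls_mem[OF H W t] stably_eq_refl[OF H W t] s(1)[OF HG[OF h]] m by simp
      then have a: "act W h \<in> hom H W (twist G h W)" using eq cls_mem[OF H W t] by blast
      show ?thesis using cls_eq_iff[OF H W t _ a] s(1)[OF HG[OF h]] m eq by simp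
    qed
    show "stably_eq (meet2 G H g2 g1) W (twist G (g2 \<otimes> g1) W) (\<lambda>w. s g2 (s g1 w)) (s (g2 \<otimes> g1))"
      if g1: "g1 \<in> carrier G" and g2: "g2 \<in> carrier G" for g1 g2
    proof -
      define L where "L = meet2 G H g2 g1"
      have g: "g2 \<otimes> g1 \<in> carrier G" using g1 g2 by simp
      have L: "subgroup L G" by (simp add: L_def meet2_subgroup[OF H g1 g2])
      note mem = meet2_mem[OF H g1 g2, folded L_def]
      have LH: "L \<subseteq> H" and L1: "L \<subseteq> meet1 G H g1" and L21: "L \<subseteq> meet1 G H (g2 \<otimes> g1)"
        using mem meet1_mem[OF H g1] meet1_mem[OF H g] by blast+
      have c1: "g1 \<otimes> k \<otimes> inv g1 \<in> H" if "k \<in> L" for k using mem that by blast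
      have c21: "(g2 \<otimes> g1) \<otimes> k \<otimes> inv (g2 \<otimes> g1) \<in> H" if "k \<in> L" for k using mem that by blast
      have c2: "g1 \<otimes> k \<otimes> inv g1 \<in> meet1 G H g2" if k: "k \<in> L" for k
      proof -
        have "k \<in> carrier G" using k LH HG by blast
        then have "g2 \<otimes> (g1 \<otimes> k \<otimes> inv g1) \<otimes> inv g2
          = (g2 \<otimes> g1) \<otimes> k \<otimes> inv (g2 \<otimes> g1)"
          using g1 g2 by (simp add: G.inv_mult_group G.m_assoc)
        then show ?thesis using meet1_mem[OF H g2] c1[OF k] c21[OF k] by simp
      qed
      note WL = rep_subgroup[OF W L LH]
      have t1: "rep L (twist G g1 W)" by (rule tw[OF g1 L c1])
      have t21: "rep L (twist G (g2 \<otimes> g1) W)" by (rule tw[OF g L c21])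
      note M1 = meet1_subgroup[OF H g1] and M2 = meet1_subgroup[OF H g2] and M = meet1_subgroup[OF H g]
      have R: "rep (meet1 G H x) W" "rep (meet1 G H x) (twist G x W)" if x: "x \<in> carrier G" for x
      proof -
        show "rep (meet1 G H x) W"
          by (rule rep_subgroup[OF W meet1_subgroup[OF H x]]) (simp add: meet1_def)
        show "rep (meet1 G H x) (twist G x W)"
          by (rule tw[OF x meet1_subgroup[OF H x]]) (use meet1_mem[OF H x] in blast)
      qed
      have s1: "s g1 \<in> hom L W (twist G g1 W)" by (rule hom_subgroup[OF s(1)[OF g1] L1])
      have s21: "s (g2 \<otimes> g1) \<in> hom L W (twist G (g2 \<otimes> g1) W)" by (rule hom_subgroup[OF s(1)[OF g] L21])
      have "s g2 \<in> hom L (twist G g1 W) (twist G g1 (twist G g2 W))" by (rule hom_twist[OF s(1)[OF g2] g1 c2])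
      then have s2: "s g2 \<in> hom L (twist G g1 W) (twist G (g2 \<otimes> g1) W)"
        by (rule hom_twist_twist[OF g1 g2 L, THEN iffD1])
      have tt: "cls L (twist G g1 W) (twist G g1 (twist G g2 W)) (s g2) = cls L (twist G g1 W) (twist G (g2 \<otimes> g1) W) (s g2)"
        by (subst twist_twist_update, rule cls_cod_act_update[OF L t1 t21])
          (rule twist_twist_act[OF g1 g2 subgroup.mem_carrier[OF L]])
      have tr: "stab_twres K G g1 L W (twist G g2 W) (cls (meet1 G H g2) W (twist G g2 W) (s g2))
        = cls L (twist G g1 W) (twist G g1 (twist G g2 W)) (s g2)"
        by (rule stab_twres_cls[OF M2 R[OF g2] s(1)[OF g2] g1 L c2])
      have "cls L W (twist G (g2 \<otimes> g1) W) (\<lambda>w. s g2 (s g1 w)) = cls L W (twist G (g2 \<otimes> g1) W) (s (g2 \<otimes> g1))"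
        using \<sigma>mult[OF g1 g2]
        unfolding L_def[symmetric] s(2)[OF g1] s(2)[OF g2] s(2)[OF g]
          tr tt
          stab_res_cls[OF M1 R[OF g1] s(1)[OF g1] L L1] stab_res_cls[OF M R[OF g] s(1)[OF g] L L21]
          stab_comp_cls[OF L WL t1 t21 s2 s1] .
      then show ?thesis
        using cls_eq_iff[OF L WL t21 hom_comp[OF s2 s1] s21] unfolding L_def by simp
    qed
  qed
  then show ?thesis using s(2) by blast
qed

theorem theorem1p4:
  fixes K :: "('k, 'c) ring_scheme" and G :: "('g, 'd) monoid_scheme" and H :: "'g set"
    and p :: nat and W :: "('k, 'w, 'g) gmod" and \<sigma> :: "'g \<Rightarrow> ('w \<Rightarrow> 'w) set"
  assumes "group G" and "finite (carrier G)"
    and "prime p"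
    and "field K" and "has_char K p"
    and "subgroup H G" and "coprime p (card (rcosets\<^bsub>G\<^esub> H))"
    and "gmodule K (G\<lparr>carrier := H\<rparr>) W"
    and "descent_datum K G H W \<sigma>"
  shows "(\<exists>(V :: ('k, nat \<Rightarrow> 'g \<Rightarrow> 'w, 'g) gmod) f. extension K G H W \<sigma> V f) \<and>
    (\<forall>(V :: ('k, 'u, 'g) gmod) f (V' :: ('k, 'v, 'g) gmod) f'.
       extension K G H W \<sigma> V f \<and> extension K G H W \<sigma> V' f' \<longrightarrow>
       (\<exists>!v. v \<in> stab_iso K G V V' \<and>
             stab_comp K (G\<lparr>carrier := H\<rparr>) V W f' (stab_res K G H V V' v) = f))"
proof -
  have "\<not> p dvd card (rcosets\<^bsub>G\<^esub> H)"
    using \<open>prime p\<close> \<open>coprime p (card (rcosets\<^bsub>G\<^esub> H))\<close> by (meson coprime_absorb_left not_prime_unit)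
  then have index: "[card (rcosets\<^bsub>G\<^esub> H)] \<cdot>\<^bsub>K\<^esub> \<one>\<^bsub>K\<^esub> \<noteq> \<zero>\<^bsub>K\<^esub>"
    using \<open>has_char K p\<close> by (simp add: has_char_def)
  interpret invertible_index K G H
    using assms(1,2,4,6) index
    by (intro invertible_index.intro group_algebra.intro invertible_index_axioms.intro)
  obtain s where "stable_descent K G H W s"
    and \<sigma>: "\<And>g. g \<in> carrier G \<Longrightarrow> \<sigma> g = cls (meet1 G H g) W (twist G g W) (s g)"
    using descent_datum_representatives[OF assms(8,9)] by blast
  then interpret D: stable_descent K G H W s by blast
  have "\<exists>(V :: ('k, nat \<Rightarrow> 'g \<Rightarrow> 'w, 'g) gmod) f. extension K G H W \<sigma> V f"
  proof -
    obtain V :: "('k, nat \<Rightarrow> 'g \<Rightarrow> 'w, 'g) gmod" and a a' where "D.models V a a'"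
      using D.model_exists by blast
    then have "\<exists>f f'. D.models V f f' \<and> cls H V W a = cls H V W f" by blast
    then have "extension K G H W \<sigma> V (cls H V W a)"
      by (rule D.extension_iff_models[of \<sigma>, OF \<sigma>, THEN iffD2, rotated])
    then show ?thesis by (intro exI)
  qed
  moreover have "\<exists>!v. v \<in> stab_iso K G V V' \<and>
      stab_comp K (G\<lparr>carrier := H\<rparr>) V W f' (stab_res K G H V V' v) = f"
    if ext: "extension K G H W \<sigma> V f" "extension K G H W \<sigma> V' f'"
    for V :: "('k, 'u, 'g) gmod" and f and V' :: "('k, 'v, 'g) gmod" and f'
  proof -
    obtain a a' where a: "D.models V a a'" "f = cls H V W a"
      using D.extension_iff_models[of \<sigma>, OF \<sigma>, THEN iffD1, OF _ ext(1)] by blast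
    obtain b b' where b: "D.models V' b b'" "f' = cls H V' W b"
      using D.extension_iff_models[of \<sigma>, OF \<sigma>, THEN iffD1, OF _ ext(2)] by blast
    show ?thesis unfolding a(2) b(2) by (rule D.unique_comparison[OF a(1) b(1)])
  qed
  ultimately show ?thesis by blast
qed

end
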